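(* Let $\frac12\le\beta<1$ and let $S_t$ follow the CEV model $dS_t=(r-q)S_t\,dt+\sigma S_t^\beta\,dW_t$ with $S_0>0$. Let $C_f(T)$ and $P_f(T)$ be the prices of the at-the-money floating strike Asian call and put options, i.e. with parameter $\kappa=1$ and maturity $T$. Then, as $T\to0$, $$C_f(T)=\sigma S_0^\beta\frac{\sqrt T}{\sqrt{6\pi}}+O(T),\qquad P_f(T)=\sigma S_0^\beta\frac{\sqrt T}{\sqrt{6\pi}}+O(T).$$
   Context: $W$ is a standard Brownian motion with $W_0=0$; $r\ge0$, $q\ge0$, $\sigma>0$ are constants; $S$ is the (unique) nonnegative solution of the stated SDE. The floating strike Asian option prices with parameter $\kappa$ are $$C_f(T)=e^{-rT}\mathbb{E}\left[\left(\kappa S_T-\tfrac1T\int_0^TS_t\,dt\right)^+\right],\qquad P_f(T)=e^{-rT}\mathbb{E}\left[\left(\tfrac1T\int_0^TS_t\,dt-\kappa S_T\right)^+\right].$$ *)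

theory Defs
  imports "HOL-Probability.Probability"
begin

text \<open>
  Stochastic processes are functions of type \<open>real \<Rightarrow> 'a \<Rightarrow> real\<close> on a probability space \<open>M\<close>;
  only their values at nonnegative times matter.
\<close>

definition filtered_prob_space :: "'a measure \<Rightarrow> (real \<Rightarrow> 'a measure) \<Rightarrow> bool" where
  "filtered_prob_space M F \<longleftrightarrow>
     prob_space M \<and> filtration (space M) F \<and> (\<forall>t. subalgebra M (F t))"

definition adapted :: "(real \<Rightarrow> 'a measure) \<Rightarrow> (real \<Rightarrow> 'a \<Rightarrow> real) \<Rightarrow> bool" where
  "adapted F X \<longleftrightarrow> (\<forall>t\<ge>0. X t \<in> borel_measurable (F t))"

definition progressive :: "(real \<Rightarrow> 'a measure) \<Rightarrow> (real \<Rightarrow> 'a \<Rightarrow> real) \<Rightarrow> bool" where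
  "progressive F X \<longleftrightarrow>
     (\<forall>t\<ge>0. case_prod X \<in> borel_measurable (restrict_space borel {0..t} \<Otimes>\<^sub>M F t))"

text \<open>Note that \<^const>\<open>normal_density\<close> takes the standard deviation, not the variance.\<close>

definition brownian_motion ::
    "'a measure \<Rightarrow> (real \<Rightarrow> 'a measure) \<Rightarrow> (real \<Rightarrow> 'a \<Rightarrow> real) \<Rightarrow> bool" where
  "brownian_motion M F W \<longleftrightarrow>
     adapted F W \<and>
     (AE \<omega> in M. W 0 \<omega> = 0) \<and>
     (AE \<omega> in M. continuous_on {0..} (\<lambda>t. W t \<omega>)) \<and>
     (\<forall>s t. 0 \<le> s \<and> s < t \<longrightarrow>
        distributed M lborel (\<lambda>\<omega>. W t \<omega> - W s \<omega>) (normal_density 0 (sqrt (t - s))) \<and>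
        prob_space.indep_set M (sets (F s))
          {(\<lambda>\<omega>. W t \<omega> - W s \<omega>) -` B \<inter> space M |B. B \<in> sets borel})"

text \<open>
  A simple process is \<open>\<Sum>i<n. \<xi> i \<cdot> 1\<^bsub>(\<tau> i, \<tau> (i+1)]\<^esub>\<close> with deterministic times \<open>\<tau>\<close> and
  bounded \<open>\<xi> i\<close> that are measurable with respect to \<open>F (\<tau> i)\<close>.
\<close>

definition simple_process ::
    "'a measure \<Rightarrow> (real \<Rightarrow> 'a measure) \<Rightarrow> nat \<Rightarrow> (nat \<Rightarrow> real) \<Rightarrow> (nat \<Rightarrow> 'a \<Rightarrow> real) \<Rightarrow> bool" where
  "simple_process M F n \<tau> \<xi> \<longleftrightarrow>
     0 \<le> \<tau> 0 \<and> (\<forall>i<n. \<tau> i < \<tau> (Suc i)) \<and>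
     (\<forall>i<n. \<xi> i \<in> borel_measurable (F (\<tau> i))) \<and>
     (\<exists>C. \<forall>i<n. \<forall>\<omega>\<in>space M. \<bar>\<xi> i \<omega>\<bar> \<le> C)"

definition simple_value ::
    "nat \<Rightarrow> (nat \<Rightarrow> real) \<Rightarrow> (nat \<Rightarrow> 'a \<Rightarrow> real) \<Rightarrow> real \<Rightarrow> 'a \<Rightarrow> real" where
  "simple_value n \<tau> \<xi> t \<omega> = (\<Sum>i<n. \<xi> i \<omega> * indicator {\<tau> i<..\<tau> (Suc i)} t)"

definition simple_integral ::
    "(real \<Rightarrow> 'a \<Rightarrow> real) \<Rightarrow> nat \<Rightarrow> (nat \<Rightarrow> real) \<Rightarrow> (nat \<Rightarrow> 'a \<Rightarrow> real) \<Rightarrow> real \<Rightarrow> 'a \<Rightarrow> real" where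
  "simple_integral W n \<tau> \<xi> t \<omega> =
     (\<Sum>i<n. \<xi> i \<omega> * (W (min t (\<tau> (Suc i))) \<omega> - W (min t (\<tau> i)) \<omega>))"

text \<open>Measurability is required explicitly because \<open>measure M A = 0\<close> for non-measurable \<open>A\<close>.\<close>

definition tendsto_in_prob ::
    "'a measure \<Rightarrow> (nat \<Rightarrow> 'a \<Rightarrow> real) \<Rightarrow> ('a \<Rightarrow> real) \<Rightarrow> bool" where
  "tendsto_in_prob M X L \<longleftrightarrow>
     (\<forall>k. X k \<in> borel_measurable M) \<and> L \<in> borel_measurable M \<and>
     (\<forall>\<epsilon>>0. (\<lambda>k. measure M {\<omega> \<in> space M. \<bar>X k \<omega> - L \<omega>\<bar> > \<epsilon>}) \<longlonglongrightarrow> 0)"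

text \<open>
  \<open>has_ito_integral M F W H t X\<close>: the random variable \<open>X\<close> is a version of the Ito integral of \<open>H\<close>
  with respect to \<open>W\<close> over \<open>[0, t]\<close>. The integrand is progressively measurable with almost surely
  square integrable paths; the integral is the limit in probability of the integrals of simple
  processes that approximate \<open>H\<close> in \<open>L\<^sup>2([0, t])\<close> in probability. It is unique up to null sets.
\<close>

definition has_ito_integral ::
    "'a measure \<Rightarrow> (real \<Rightarrow> 'a measure) \<Rightarrow> (real \<Rightarrow> 'a \<Rightarrow> real) \<Rightarrow> (real \<Rightarrow> 'a \<Rightarrow> real) \<Rightarrow> real \<Rightarrow>
      ('a \<Rightarrow> real) \<Rightarrow> bool" where
  "has_ito_integral M F W H t X \<longleftrightarrow>
     progressive F H \<and>
     (AE \<omega> in M. set_integrable lborel {0..t} (\<lambda>s. (H s \<omega>)\<^sup>2)) \<and>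
     (\<exists>n \<tau> \<xi>. (\<forall>k. simple_process M F (n k) (\<tau> k) (\<xi> k)) \<and>
        tendsto_in_prob M
          (\<lambda>k \<omega>. LINT s:{0..t}|lborel. (simple_value (n k) (\<tau> k) (\<xi> k) s \<omega> - H s \<omega>)\<^sup>2) (\<lambda>_. 0) \<and>
        tendsto_in_prob M (\<lambda>k. simple_integral W (n k) (\<tau> k) (\<xi> k) t) X)"

text \<open>Solutions of \<open>dS\<^sub>t = b(S\<^sub>t) dt + a(S\<^sub>t) dW\<^sub>t\<close> with \<open>S\<^sub>0 = x\<close>.\<close>

definition sde_solution ::
    "'a measure \<Rightarrow> (real \<Rightarrow> 'a measure) \<Rightarrow> (real \<Rightarrow> 'a \<Rightarrow> real) \<Rightarrow> (real \<Rightarrow> real) \<Rightarrow> (real \<Rightarrow> real) \<Rightarrow>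
      real \<Rightarrow> (real \<Rightarrow> 'a \<Rightarrow> real) \<Rightarrow> bool" where
  "sde_solution M F W b a x S \<longleftrightarrow>
     adapted F S \<and>
     (\<forall>\<omega>\<in>space M. continuous_on {0..} (\<lambda>t. S t \<omega>)) \<and>
     (AE \<omega> in M. S 0 \<omega> = x) \<and>
     (AE \<omega> in M. \<forall>t\<ge>0. set_integrable lborel {0..t} (\<lambda>u. b (S u \<omega>))) \<and>
     (\<exists>I. (\<forall>t\<ge>0. has_ito_integral M F W (\<lambda>u \<omega>. a (S u \<omega>)) t (I t)) \<and>
        (AE \<omega> in M. \<forall>t\<ge>0. S t \<omega> = x + (LINT u:{0..t}|lborel. b (S u \<omega>)) + I t \<omega>))"

text \<open>
  The constant elasticity of variance model. Since \<open>0 powr \<beta> = 0\<close>, the diffusion coefficient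
  vanishes at the origin.
\<close>

definition cev_model ::
    "'a measure \<Rightarrow> (real \<Rightarrow> 'a measure) \<Rightarrow> (real \<Rightarrow> 'a \<Rightarrow> real) \<Rightarrow> real \<Rightarrow> real \<Rightarrow> real \<Rightarrow> real \<Rightarrow> real \<Rightarrow>
      (real \<Rightarrow> 'a \<Rightarrow> real) \<Rightarrow> bool" where
  "cev_model M F W r q \<sigma> \<beta> S0 S \<longleftrightarrow>
     sde_solution M F W (\<lambda>x. (r - q) * x) (\<lambda>x. \<sigma> * x powr \<beta>) S0 S \<and>
     (AE \<omega> in M. \<forall>t\<ge>0. S t \<omega> \<ge> 0)"

definition floating_call ::
    "'a measure \<Rightarrow> real \<Rightarrow> (real \<Rightarrow> 'a \<Rightarrow> real) \<Rightarrow> real \<Rightarrow> real \<Rightarrow> real" where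
  "floating_call M r S \<kappa> T =
     exp (- r * T) *
     (LINT \<omega>|M. max 0 (\<kappa> * S T \<omega> - 1 / T * (LINT t:{0..T}|lborel. S t \<omega>)))"

definition floating_put ::
    "'a measure \<Rightarrow> real \<Rightarrow> (real \<Rightarrow> 'a \<Rightarrow> real) \<Rightarrow> real \<Rightarrow> real \<Rightarrow> real" where
  "floating_put M r S \<kappa> T =
     exp (- r * T) *
     (LINT \<omega>|M. max 0 (1 / T * (LINT t:{0..T}|lborel. S t \<omega>) - \<kappa> * S T \<omega>))"

end

theory Submission
  imports Defs
begin

text \<open>
  Put \<open>a = \<sigma> S\<^sub>0\<^sup>\<beta>\<close> and \<open>X\<^sub>t = S\<^sub>t - S\<^sub>0 - a W\<^sub>t\<close>. Both payoffs are 1-Lipschitz in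
  \<open>S\<^sub>T - (1/T) \<integral> S\<^sub>t dt\<close>, so replacing \<open>S\<close> by \<open>S\<^sub>0 + a W\<close> costs at most twice the supremum of
  \<open>E \<bar>X\<^sub>t\<bar>\<close>, and \<open>W\<^sub>T - (1/T) \<integral> W\<^sub>t dt\<close> is centred normal with variance \<open>T/3\<close>. It remains to see
  that \<open>E \<bar>X\<^sub>t\<bar> = O(t)\<close>. The martingale part of \<open>X\<close> has second moment at most
  \<open>E \<integral> \<sigma>\<^sup>2 (S\<^sub>u\<^sup>\<beta> - S\<^sub>0\<^sup>\<beta>)\<^sup>2 du\<close>, and \<open>\<bar>S\<^sup>\<beta> - S\<^sub>0\<^sup>\<beta>\<bar>\<close> is bounded by a multiple of \<open>\<bar>S - S\<^sub>0\<bar>\<close>,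
  whose second moment is \<open>O(u)\<close> as soon as \<open>E S\<^sub>u\<^sup>2\<close> is bounded near \<open>0\<close>.

  The integrand is only pathwise square integrable, so moments need a localization. Instead of
  stopping times, the simple integrals in the definition of the Ito integral \<open>I\<close> of \<open>H\<close> are switched
  off when their quadratic variation exceeds \<open>N\<close>; by Fatou this gives
  \<open>E [I\<^sub>t\<^sup>2; G\<^sub>t \<le> N] \<le> E min(N, G\<^sub>t)\<close> for \<open>G\<^sub>t = \<integral> H\<^sub>u\<^sup>2 du\<close> over \<open>[0, t]\<close>, for each fixed \<open>t\<close>.
  Since \<open>min(N, G\<^sub>t)\<close> is at most the integral of \<open>H\<^sub>u\<^sup>2\<close> over the times with \<open>G\<^sub>u \<le> N\<close>, the truncated
  moments \<open>E [S\<^sub>t\<^sup>2; G\<^sub>t \<le> N]\<close> satisfy a Gronwall type inequality uniformly in \<open>N\<close>, which on a short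
  interval is a contraction.
\<close>

subsection \<open>Integrals of step processes against Brownian motion\<close>

lemma step_mono:
  fixes s :: "nat \<Rightarrow> real"
  assumes "\<And>i. i < m \<Longrightarrow> s i \<le> s (Suc i)" "i \<le> j" "j \<le> m"
  shows "s i \<le> s j"
  using assms(2,3)
proof (induction j)
  case (Suc j)
  then show ?case using assms(1)[of j] by (cases "i = Suc j") auto
qed simp

section \<open>Brownian increments: independence of the past and their moments\<close>

locale brownian_setting =
  fixes M :: "'a measure" and F :: "real \<Rightarrow> 'a measure" and W :: "real \<Rightarrow> 'a \<Rightarrow> real"
  assumes filtered: "filtered_prob_space M F"
    and brownian: "brownian_motion M F W"
begin

sublocale prob_space M
  using filtered by (simp add: filtered_prob_space_def)

lemma borel_measurable_F: "f \<in> borel_measurable (F s) \<Longrightarrow> f \<in> borel_measurable M"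
  using filtered measurable_from_subalg[of M "F s" f borel] by (auto simp: filtered_prob_space_def)

lemma space_F: "space (F s) = space M"
  using filtered by (auto simp: filtered_prob_space_def filtration_def)

lemma borel_measurable_F_mono:
  assumes "s \<le> t" "f \<in> borel_measurable (F s)"
  shows "f \<in> borel_measurable (F t)"
proof -
  have "subalgebra (F t) (F s)"
    using filtered assms(1) by (auto simp: filtered_prob_space_def filtration_def subalgebra_def)
  with assms(2) show ?thesis
    by (rule measurable_from_subalg[rotated])
qed

lemma W_adapted: "0 \<le> t \<Longrightarrow> W t \<in> borel_measurable (F t)"
  using brownian by (simp add: brownian_motion_def adapted_def)

lemma W_adapted_mono: "0 \<le> s \<Longrightarrow> s \<le> t \<Longrightarrow> W s \<in> borel_measurable (F t)"
  using W_adapted borel_measurable_F_mono by blast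

lemma W_measurable: "0 \<le> t \<Longrightarrow> W t \<in> borel_measurable M"
  using borel_measurable_F W_adapted by blast

lemma W_zero: "AE \<omega> in M. W 0 \<omega> = 0"
  using brownian by (simp add: brownian_motion_def)

lemma increment_distributed:
  "0 \<le> s \<Longrightarrow> s < t \<Longrightarrow>
    distributed M lborel (\<lambda>\<omega>. W t \<omega> - W s \<omega>) (normal_density 0 (sqrt (t - s)))"
  using brownian by (simp add: brownian_motion_def)

text \<open>The sigma-algebra generated by \<open>Y\<close> lies inside \<open>F s\<close>, and the
  preimages of Borel sets under the increment already form a sigma-algebra. Hence the independence
  of families of events in \<open>brownian_motion\<close> is independence of the two
  variables.\<close>

lemma increment_indep:
  assumes st: "0 \<le> s" "s < t" and Y: "Y \<in> borel_measurable (F s)"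
  shows "indep_var borel Y borel (\<lambda>\<omega>. W t \<omega> - W s \<omega>)"
proof -
  let ?D = "\<lambda>\<omega>. W t \<omega> - W s \<omega>"
  have D: "?D \<in> borel_measurable M"
    using st W_measurable[of s] W_measurable[of t] by simp
  have YM: "Y \<in> borel_measurable M"
    using Y by (rule borel_measurable_F)
  have ind: "indep_set (sets (F s)) {?D -` B \<inter> space M |B. B \<in> sets borel}"
    using brownian st by (simp add: brownian_motion_def)
  have eqY: "sigma_sets (space M) {Y -` A \<inter> space M |A. A \<in> sets borel} \<subseteq> sets (F s)"
    using sets.sigma_sets_subset[of "{Y -` A \<inter> space M |A. A \<in> sets borel}" "F s"]
      measurable_sets[OF Y] space_F[of s] by fastforce
  have eqD: "sigma_sets (space M) {?D -` A \<inter> space M |A. A \<in> sets borel}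
      = {?D -` A \<inter> space M |A. A \<in> sets borel}"
    using sets_vimage_algebra[of "space M" ?D borel] sets_vimage_algebra2[of ?D "space M" borel]
    by auto
  show ?thesis
    unfolding indep_var_eq
  proof (intro conjI)
    show "indep_set (sigma_sets (space M) {Y -` A \<inter> space M |A. A \<in> sets borel})
       (sigma_sets (space M) {?D -` A \<inter> space M |A. A \<in> sets borel})"
      using ind eqY unfolding eqD indep_sets2_eq by blast
  qed (use D YM in auto)
qed

lemma
  assumes st: "0 \<le> s" "s < t"
  shows increment_integrable: "integrable M (\<lambda>\<omega>. W t \<omega> - W s \<omega>)"
    and increment_expectation: "expectation (\<lambda>\<omega>. W t \<omega> - W s \<omega>) = 0"
    and increment_square_integrable: "integrable M (\<lambda>\<omega>. (W t \<omega> - W s \<omega>)\<^sup>2)"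
    and increment_square_expectation: "expectation (\<lambda>\<omega>. (W t \<omega> - W s \<omega>)\<^sup>2) = t - s"
proof -
  let ?D = "\<lambda>\<omega>. W t \<omega> - W s \<omega>"
  have pos: "0 < sqrt (t - s)" using st by simp
  note d = increment_distributed[OF st]
  have i: "integrable M (\<lambda>\<omega>. ?D \<omega> ^ k)" for k
    using integrable_normal_moment[OF pos, of 0 k]
    by (subst distributed_integrable[OF d, symmetric]) auto
  show "integrable M ?D" using i[of 1] by simp
  show "integrable M (\<lambda>\<omega>. (?D \<omega>)\<^sup>2)" by (rule i)
  show e: "expectation ?D = 0"
    by (rule normal_distributed_expectation[OF pos d])
  show "expectation (\<lambda>\<omega>. (?D \<omega>)\<^sup>2) = t - s"
    using normal_distributed_variance[OF pos d] st e by simp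
qed

text \<open>Independence of the increment from \<open>F s\<close> factors each expectation into that
  of \<open>Y\<close> and a Gaussian moment.\<close>

lemma
  assumes st: "0 \<le> s" "s \<le> t" and Y: "Y \<in> borel_measurable (F s)" "integrable M Y"
  shows mult_increment_integrable: "integrable M (\<lambda>\<omega>. Y \<omega> * (W t \<omega> - W s \<omega>))"
    and mult_increment_expectation: "expectation (\<lambda>\<omega>. Y \<omega> * (W t \<omega> - W s \<omega>)) = 0"
    and mult_increment_square_integrable: "integrable M (\<lambda>\<omega>. Y \<omega> * (W t \<omega> - W s \<omega>)\<^sup>2)"
    and mult_increment_square_expectation:
      "expectation (\<lambda>\<omega>. Y \<omega> * (W t \<omega> - W s \<omega>)\<^sup>2) = (t - s) * expectation Y"
proof -
  let ?D = "\<lambda>\<omega>. W t \<omega> - W s \<omega>"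
  have "integrable M (\<lambda>\<omega>. Y \<omega> * ?D \<omega>) \<and> expectation (\<lambda>\<omega>. Y \<omega> * ?D \<omega>) = 0 \<and>
      integrable M (\<lambda>\<omega>. Y \<omega> * (?D \<omega>)\<^sup>2) \<and>
      expectation (\<lambda>\<omega>. Y \<omega> * (?D \<omega>)\<^sup>2) = (t - s) * expectation Y"
  \<comment> \<open>\<open>brownian_motion\<close> speaks of \<open>s < t\<close> only. Equality has
    to be covered because grids stopped at a final time have cells of length zero.\<close>
  proof (cases "s = t")
    case False
    with st have "s < t" by simp
    note I = increment_indep[OF st(1) this Y(1)]
    have I2: "indep_var borel Y borel (\<lambda>\<omega>. (?D \<omega>)\<^sup>2)"
      using indep_var_compose[OF I, of "\<lambda>x. x" borel "\<lambda>x. x\<^sup>2" borel] by (simp add: comp_def)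
    show ?thesis
      using indep_var_integrable[OF I Y(2)] indep_var_integrable[OF I2 Y(2)]
        indep_var_lebesgue_integral[OF I Y(2)] indep_var_lebesgue_integral[OF I2 Y(2)]
        increment_integrable[OF st(1) \<open>s < t\<close>] increment_expectation[OF st(1) \<open>s < t\<close>]
        increment_square_integrable[OF st(1) \<open>s < t\<close>]
        increment_square_expectation[OF st(1) \<open>s < t\<close>]
      by simp
  qed simp
  then show "integrable M (\<lambda>\<omega>. Y \<omega> * ?D \<omega>)" "expectation (\<lambda>\<omega>. Y \<omega> * ?D \<omega>) = 0"
    "integrable M (\<lambda>\<omega>. Y \<omega> * (?D \<omega>)\<^sup>2)"
    "expectation (\<lambda>\<omega>. Y \<omega> * (?D \<omega>)\<^sup>2) = (t - s) * expectation Y"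
    by auto
qed

section \<open>Discrete stochastic integrals and their isometry\<close>

definition martingale_transform :: "(nat \<Rightarrow> real) \<Rightarrow> (nat \<Rightarrow> 'a \<Rightarrow> real) \<Rightarrow> nat \<Rightarrow> 'a \<Rightarrow> real" where
  "martingale_transform s \<eta> m \<omega> = (\<Sum>i<m. \<eta> i \<omega> * (W (s (Suc i)) \<omega> - W (s i) \<omega>))"

text \<open>The time step stands where a squared increment of \<open>W\<close> might be expected:
  this is the predictable bracket of the transform, the time integral of the squared
  integrand.\<close>

definition quadratic_variation :: "(nat \<Rightarrow> real) \<Rightarrow> (nat \<Rightarrow> 'a \<Rightarrow> real) \<Rightarrow> nat \<Rightarrow> 'a \<Rightarrow> real" where
  "quadratic_variation s \<eta> m \<omega> = (\<Sum>i<m. (\<eta> i \<omega>)\<^sup>2 * (s (Suc i) - s i))"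

context
  fixes s :: "nat \<Rightarrow> real" and \<eta> :: "nat \<Rightarrow> 'a \<Rightarrow> real" and m :: nat and C :: real
  assumes s0: "0 \<le> s 0" and s_step: "\<And>i. i < m \<Longrightarrow> s i \<le> s (Suc i)"
    and meas: "\<And>i. i < m \<Longrightarrow> \<eta> i \<in> borel_measurable (F (s i))"
    and bound: "\<And>i \<omega>. i < m \<Longrightarrow> \<omega> \<in> space M \<Longrightarrow> \<bar>\<eta> i \<omega>\<bar> \<le> C"
begin

lemma s_le: "i \<le> j \<Longrightarrow> j \<le> m \<Longrightarrow> s i \<le> s j"
  by (rule step_mono[where m=m and s=s, OF s_step])

lemma s_nonneg: "i \<le> m \<Longrightarrow> 0 \<le> s i"
  using s_le[of 0 i] s0 by simp

lemma martingale_transform_adapted: "k \<le> m \<Longrightarrow> martingale_transform s \<eta> k \<in> borel_measurable (F (s k))"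
  unfolding martingale_transform_def
  by (intro borel_measurable_sum borel_measurable_times borel_measurable_diff W_adapted_mono s_nonneg s_le)
     (auto intro!: borel_measurable_F_mono[OF s_le meas])

text \<open>Discrete Ito isometry. When the square is expanded after one more step, the cross term
  has mean zero since its coefficient is measurable for \<open>F (s k)\<close>, and the last term
  contributes the step length times the second moment of \<open>\<eta> k\<close>. Integrability
  travels along in the induction because the factorization asks for it.\<close>

lemma isometry:
  "k \<le> m \<Longrightarrow> integrable M (\<lambda>\<omega>. (martingale_transform s \<eta> k \<omega>)\<^sup>2) \<and> integrable M (quadratic_variation s \<eta> k) \<and>
     expectation (\<lambda>\<omega>. (martingale_transform s \<eta> k \<omega>)\<^sup>2) = expectation (quadratic_variation s \<eta> k)"
proof (induction k)
  case 0
  show ?case by (simp add: martingale_transform_def quadratic_variation_def)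
next
  case (Suc k)
  let ?Z = "martingale_transform s \<eta> k" and ?D = "\<lambda>\<omega>. W (s (Suc k)) \<omega> - W (s k) \<omega>"
  from Suc.prems have k: "k < m" by simp
  have Z[measurable]: "?Z \<in> borel_measurable (F (s k))" and \<eta>[measurable]: "\<eta> k \<in> borel_measurable (F (s k))"
    using martingale_transform_adapted[of k] meas[OF k] k by auto
  have ZM[measurable]: "?Z \<in> borel_measurable M" and \<eta>M[measurable]: "\<eta> k \<in> borel_measurable M"
    by (rule borel_measurable_F, fact)+
  have sk: "0 \<le> s k" "s k \<le> s (Suc k)" using s_nonneg[of k] s_step[of k] k by auto
  from Suc k have IH: "integrable M (\<lambda>\<omega>. (?Z \<omega>)\<^sup>2)" "integrable M (quadratic_variation s \<eta> k)"
      "expectation (\<lambda>\<omega>. (?Z \<omega>)\<^sup>2) = expectation (quadratic_variation s \<eta> k)"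
    by auto
  have Zi: "integrable M ?Z"
    using square_integrable_imp_integrable[OF ZM IH(1)] .
  have bk: "AE \<omega> in M. \<bar>\<eta> k \<omega>\<bar> \<le> C" using bound[OF k] by (intro AE_I2) auto
  have \<eta>2: "integrable M (\<lambda>\<omega>. (\<eta> k \<omega>)\<^sup>2)"
  proof (rule integrable_const_bound[of _ "C\<^sup>2"])
    show "AE \<omega> in M. norm ((\<eta> k \<omega>)\<^sup>2) \<le> C\<^sup>2"
      using bk by eventually_elim (auto simp: abs_le_square_iff[symmetric])
  qed simp
  have Z\<eta>: "integrable M (\<lambda>\<omega>. 2 * (?Z \<omega> * \<eta> k \<omega>))"
  proof (intro integrable_mult_right Bochner_Integration.integrable_bound[OF integrable_mult_left[OF Zi, of C]])
    show "AE \<omega> in M. norm (?Z \<omega> * \<eta> k \<omega>) \<le> norm (?Z \<omega> * C)"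
      using bk by eventually_elim (auto simp: abs_mult intro!: mult_left_mono)
  qed simp
  note cross = mult_increment_integrable[OF sk _ Z\<eta>] mult_increment_expectation[OF sk _ Z\<eta>]
  note sq = mult_increment_square_integrable[OF sk _ \<eta>2] mult_increment_square_expectation[OF sk _ \<eta>2]
  have eq: "(martingale_transform s \<eta> (Suc k) \<omega>)\<^sup>2 =
      (?Z \<omega>)\<^sup>2 + 2 * (?Z \<omega> * \<eta> k \<omega>) * ?D \<omega> + (\<eta> k \<omega>)\<^sup>2 * (?D \<omega>)\<^sup>2" for \<omega>
    by (simp add: martingale_transform_def power2_eq_square algebra_simps)
  have eqQ: "quadratic_variation s \<eta> (Suc k) = (\<lambda>\<omega>. quadratic_variation s \<eta> k \<omega> + (s (Suc k) - s k) * (\<eta> k \<omega>)\<^sup>2)"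
    by (auto simp: quadratic_variation_def)
  show ?case
    unfolding eq eqQ using IH cross sq \<eta>2 by simp
qed

end

end

section \<open>Step functions on a grid, truncation and simple processes\<close>

lemma step_sum_eq:
  fixes s c :: "nat \<Rightarrow> real"
  assumes s: "\<And>i. i < m \<Longrightarrow> s i \<le> s (Suc i)" and i: "i < m" and u: "s i < u" "u \<le> s (Suc i)"
  shows "(\<Sum>k<m. c k * indicator {s k<..s (Suc k)} u) = c i"
proof -
  have "c k * indicator {s k<..s (Suc k)} u = (if k = i then c i else 0)" if "k < m" for k
  proof (cases k i rule: linorder_cases)
    case less
    then have "s (Suc k) \<le> s i" using step_mono[where m=m and s=s, OF s, of "Suc k" i] i by auto
    with less u show ?thesis by auto
  next
    case greater
    then have "s (Suc i) \<le> s k" using step_mono[where m=m and s=s, OF s, of "Suc i" k] that by auto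
    with greater u show ?thesis by auto
  qed (use u in auto)
  then have "(\<Sum>k<m. c k * indicator {s k<..s (Suc k)} u) = (\<Sum>k<m. if k = i then c i else 0)"
    by (intro sum.cong) auto
  with i show ?thesis by simp
qed

lemma step_sum_eq_0:
  fixes s c :: "nat \<Rightarrow> real"
  assumes s: "\<And>i. i < m \<Longrightarrow> s i \<le> s (Suc i)" and u: "u \<le> s 0 \<or> s m < u"
  shows "(\<Sum>k<m. c k * indicator {s k<..s (Suc k)} u) = 0"
proof (intro sum.neutral ballI)
  fix k assume "k \<in> {..<m}"
  then show "c k * indicator {s k<..s (Suc k)} u = 0"
    using u step_mono[where m=m and s=s, OF s, of 0 k] step_mono[where m=m and s=s, OF s, of "Suc k" m] by (auto simp: indicator_def)
qed

context brownian_setting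
begin

context
  fixes s :: "nat \<Rightarrow> real" and \<eta> :: "nat \<Rightarrow> 'a \<Rightarrow> real" and m :: nat and C :: real
  assumes s0: "0 \<le> s 0" and s_step: "\<And>i. i < m \<Longrightarrow> s i \<le> s (Suc i)"
    and meas: "\<And>i. i < m \<Longrightarrow> \<eta> i \<in> borel_measurable (F (s i))"
    and bound: "\<And>i \<omega>. i < m \<Longrightarrow> \<omega> \<in> space M \<Longrightarrow> \<bar>\<eta> i \<omega>\<bar> \<le> C"
begin

text \<open>
  The integrand is switched off as soon as the quadratic variation of the next step would exceed
  the level \<open>N\<close>; this can be decided at the beginning of the step.
\<close>

lemma truncated_isometry:
  assumes N: "0 \<le> N"
  obtains Z where "Z \<in> borel_measurable M"
    "(\<integral>\<^sup>+\<omega>. ennreal ((Z \<omega>)\<^sup>2) \<partial>M) \<le> (\<integral>\<^sup>+\<omega>. ennreal (min N (quadratic_variation s \<eta> m \<omega>)) \<partial>M)"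
    "\<And>\<omega>. quadratic_variation s \<eta> m \<omega> \<le> N \<Longrightarrow> Z \<omega> = martingale_transform s \<eta> m \<omega>"
proof -
  define \<zeta> where "\<zeta> i \<omega> = (if quadratic_variation s \<eta> (Suc i) \<omega> \<le> N then \<eta> i \<omega> else 0)" for i \<omega>
  have le: "s i \<le> s j" if "i \<le> j" "j \<le> m" for i j
    by (rule step_mono[where m=m and s=s, OF s_step that])
  have \<zeta>_meas: "\<zeta> i \<in> borel_measurable (F (s i))" if "i < m" for i
  proof -
    have [measurable]: "\<eta> j \<in> borel_measurable (F (s i))" if "j \<le> i" for j
      using that \<open>i < m\<close> by (intro borel_measurable_F_mono[OF le meas]) auto
    have [measurable]: "quadratic_variation s \<eta> (Suc i) \<in> borel_measurable (F (s i))"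
      unfolding quadratic_variation_def by measurable
    show ?thesis
      unfolding \<zeta>_def by measurable
  qed
  have \<zeta>_bound: "\<bar>\<zeta> i \<omega>\<bar> \<le> C" if "i < m" "\<omega> \<in> space M" for i \<omega>
    using bound[OF that] by (auto simp: \<zeta>_def)
  note iso = isometry[OF s0 s_step \<zeta>_meas \<zeta>_bound order_refl]
  have Q_mono: "quadratic_variation s \<eta> i \<omega> \<le> quadratic_variation s \<eta> j \<omega>" if "i \<le> j" "j \<le> m" for i j \<omega>
    unfolding quadratic_variation_def using that s_step by (intro sum_mono2) auto
  \<comment> \<open>A step that is kept ends with the bracket of \<open>\<eta>\<close> at most
    \<open>N\<close>; a suppressed step adds nothing. So the bracket of \<open>\<zeta>\<close>
    passes neither bound.\<close>
  have Q\<zeta>: "quadratic_variation s \<zeta> k \<omega> \<le> min N (quadratic_variation s \<eta> k \<omega>)" if "k \<le> m" for k \<omega>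
    using that
  proof (induction k)
    case 0
    then show ?case using N by (simp add: quadratic_variation_def)
  next
    case (Suc k)
    then show ?case
      using Q_mono[of k "Suc k" \<omega>] by (auto simp: quadratic_variation_def \<zeta>_def)
  qed
  show thesis
  proof (rule that[of "martingale_transform s \<zeta> m"])
    have "martingale_transform s \<zeta> m \<in> borel_measurable (F (s m))"
      by (rule martingale_transform_adapted[OF s0 s_step \<zeta>_meas \<zeta>_bound order_refl])
    then show "martingale_transform s \<zeta> m \<in> borel_measurable M"
      by (rule borel_measurable_F)
    have "(\<integral>\<^sup>+\<omega>. ennreal ((martingale_transform s \<zeta> m \<omega>)\<^sup>2) \<partial>M) = ennreal (expectation (quadratic_variation s \<zeta> m))"
      using iso by (subst nn_integral_eq_integral) auto
    also have "\<dots> = (\<integral>\<^sup>+\<omega>. ennreal (quadratic_variation s \<zeta> m \<omega>) \<partial>M)"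
      using iso s_step by (subst nn_integral_eq_integral) (auto simp: quadratic_variation_def intro!: sum_nonneg)
    also have "\<dots> \<le> (\<integral>\<^sup>+\<omega>. ennreal (min N (quadratic_variation s \<eta> m \<omega>)) \<partial>M)"
      by (intro nn_integral_mono ennreal_leI Q\<zeta> order_refl)
    finally show "(\<integral>\<^sup>+\<omega>. ennreal ((martingale_transform s \<zeta> m \<omega>)\<^sup>2) \<partial>M)
      \<le> (\<integral>\<^sup>+\<omega>. ennreal (min N (quadratic_variation s \<eta> m \<omega>)) \<partial>M)" .
  next
    fix \<omega> assume "quadratic_variation s \<eta> m \<omega> \<le> N"
    \<comment> \<open>The bracket increases along the grid, so a final value of at most
      \<open>N\<close> means that no step was switched off.\<close>
    then have "\<zeta> i \<omega> = \<eta> i \<omega>" if "i < m" for i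
      using Q_mono[of "Suc i" m \<omega>] that by (simp add: \<zeta>_def)
    then show "martingale_transform s \<zeta> m \<omega> = martingale_transform s \<eta> m \<omega>"
      by (simp add: martingale_transform_def)
  qed
qed

end

text \<open>Subtracting \<open>a * (W t - W 0)\<close> from a simple integral again gives a
  transform once the partition is stopped at \<open>t\<close> and padded by a cell starting at 0 and
  a cell ending at \<open>t\<close>; on both pads the integrand is \<open>- a\<close>.\<close>

lemma simple_process_minus_const:
  assumes sp: "simple_process M F n \<tau> \<xi>" and t: "0 < t"
  obtains s m \<eta> C where "0 \<le> s 0" "\<And>i. i < m \<Longrightarrow> s i \<le> s (Suc i)"
    "\<And>i. i < m \<Longrightarrow> \<eta> i \<in> borel_measurable (F (s i))"
    "\<And>i \<omega>. i < m \<Longrightarrow> \<omega> \<in> space M \<Longrightarrow> \<bar>\<eta> i \<omega>\<bar> \<le> C"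
    "\<And>\<omega>. martingale_transform s \<eta> m \<omega> = simple_integral W n \<tau> \<xi> t \<omega> - a * (W t \<omega> - W 0 \<omega>)"
    "\<And>\<omega>. ennreal (quadratic_variation s \<eta> m \<omega>) \<le>
       (\<integral>\<^sup>+u\<in>{0..t}. ennreal ((simple_value n \<tau> \<xi> u \<omega> - a)\<^sup>2) \<partial>lborel)"
proof -
  from sp have \<tau>0: "0 \<le> \<tau> 0" and \<tau>s: "\<And>i. i < n \<Longrightarrow> \<tau> i < \<tau> (Suc i)"
    and \<xi>_meas: "\<And>i. i < n \<Longrightarrow> \<xi> i \<in> borel_measurable (F (\<tau> i))"
    by (auto simp: simple_process_def)
  from sp obtain C where C: "\<And>i \<omega>. i < n \<Longrightarrow> \<omega> \<in> space M \<Longrightarrow> \<bar>\<xi> i \<omega>\<bar> \<le> C"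
    unfolding simple_process_def by blast
  have \<tau>_step: "\<tau> i \<le> \<tau> (Suc i)" if "i < n" for i using \<tau>s[OF that] by simp
  note \<tau>_mono = step_mono[where m=n and s=\<tau>, OF \<tau>_step]
  \<comment> \<open>The \<open>n\<close> cells of the partition and one padding cell at each
    end.\<close>
  define m where "m = n + 2"
  define s where "s i = (case i of 0 \<Rightarrow> 0 | Suc j \<Rightarrow> if j \<le> n then min t (\<tau> j) else t)" for i
  \<comment> \<open>If \<open>\<tau> j \<ge> t\<close>, the cell has shrunk to the point
    \<open>t\<close>, and \<open>\<xi> j\<close> need not be measurable for \<open>F t\<close>. The
    coefficient is set to 0 there; the increment of \<open>W\<close> vanishes anyway.\<close>
  define \<zeta> where "\<zeta> i \<omega> = (case i of 0 \<Rightarrow> 0 | Suc j \<Rightarrow> if j < n \<and> \<tau> j < t then \<xi> j \<omega> else 0)" for i \<omega>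
  define \<eta> where "\<eta> i \<omega> = \<zeta> i \<omega> - a" for i \<omega>
  have \<tau>_nonneg: "0 \<le> \<tau> i" if "i \<le> n" for i using \<tau>_mono[of 0 i] \<tau>0 that by simp
  have s_step: "s i \<le> s (Suc i)" if "i < m" for i
    using that t \<tau>_step \<tau>_nonneg unfolding s_def m_def
    by (auto split: nat.split intro: min.coboundedI2)
  have \<eta>_meas: "\<eta> i \<in> borel_measurable (F (s i))" for i
  proof (cases "\<exists>j<n. i = Suc j \<and> \<tau> j < t")
    case True
    then obtain j where j: "j < n" "i = Suc j" "\<tau> j < t" by blast
    then have "\<eta> i = (\<lambda>\<omega>. \<xi> j \<omega> - a)" "s i = \<tau> j"
      by (auto simp: \<eta>_def \<zeta>_def s_def)
    with \<xi>_meas[OF j(1)] show ?thesis by simp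
  next
    case False
    then have "\<eta> i = (\<lambda>\<omega>. - a)"
      by (auto simp: \<eta>_def \<zeta>_def fun_eq_iff split: nat.split)
    then show ?thesis by simp
  qed
  \<comment> \<open>For \<open>n = 0\<close> the constant \<open>C\<close> is arbitrary and may be
    negative, hence \<open>max C 0\<close>.\<close>
  have \<eta>_bound: "\<bar>\<eta> i \<omega>\<bar> \<le> max C 0 + \<bar>a\<bar>" if "\<omega> \<in> space M" for i \<omega>
    using C[OF _ that] unfolding \<eta>_def \<zeta>_def by (auto split: nat.split simp: max_def) (smt (verit))+
  have tr: "martingale_transform s \<eta> m \<omega> = simple_integral W n \<tau> \<xi> t \<omega> - a * (W t \<omega> - W 0 \<omega>)" for \<omega>
  proof -
    have "martingale_transform s \<eta> m \<omega> = (\<Sum>i<m. \<zeta> i \<omega> * (W (s (Suc i)) \<omega> - W (s i) \<omega>))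
        - a * (\<Sum>i<m. W (s (Suc i)) \<omega> - W (s i) \<omega>)"
      unfolding martingale_transform_def \<eta>_def left_diff_distrib sum_distrib_left by (rule sum_subtractf)
    also have "(\<Sum>i<m. W (s (Suc i)) \<omega> - W (s i) \<omega>) = W t \<omega> - W 0 \<omega>"
      by (subst sum_lessThan_telescope) (simp add: s_def m_def)
    also have "(\<Sum>i<m. \<zeta> i \<omega> * (W (s (Suc i)) \<omega> - W (s i) \<omega>)) =
        (\<Sum>j<Suc n. \<zeta> (Suc j) \<omega> * (W (s (Suc (Suc j))) \<omega> - W (s (Suc j)) \<omega>))"
      unfolding m_def by (simp add: sum.lessThan_Suc_shift \<zeta>_def del: sum.lessThan_Suc)
    also have "\<dots> = (\<Sum>j<n. \<zeta> (Suc j) \<omega> * (W (s (Suc (Suc j))) \<omega> - W (s (Suc j)) \<omega>))"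
      by (simp add: \<zeta>_def)
    also have "\<dots> = simple_integral W n \<tau> \<xi> t \<omega>"
      unfolding simple_integral_def
    proof (intro sum.cong refl)
      fix j assume "j \<in> {..<n}"
      then show "\<zeta> (Suc j) \<omega> * (W (s (Suc (Suc j))) \<omega> - W (s (Suc j)) \<omega>) =
          \<xi> j \<omega> * (W (min t (\<tau> (Suc j))) \<omega> - W (min t (\<tau> j)) \<omega>)"
        using \<tau>_step[of j] by (auto simp: \<zeta>_def s_def min_def)
    qed
    finally show ?thesis .
  qed
  have qv: "ennreal (quadratic_variation s \<eta> m \<omega>) \<le>
      (\<integral>\<^sup>+u\<in>{0..t}. ennreal ((simple_value n \<tau> \<xi> u \<omega> - a)\<^sup>2) \<partial>lborel)" for \<omega>
  proof -
    have "ennreal (quadratic_variation s \<eta> m \<omega>) = (\<Sum>i<m. ennreal ((\<eta> i \<omega>)\<^sup>2) * ennreal (s (Suc i) - s i))"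
      unfolding quadratic_variation_def using s_step by (subst sum_ennreal[symmetric]) (auto simp: ennreal_mult)
    also have "\<dots> = (\<Sum>i<m. \<integral>\<^sup>+u. ennreal ((\<eta> i \<omega>)\<^sup>2) * indicator {s i<..s (Suc i)} u \<partial>lborel)"
      using s_step by (intro sum.cong) (simp_all add: nn_integral_cmult_indicator)
    also have "\<dots> = (\<integral>\<^sup>+u. (\<Sum>i<m. ennreal ((\<eta> i \<omega>)\<^sup>2) * indicator {s i<..s (Suc i)} u) \<partial>lborel)"
      by (subst nn_integral_sum) auto
    also have "\<dots> = (\<integral>\<^sup>+u. ennreal (\<Sum>i<m. (\<eta> i \<omega>)\<^sup>2 * indicator {s i<..s (Suc i)} u) \<partial>lborel)"
      by (subst sum_ennreal[symmetric]) (auto simp: ennreal_mult ennreal_indicator)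
    also have "\<dots> \<le> (\<integral>\<^sup>+u\<in>{0..t}. ennreal ((simple_value n \<tau> \<xi> u \<omega> - a)\<^sup>2) \<partial>lborel)"
    proof (rule nn_integral_mono)
      fix u
      show "ennreal (\<Sum>i<m. (\<eta> i \<omega>)\<^sup>2 * indicator {s i<..s (Suc i)} u)
        \<le> ennreal ((simple_value n \<tau> \<xi> u \<omega> - a)\<^sup>2) * indicator {0..t} u"
      proof (cases "\<exists>i<m. s i < u \<and> u \<le> s (Suc i)")
        case True
        then obtain i where i: "i < m" "s i < u" "u \<le> s (Suc i)" by auto
        have "0 \<le> s i" "s (Suc i) \<le> t"
          using step_mono[where m=m and s=s, OF s_step, of 0 i] step_mono[where m=m and s=s, OF s_step, of "Suc i" m] i(1)
          by (auto simp: s_def m_def)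
        then have u: "u \<in> {0..t}" using i by auto
        \<comment> \<open>Cell 0 lies before the first time of the simple process and cell
          \<open>n + 1\<close> after its last, so both sides are 0 there; every other cell lies
          within one cell of the original partition.\<close>
        have "simple_value n \<tau> \<xi> u \<omega> = \<zeta> i \<omega>"
        proof (cases i)
          case 0
          then have "u \<le> \<tau> 0" using i by (auto simp: s_def)
          then show ?thesis
            using step_sum_eq_0[where m=n and s=\<tau>, OF \<tau>_step, of u "\<lambda>i. \<xi> i \<omega>"] 0 by (simp add: simple_value_def \<zeta>_def)
        next
          case (Suc j)
          show ?thesis
          proof (cases "j < n")
            case True
            then have "\<tau> j < u" "u \<le> \<tau> (Suc j)" "\<tau> j < t" using i Suc by (auto simp: s_def)
            then show ?thesis
              using step_sum_eq[where m=n and s=\<tau>, OF \<tau>_step, of j u "\<lambda>i. \<xi> i \<omega>"] Suc True by (simp add: simple_value_def \<zeta>_def)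
          next
            case False
            then have "j = n" using i Suc by (simp add: m_def)
            then have "\<tau> n < u" using i Suc by (auto simp: s_def)
            then show ?thesis
              using step_sum_eq_0[where m=n and s=\<tau>, OF \<tau>_step, of u "\<lambda>i. \<xi> i \<omega>"] Suc False by (simp add: simple_value_def \<zeta>_def)
          qed
        qed
        then show ?thesis
          using step_sum_eq[where m=m and s=s, OF s_step i, of "\<lambda>i. (\<eta> i \<omega>)\<^sup>2"] u by (simp add: \<eta>_def)
      next
        case False
        then have "(\<Sum>i<m. (\<eta> i \<omega>)\<^sup>2 * indicator {s i<..s (Suc i)} u) = 0"
          by (intro sum.neutral) auto
        then show ?thesis by simp
      qed
    qed
    finally show ?thesis .
  qed
  show thesis
  proof (rule that[of s m \<eta> "max C 0 + \<bar>a\<bar>"])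
    show "0 \<le> s 0" by (simp add: s_def)
  qed (erule s_step | rule \<eta>_meas | erule \<eta>_bound | rule tr | rule qv)+
qed

end

subsection \<open>A localized Ito inequality\<close>

lemma (in prob_space) expectation_const_add_indicator:
  assumes [measurable]: "A \<in> sets M"
  shows "expectation (\<lambda>\<omega>. c + indicator A \<omega>) = c + prob A"
  by (subst Bochner_Integration.integral_add)
    (auto intro!: integrable_real_indicator simp: prob_space less_top[symmetric])

text \<open>The distance capped at 1 is bounded, so convergence in probability makes it tend to 0 in
  L1, and an L1 null sequence has an almost surely convergent subsequence. Near the limit the cap is
  inactive.\<close>

lemma (in prob_space) tendsto_in_prob_AE_subseq:
  assumes "tendsto_in_prob M X L"
  shows "\<exists>r::nat \<Rightarrow> nat. strict_mono r \<and> (AE \<omega> in M. (\<lambda>k. X (r k) \<omega>) \<longlonglongrightarrow> L \<omega>)"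
proof -
  from assms have [measurable]: "\<And>k. X k \<in> borel_measurable M" "L \<in> borel_measurable M"
    and conv: "\<And>\<epsilon>. \<epsilon> > 0 \<Longrightarrow> (\<lambda>k. prob {\<omega> \<in> space M. \<bar>X k \<omega> - L \<omega>\<bar> > \<epsilon>}) \<longlonglongrightarrow> 0"
    by (auto simp: tendsto_in_prob_def)
  define u where "u k \<omega> = min 1 \<bar>X k \<omega> - L \<omega>\<bar>" for k \<omega>
  have [measurable]: "u k \<in> borel_measurable M" for k unfolding u_def by measurable
  have u_int: "integrable M (u k)" for k
    by (rule integrable_const_bound[of _ 1]) (auto simp: u_def)
  have "(\<lambda>k. expectation (\<lambda>\<omega>. norm (u k \<omega>))) \<longlonglongrightarrow> 0"
  proof (rule LIMSEQ_I)
    fix e :: real assume e: "0 < e"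
    let ?A = "\<lambda>k. {\<omega> \<in> space M. \<bar>X k \<omega> - L \<omega>\<bar> > e / 2}"
    from LIMSEQ_D[OF conv[of "e / 2"], of "e / 2"] e
    obtain k0 where k0: "\<And>k. k \<ge> k0 \<Longrightarrow> prob (?A k) < e / 2" by auto
    have "norm (expectation (\<lambda>\<omega>. norm (u k \<omega>)) - 0) < e" if "k \<ge> k0" for k
    proof -
      have "expectation (\<lambda>\<omega>. norm (u k \<omega>)) \<le> expectation (\<lambda>\<omega>. e / 2 + indicator (?A k) \<omega>)"
      proof (rule integral_mono)
        show "integrable M (\<lambda>\<omega>. norm (u k \<omega>))"
          using u_int by (rule integrable_norm)
        show "integrable M (\<lambda>\<omega>. e / 2 + indicator (?A k) \<omega> :: real)"
          by (auto intro!: integrable_real_indicator simp: less_top[symmetric])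
        show "norm (u k \<omega>) \<le> e / 2 + indicator (?A k) \<omega>" if "\<omega> \<in> space M" for \<omega>
          using that e by (auto simp: u_def min_def split: split_indicator)
      qed
      also have "\<dots> = e / 2 + prob (?A k)"
        by (rule expectation_const_add_indicator) measurable
      finally show ?thesis using k0[OF that] by (simp add: integral_nonneg_AE)
    qed
    then show "\<exists>k0. \<forall>k\<ge>k0. norm (expectation (\<lambda>\<omega>. norm (u k \<omega>)) - 0) < e" by blast
  qed
  from tendsto_L1_AE_subseq[OF u_int this] obtain r :: "nat \<Rightarrow> nat"
    where r: "strict_mono r" "AE \<omega> in M. (\<lambda>k. u (r k) \<omega>) \<longlonglongrightarrow> 0" by blast
  from r(2) have "AE \<omega> in M. (\<lambda>k. X (r k) \<omega>) \<longlonglongrightarrow> L \<omega>"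
  proof eventually_elim
    case (elim \<omega>)
    then have "eventually (\<lambda>k. u (r k) \<omega> < 1) sequentially"
      by (rule order_tendstoD) simp
    then have "eventually (\<lambda>k. u (r k) \<omega> = \<bar>X (r k) \<omega> - L \<omega>\<bar>) sequentially"
      by eventually_elim (auto simp: u_def)
    with elim have "(\<lambda>k. \<bar>X (r k) \<omega> - L \<omega>\<bar>) \<longlonglongrightarrow> 0"
      by (rule Lim_transform_eventually)
    then show ?case
      using LIM_zero_iff tendsto_rabs_zero_iff by blast
  qed
  with r(1) show ?thesis by blast
qed

lemma tendsto_in_prob_subseq:
  assumes "tendsto_in_prob M X L" "strict_mono (r :: nat \<Rightarrow> nat)"
  shows "tendsto_in_prob M (\<lambda>k. X (r k)) L"
  using assms LIMSEQ_subseq_LIMSEQ[OF _ assms(2)]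
  by (auto simp: tendsto_in_prob_def comp_def)

text \<open>Weighted Young inequality. A small \<open>\<delta>\<close> keeps the factor of the main
  term close to 1, at the price of a large factor on an error term.\<close>

lemma square_add_le:
  fixes x y \<delta> :: real
  assumes "0 < \<delta>"
  shows "(x + y)\<^sup>2 \<le> (1 + \<delta>) * x\<^sup>2 + (1 + 1 / \<delta>) * y\<^sup>2"
proof -
  have "0 \<le> (\<delta> * x - y)\<^sup>2 / \<delta>" using assms by simp
  also have "\<dots> = \<delta> * x\<^sup>2 - 2 * x * y + y\<^sup>2 / \<delta>"
    using assms by (simp add: power2_eq_square field_simps)
  finally show ?thesis by (simp add: power2_eq_square algebra_simps)
qed

section \<open>Passage from simple integrals to the Ito integral\<close>

context brownian_setting
begin

text \<open>Progressive measurability concerns \<open>[0, t]\<close> only. Composition with the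
  clamp \<open>max 0 (min t u)\<close> transports it to all real times, and \<open>F t\<close> is a
  subalgebra of \<open>M\<close>.\<close>

lemma progressive_measurable:
  assumes "progressive F H" "0 \<le> t"
  shows "(\<lambda>(u, \<omega>). indicator {0..t} u * H u \<omega>) \<in> borel_measurable (borel \<Otimes>\<^sub>M M)"
proof -
  have H: "case_prod H \<in> borel_measurable (restrict_space borel {0..t} \<Otimes>\<^sub>M F t)"
    using assms by (simp add: progressive_def)
  have sub: "subalgebra M (F t)" using filtered by (simp add: filtered_prob_space_def)
  have "(\<lambda>x. x) \<in> M \<rightarrow>\<^sub>M F t"
    using measurable_from_subalg[OF sub, of "\<lambda>x. x" "F t"] by simp
  moreover have "(\<lambda>u. max 0 (min t u)) \<in> borel \<rightarrow>\<^sub>M restrict_space borel {0..t}"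
    using assms(2) by (intro measurable_restrict_space2) auto
  ultimately have "(\<lambda>(u, \<omega>). (max 0 (min t u), \<omega>)) \<in>
      borel \<Otimes>\<^sub>M M \<rightarrow>\<^sub>M restrict_space borel {0..t} \<Otimes>\<^sub>M F t"
    by measurable
  from measurable_compose[OF this H]
  have [measurable]: "(\<lambda>p. H (max 0 (min t (fst p))) (snd p)) \<in> borel_measurable (borel \<Otimes>\<^sub>M M)"
    by (simp add: case_prod_beta')
  have "(\<lambda>(u, \<omega>). indicator {0..t} u * H u \<omega>) =
      (\<lambda>p. indicator {0..t} (fst p) * H (max 0 (min t (fst p))) (snd p))"
    by (auto simp: fun_eq_iff indicator_def)
  then show ?thesis by simp
qed

text \<open>Along a subsequence the simple integrals and their L2 errors both converge almost
  surely. Each simple integral is truncated when its own bracket would pass a level just above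
  \<open>N\<close>. On the event \<open>G \<le> N\<close> this truncation is eventually inactive, so
  Fatou bounds the left side; dominated convergence evaluates the right side.\<close>

lemma ito_integral_minus_const_bound_aux:
  fixes a :: real
  assumes ito: "has_ito_integral M F W H t X" and t: "0 < t" and N: "0 < N" and \<delta>: "0 < \<delta>"
  defines "G \<equiv> \<lambda>\<omega>. \<integral>\<^sup>+u\<in>{0..t}. ennreal ((H u \<omega> - a)\<^sup>2) \<partial>lborel"
  shows "(\<integral>\<^sup>+\<omega>. ennreal ((X \<omega> - a * W t \<omega>)\<^sup>2) * indicator {\<omega>. G \<omega> \<le> ennreal N} \<omega> \<partial>M)
    \<le> ennreal (1 + 2 * \<delta>) * (\<integral>\<^sup>+\<omega>. min (ennreal N) (G \<omega>) \<partial>M)"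
proof -
  from ito have prog: "progressive F H"
    and int2: "AE \<omega> in M. set_integrable lborel {0..t} (\<lambda>u. (H u \<omega>)\<^sup>2)"
    by (auto simp: has_ito_integral_def)
  from ito obtain n \<tau> \<xi> where sp: "\<And>k. simple_process M F (n k) (\<tau> k) (\<xi> k)"
    and R0: "tendsto_in_prob M (\<lambda>k \<omega>. LINT u:{0..t}|lborel.
        (simple_value (n k) (\<tau> k) (\<xi> k) u \<omega> - H u \<omega>)\<^sup>2) (\<lambda>_. 0)"
    and Z0: "tendsto_in_prob M (\<lambda>k. simple_integral W (n k) (\<tau> k) (\<xi> k) t) X"
    by (auto simp: has_ito_integral_def)
  define K where "K k = simple_value (n k) (\<tau> k) (\<xi> k)" for k
  define R where "R k \<omega> = (LINT u:{0..t}|lborel. (K k u \<omega> - H u \<omega>)\<^sup>2)" for k \<omega>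
  define Z where "Z k = simple_integral W (n k) (\<tau> k) (\<xi> k) t" for k
  have R: "tendsto_in_prob M R (\<lambda>_. 0)" and Z: "tendsto_in_prob M Z X"
    using R0 Z0 by (simp_all add: R_def[abs_def] K_def Z_def[abs_def])
  obtain r1 :: "nat \<Rightarrow> nat" where r1: "strict_mono r1" "AE \<omega> in M. (\<lambda>k. R (r1 k) \<omega>) \<longlonglongrightarrow> 0"
    using tendsto_in_prob_AE_subseq[OF R] by blast
  obtain r2 :: "nat \<Rightarrow> nat" where r2: "strict_mono r2" "AE \<omega> in M. (\<lambda>k. Z (r1 (r2 k)) \<omega>) \<longlonglongrightarrow> X \<omega>"
    using tendsto_in_prob_AE_subseq[OF tendsto_in_prob_subseq[OF Z r1(1)]] by blast
  define r where "r k = r1 (r2 k)" for k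
  have R_AE: "AE \<omega> in M. (\<lambda>k. R (r k) \<omega>) \<longlonglongrightarrow> 0"
    using r1(2)
  proof eventually_elim
    case (elim \<omega>)
    from LIMSEQ_subseq_LIMSEQ[OF this r2(1)] show ?case by (simp add: comp_def r_def)
  qed
  have [measurable]: "R k \<in> borel_measurable M" "Z k \<in> borel_measurable M" "X \<in> borel_measurable M" for k
    using R Z by (auto simp: tendsto_in_prob_def)
  have [measurable]: "W t \<in> borel_measurable M" "W 0 \<in> borel_measurable M"
    using t by (auto intro: W_measurable)
  \<comment> \<open>Joint measurability of \<open>H\<close> is available on \<open>[0, t]\<close>
    only; \<open>h\<close> extends \<open>H\<close> by 0.\<close>
  define h where "h u \<omega> = indicator {0..t} u * H u \<omega>" for u \<omega>
  have h_meas[measurable]: "(\<lambda>(u, \<omega>). h u \<omega>) \<in> borel_measurable (borel \<Otimes>\<^sub>M M)"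
    using progressive_measurable[OF prog, of t] t by (simp add: h_def)
  have G_eq: "G = (\<lambda>\<omega>. \<integral>\<^sup>+u. ennreal ((h u \<omega> - a)\<^sup>2) * indicator {0..t} u \<partial>lborel)"
    unfolding G_def h_def by (intro ext nn_integral_cong) (auto simp: indicator_def)
  have [measurable]: "G \<in> borel_measurable M"
    unfolding G_eq by measurable
  \<comment> \<open>On \<open>G \<le> N\<close> the brackets are bounded by quantities tending to at
    most \<open>(1 + \<delta>) * N\<close>; the second \<open>\<delta>\<close> leaves a strict gap
    below the truncation level.\<close>
  define N' where "N' = (1 + 2 * \<delta>) * N"
  have N': "0 \<le> N'" using N \<delta> by (simp add: N'_def)
  define V where "V k \<omega> = (\<integral>\<^sup>+u\<in>{0..t}. ennreal ((K k u \<omega> - a)\<^sup>2) \<partial>lborel)" for k \<omega>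
  \<comment> \<open>Bundles what is required of one truncated integral \<open>Y\<close> and its
    bracket \<open>Q\<close>, so that both can be chosen as sequences in \<open>k\<close>.\<close>
  define good where "good k Y Q \<longleftrightarrow> Y \<in> borel_measurable M \<and>
      (\<integral>\<^sup>+\<omega>. ennreal ((Y \<omega>)\<^sup>2) \<partial>M) \<le> (\<integral>\<^sup>+\<omega>. ennreal (min N' (Q \<omega>)) \<partial>M) \<and>
      (\<forall>\<omega>. Q \<omega> \<le> N' \<longrightarrow> Y \<omega> = Z k \<omega> - a * (W t \<omega> - W 0 \<omega>)) \<and>
      (\<forall>\<omega>. ennreal (Q \<omega>) \<le> V k \<omega>)" for k Y Q
  have "\<exists>Y Q. good k Y Q" for k
  proof -
    obtain s m \<eta> C where *: "0 \<le> s 0" "\<And>i. i < m \<Longrightarrow> s i \<le> s (Suc i)"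
      "\<And>i. i < m \<Longrightarrow> \<eta> i \<in> borel_measurable (F (s i))"
      "\<And>i \<omega>. i < m \<Longrightarrow> \<omega> \<in> space M \<Longrightarrow> \<bar>\<eta> i \<omega>\<bar> \<le> C"
      and tr: "\<And>\<omega>. martingale_transform s \<eta> m \<omega> = simple_integral W (n k) (\<tau> k) (\<xi> k) t \<omega> - a * (W t \<omega> - W 0 \<omega>)"
      and qv: "\<And>\<omega>. ennreal (quadratic_variation s \<eta> m \<omega>) \<le>
        (\<integral>\<^sup>+u\<in>{0..t}. ennreal ((simple_value (n k) (\<tau> k) (\<xi> k) u \<omega> - a)\<^sup>2) \<partial>lborel)"
      by (rule simple_process_minus_const[OF sp[of k] t, of a]) blast
    obtain Y where "Y \<in> borel_measurable M"
      "(\<integral>\<^sup>+\<omega>. ennreal ((Y \<omega>)\<^sup>2) \<partial>M) \<le> (\<integral>\<^sup>+\<omega>. ennreal (min N' (quadratic_variation s \<eta> m \<omega>)) \<partial>M)"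
      "\<And>\<omega>. quadratic_variation s \<eta> m \<omega> \<le> N' \<Longrightarrow> Y \<omega> = martingale_transform s \<eta> m \<omega>"
      by (rule truncated_isometry[OF * N']) blast+
    then have "good k Y (quadratic_variation s \<eta> m)"
      unfolding good_def Z_def V_def K_def using tr qv by simp
    then show ?thesis by blast
  qed
  then obtain Y Q where "\<And>k. good k (Y k) (Q k)" by metis
  then have Y[measurable]: "\<And>k. Y k \<in> borel_measurable M"
    and YQ: "\<And>k. (\<integral>\<^sup>+\<omega>. ennreal ((Y k \<omega>)\<^sup>2) \<partial>M) \<le> (\<integral>\<^sup>+\<omega>. ennreal (min N' (Q k \<omega>)) \<partial>M)"
    and Y_eq: "\<And>k \<omega>. Q k \<omega> \<le> N' \<Longrightarrow> Y k \<omega> = Z k \<omega> - a * (W t \<omega> - W 0 \<omega>)"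
    and QV: "\<And>k \<omega>. ennreal (Q k \<omega>) \<le> V k \<omega>"
    unfolding good_def by blast+
  \<comment> \<open>A bound for the bracket of the approximation, from \<open>square_add_le\<close>;
    the large factor \<open>1 + 1 / \<delta>\<close> meets an error that tends to 0 along
    \<open>r\<close>.\<close>
  define B where "B k \<omega> = ennreal (1 + \<delta>) * G \<omega> + ennreal (1 + 1 / \<delta>) * ennreal (R k \<omega>)" for k \<omega>
  have [measurable]: "B k \<in> borel_measurable M" for k unfolding B_def by measurable
  have K_meas[measurable]: "(\<lambda>u. K k u \<omega>) \<in> borel_measurable borel" for k \<omega>
    unfolding K_def simple_value_def by measurable
  have VB: "AE \<omega> in M. \<forall>k. V k \<omega> \<le> B k \<omega>"
    using int2 AE_space
  proof eventually_elim
    case (elim \<omega>)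
    have h\<omega>[measurable]: "(\<lambda>u. h u \<omega>) \<in> borel_measurable borel"
      using measurable_compose[OF measurable_Pair2'[OF elim(2)] h_meas] by simp
    show ?case
    proof
      fix k
      \<comment> \<open>\<open>R k\<close> is a Bochner integral and would default to 0 for a
        non-integrable error. Square integrability of \<open>h\<close> and \<open>K k\<close> rules
        this out and identifies \<open>R k\<close> with a nonnegative integral.\<close>
      have "integrable lborel (\<lambda>u. indicator {0..t} u * (h u \<omega>)\<^sup>2)"
        using elim(1) unfolding set_integrable_def
        by (rule back_subst[of "integrable lborel"]) (auto simp: h_def indicator_def)
      moreover have "integrable lborel (\<lambda>u. indicator {0..t} u * (K k u \<omega>)\<^sup>2)"
      proof (rule integrableI_bounded_set_indicator[where B="(\<Sum>i<n k. \<bar>\<xi> k i \<omega>\<bar>)\<^sup>2" and A="{0..t}" and f="\<lambda>u. (K k u \<omega>)\<^sup>2", simplified real_scaleR_def])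
        have "\<bar>K k u \<omega>\<bar> \<le> (\<Sum>i<n k. \<bar>\<xi> k i \<omega>\<bar>)" for u
          unfolding K_def simple_value_def
          by (rule order_trans[OF sum_abs]) (auto intro!: sum_mono simp: indicator_def)
        then show "AE u in lborel. u \<in> {0..t} \<longrightarrow> norm ((K k u \<omega>)\<^sup>2) \<le> (\<Sum>i<n k. \<bar>\<xi> k i \<omega>\<bar>)\<^sup>2"
          by (auto simp: abs_le_square_iff[symmetric] sum_nonneg intro!: AE_I2) 
      qed (use t in auto)
      ultimately have "integrable lborel (\<lambda>u. 2 * (indicator {0..t} u * (h u \<omega>)\<^sup>2) + 2 * (indicator {0..t} u * (K k u \<omega>)\<^sup>2))"
        by simp
      then have "integrable lborel (\<lambda>u. indicator {0..t} u * (K k u \<omega> - h u \<omega>)\<^sup>2)"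
      proof (rule Bochner_Integration.integrable_bound)
        show "AE u in lborel. norm (indicator {0..t} u * (K k u \<omega> - h u \<omega>)\<^sup>2)
          \<le> norm (2 * (indicator {0..t} u * (h u \<omega>)\<^sup>2) + 2 * (indicator {0..t} u * (K k u \<omega>)\<^sup>2))"
          using square_add_le[of 1 "K k u \<omega>" "- h u \<omega>" for u]
          by (intro AE_I2) (auto simp: indicator_def algebra_simps)
      qed measurable
      then have "(\<integral>\<^sup>+u. ennreal (indicator {0..t} u * (K k u \<omega> - h u \<omega>)\<^sup>2) \<partial>lborel) =
          ennreal (LINT u|lborel. indicator {0..t} u * (K k u \<omega> - h u \<omega>)\<^sup>2)"
        by (rule nn_integral_eq_integral) auto
      also have "(LINT u|lborel. indicator {0..t} u * (K k u \<omega> - h u \<omega>)\<^sup>2) = R k \<omega>"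
        unfolding R_def set_lebesgue_integral_def
        by (intro Bochner_Integration.integral_cong) (auto simp: h_def indicator_def)
      finally have R_eq: "(\<integral>\<^sup>+u. ennreal (indicator {0..t} u * (K k u \<omega> - h u \<omega>)\<^sup>2) \<partial>lborel) = ennreal (R k \<omega>)" .
      have "V k \<omega> \<le> (\<integral>\<^sup>+u. ennreal (1 + \<delta>) * (ennreal ((h u \<omega> - a)\<^sup>2) * indicator {0..t} u) +
          ennreal (1 + 1 / \<delta>) * ennreal (indicator {0..t} u * (K k u \<omega> - h u \<omega>)\<^sup>2) \<partial>lborel)"
        unfolding V_def
      proof (intro nn_integral_mono)
        fix u :: real
        have "(K k u \<omega> - a)\<^sup>2 \<le> (1 + \<delta>) * (h u \<omega> - a)\<^sup>2 + (1 + 1 / \<delta>) * (K k u \<omega> - h u \<omega>)\<^sup>2"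
          using square_add_le[OF \<delta>, of "h u \<omega> - a" "K k u \<omega> - h u \<omega>"] by simp
        then show "ennreal ((K k u \<omega> - a)\<^sup>2) * indicator {0..t} u
          \<le> ennreal (1 + \<delta>) * (ennreal ((h u \<omega> - a)\<^sup>2) * indicator {0..t} u) +
          ennreal (1 + 1 / \<delta>) * ennreal (indicator {0..t} u * (K k u \<omega> - h u \<omega>)\<^sup>2)"
          using \<delta> by (auto simp: indicator_def ennreal_mult[symmetric] ennreal_plus[symmetric]
              simp del: ennreal_plus intro!: ennreal_leI)
      qed
      also have "\<dots> = B k \<omega>"
        unfolding B_def G_eq by (subst nn_integral_add) (auto simp: nn_integral_cmult R_eq)
      finally show "V k \<omega> \<le> B k \<omega>" .
    qed
  qed
  have B_lim: "AE \<omega> in M. (\<lambda>k. B (r k) \<omega>) \<longlonglongrightarrow> ennreal (1 + \<delta>) * G \<omega>"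
    using R_AE
  proof eventually_elim
    case (elim \<omega>)
    have "(\<lambda>k. B (r k) \<omega>) \<longlonglongrightarrow> ennreal (1 + \<delta>) * G \<omega> + ennreal (1 + 1 / \<delta>) * ennreal 0"
      unfolding B_def by (intro tendsto_add tendsto_const ennreal_tendsto_cmult tendsto_ennrealI elim) auto
    then show ?case by simp
  qed
  have lower: "AE \<omega> in M. ennreal ((X \<omega> - a * W t \<omega>)\<^sup>2) * indicator {\<omega>. G \<omega> \<le> ennreal N} \<omega>
      \<le> liminf (\<lambda>k. ennreal ((Y (r k) \<omega>)\<^sup>2))"
    using B_lim VB r2(2) W_zero
  proof eventually_elim
    case (elim \<omega>)
    show ?case
    proof (cases "G \<omega> \<le> ennreal N")
      case True
      have "ennreal (1 + \<delta>) * G \<omega> \<le> ennreal ((1 + \<delta>) * N)"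
        using mult_left_mono[OF True, of "ennreal (1 + \<delta>)"] \<delta> N by (simp add: ennreal_mult)
      also have "\<dots> < ennreal N'"
        using N \<delta> by (auto simp: N'_def ennreal_less_iff)
      finally have "eventually (\<lambda>k. B (r k) \<omega> < ennreal N') sequentially"
        using elim(1) by (intro order_tendstoD(2)) auto
      then have "eventually (\<lambda>k. (Z (r k) \<omega> - a * W t \<omega>)\<^sup>2 = (Y (r k) \<omega>)\<^sup>2) sequentially"
      proof eventually_elim
        case (elim k)
        have "ennreal (Q (r k) \<omega>) \<le> ennreal N'"
          using QV[of "r k" \<omega>] \<open>\<forall>k. V k \<omega> \<le> B k \<omega>\<close> elim by (meson less_imp_le order_trans)
        then have "Q (r k) \<omega> \<le> N'" using N' by (simp add: ennreal_le_iff)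
        from Y_eq[OF this] show ?case using \<open>W 0 \<omega> = 0\<close> by simp
      qed
      moreover have "(\<lambda>k. (Z (r k) \<omega> - a * W t \<omega>)\<^sup>2) \<longlonglongrightarrow> (X \<omega> - a * W t \<omega>)\<^sup>2"
        using elim(3) unfolding r_def by (intro tendsto_intros)
      ultimately have "(\<lambda>k. (Y (r k) \<omega>)\<^sup>2) \<longlonglongrightarrow> (X \<omega> - a * W t \<omega>)\<^sup>2"
        by (rule Lim_transform_eventually[rotated])
      then have "(\<lambda>k. ennreal ((Y (r k) \<omega>)\<^sup>2)) \<longlonglongrightarrow> ennreal ((X \<omega> - a * W t \<omega>)\<^sup>2)"
        by (rule tendsto_ennrealI)
      from lim_imp_Liminf[OF _ this] True show ?thesis by simp
    qed simp
  qed
  have [simp]: "emeasure M (space M) = 1" by (rule emeasure_space_1)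
  have "(\<integral>\<^sup>+\<omega>. ennreal ((X \<omega> - a * W t \<omega>)\<^sup>2) * indicator {\<omega>. G \<omega> \<le> ennreal N} \<omega> \<partial>M)
      \<le> (\<integral>\<^sup>+\<omega>. liminf (\<lambda>k. ennreal ((Y (r k) \<omega>)\<^sup>2)) \<partial>M)"
    by (rule nn_integral_mono_AE[OF lower])
  also have "\<dots> \<le> liminf (\<lambda>k. \<integral>\<^sup>+\<omega>. ennreal ((Y (r k) \<omega>)\<^sup>2) \<partial>M)"
    by (rule nn_integral_liminf) measurable
  also have "\<dots> \<le> liminf (\<lambda>k. \<integral>\<^sup>+\<omega>. min (ennreal N') (B (r k) \<omega>) \<partial>M)"
  proof (intro Liminf_mono always_eventually allI)
    fix k
    have "(\<integral>\<^sup>+\<omega>. ennreal ((Y (r k) \<omega>)\<^sup>2) \<partial>M) \<le> (\<integral>\<^sup>+\<omega>. ennreal (min N' (Q (r k) \<omega>)) \<partial>M)"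
      by (rule YQ)
    also have "\<dots> \<le> (\<integral>\<^sup>+\<omega>. min (ennreal N') (B (r k) \<omega>) \<partial>M)"
    proof (rule nn_integral_mono_AE)
      show "AE \<omega> in M. ennreal (min N' (Q (r k) \<omega>)) \<le> min (ennreal N') (B (r k) \<omega>)"
        using VB
      proof eventually_elim
        case (elim \<omega>)
        then have "ennreal (Q (r k) \<omega>) \<le> B (r k) \<omega>" using QV[of "r k" \<omega>] order_trans by blast
        then show ?case
          by (metis ennreal_leI min.bounded_iff min.cobounded1 min.cobounded2 order_trans)
      qed
    qed
    finally show "(\<integral>\<^sup>+\<omega>. ennreal ((Y (r k) \<omega>)\<^sup>2) \<partial>M) \<le> (\<integral>\<^sup>+\<omega>. min (ennreal N') (B (r k) \<omega>) \<partial>M)" .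
  qed
  also have "\<dots> = (\<integral>\<^sup>+\<omega>. min (ennreal N') (ennreal (1 + \<delta>) * G \<omega>) \<partial>M)"
  proof (rule lim_imp_Liminf)
    show "(\<lambda>k. \<integral>\<^sup>+\<omega>. min (ennreal N') (B (r k) \<omega>) \<partial>M) \<longlonglongrightarrow>
        (\<integral>\<^sup>+\<omega>. min (ennreal N') (ennreal (1 + \<delta>) * G \<omega>) \<partial>M)"
    proof (rule nn_integral_dominated_convergence[where w="\<lambda>_. ennreal N'"])
      show "AE \<omega> in M. (\<lambda>k. min (ennreal N') (B (r k) \<omega>)) \<longlonglongrightarrow> min (ennreal N') (ennreal (1 + \<delta>) * G \<omega>)"
        using B_lim by eventually_elim (intro tendsto_min tendsto_const)
    qed (auto simp: less_top[symmetric] ennreal_mult_less_top)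
  qed simp
  also have "\<dots> \<le> (\<integral>\<^sup>+\<omega>. ennreal (1 + 2 * \<delta>) * min (ennreal N) (G \<omega>) \<partial>M)"
  proof (rule nn_integral_mono)
    fix \<omega>
    have "ennreal (1 + \<delta>) * G \<omega> \<le> ennreal (1 + 2 * \<delta>) * G \<omega>"
      using \<delta> by (intro mult_right_mono ennreal_leI) auto
    then show "min (ennreal N') (ennreal (1 + \<delta>) * G \<omega>) \<le> ennreal (1 + 2 * \<delta>) * min (ennreal N) (G \<omega>)"
      using \<delta> N by (auto simp: N'_def ennreal_mult min_def)
  qed
  also have "\<dots> = ennreal (1 + 2 * \<delta>) * (\<integral>\<^sup>+\<omega>. min (ennreal N) (G \<omega>) \<partial>M)"
    by (rule nn_integral_cmult) measurable
  finally show ?thesis .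
qed

text \<open>The factor \<open>1 + 2 * \<delta>\<close> disappears in the limit
  \<open>\<delta> \<rightarrow> 0\<close>, since nothing else in the estimate depends on
  \<open>\<delta>\<close>.\<close>

lemma ito_integral_minus_const_bound:
  fixes a :: real
  assumes ito: "has_ito_integral M F W H t X" and t: "0 < t" and N: "0 < N"
  defines "G \<equiv> \<lambda>\<omega>. \<integral>\<^sup>+u\<in>{0..t}. ennreal ((H u \<omega> - a)\<^sup>2) \<partial>lborel"
  shows "(\<integral>\<^sup>+\<omega>. ennreal ((X \<omega> - a * W t \<omega>)\<^sup>2) * indicator {\<omega>. G \<omega> \<le> ennreal N} \<omega> \<partial>M)
    \<le> (\<integral>\<^sup>+\<omega>. min (ennreal N) (G \<omega>) \<partial>M)"
    (is "?L \<le> ?R")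
proof (rule tendsto_lowerbound[where F="at_right 0"])
  have "((\<lambda>\<delta>. ennreal (1 + 2 * \<delta>) * ?R) \<longlongrightarrow> ennreal (1 + 2 * 0) * ?R) (at_right 0)"
    by (intro tendsto_mult_ennreal tendsto_ennrealI tendsto_intros) auto
  then show "((\<lambda>\<delta>. ennreal (1 + 2 * \<delta>) * ?R) \<longlongrightarrow> ?R) (at_right 0)" by simp
  show "eventually (\<lambda>\<delta>. ?L \<le> ennreal (1 + 2 * \<delta>) * ?R) (at_right 0)"
    using eventually_at_right_less[of 0]
    by eventually_elim (unfold G_def, rule ito_integral_minus_const_bound_aux[OF ito t N])
qed simp

end

subsection \<open>The CEV price near time zero\<close>

lemma nn_integral_set_continuous:
  fixes h :: "real \<Rightarrow> real"
  assumes "continuous_on {0..t} h" "\<And>u. u \<in> {0..t} \<Longrightarrow> 0 \<le> h u"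
  shows "(\<integral>\<^sup>+u\<in>{0..t}. ennreal (h u) \<partial>lborel) = ennreal (integral {0..t} h)"
proof -
  have i: "set_integrable lborel {0..t} h"
    by (rule borel_integrable_atLeastAtMost') (rule assms)
  have "(\<integral>\<^sup>+u\<in>{0..t}. ennreal (h u) \<partial>lborel) = (\<integral>\<^sup>+u. ennreal (indicator {0..t} u * h u) \<partial>lborel)"
    by (intro nn_integral_cong) (auto simp: indicator_def)
  also have "\<dots> = ennreal (LINT u:{0..t}|lborel. h u)"
    unfolding set_lebesgue_integral_def using i assms(2)
    by (subst nn_integral_eq_integral) (auto simp: set_integrable_def indicator_def)
  also have "(LINT u:{0..t}|lborel. h u) = integral {0..t} h"
    using i by (rule set_borel_integral_eq_integral)
  finally show ?thesis .
qed

text \<open>If the clock \<open>g\<close> passes \<open>N\<close> before \<open>t\<close>, the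
  intermediate value theorem gives a time \<open>v\<close> with \<open>g v = N\<close>, and by
  monotonicity the indicator is 1 up to \<open>v\<close>. Otherwise \<open>v = t\<close> works. This
  time \<open>v\<close> does the work of a stopping time, path by path.\<close>

lemma min_clock_le:
  fixes h :: "real \<Rightarrow> real"
  assumes h: "continuous_on {0..t} h" "\<And>u. u \<in> {0..t} \<Longrightarrow> 0 \<le> h u" and t: "0 \<le> t" and N: "0 \<le> N"
  defines "g \<equiv> \<lambda>u. \<integral>\<^sup>+v\<in>{0..u}. ennreal (h v) \<partial>lborel"
  shows "min (ennreal N) (g t) \<le>
    (\<integral>\<^sup>+u\<in>{0..t}. ennreal (h u) * indicator {u. g u \<le> ennreal N} u \<partial>lborel)"
proof -
  have g_mono: "g u \<le> g v" if "u \<le> v" for u v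
    unfolding g_def using that by (intro nn_integral_mono) (auto simp: indicator_def)
  have key: "g v \<le> (\<integral>\<^sup>+u\<in>{0..t}. ennreal (h u) * indicator {u. g u \<le> ennreal N} u \<partial>lborel)"
    if "v \<le> t" "g v \<le> ennreal N" for v
  proof -
    have "g v = (\<integral>\<^sup>+u\<in>{0..v}. ennreal (h u) \<partial>lborel)"
      by (simp add: g_def)
    also have "\<dots> \<le> (\<integral>\<^sup>+u\<in>{0..t}. ennreal (h u) * indicator {u. g u \<le> ennreal N} u \<partial>lborel)"
      using that by (intro nn_integral_mono) (auto simp: indicator_def intro: order_trans[OF g_mono])
    finally show ?thesis .
  qed
  show ?thesis
  proof (cases "g t \<le> ennreal N")
    case True
    with key[of t] show ?thesis by (simp add: min_absorb2)
  next
    case False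
    have g_eq: "g u = ennreal (integral {0..u} h)" if "0 \<le> u" "u \<le> t" for u
      unfolding g_def using that h
      by (intro nn_integral_set_continuous) (auto intro: continuous_on_subset)
    have "continuous_on {0..t} (\<lambda>u. integral {0..u} h)"
      by (intro indefinite_integral_continuous_1 integrable_continuous_interval h)
    moreover have "N \<le> integral {0..t} h"
      using False g_eq[of t] t N by (auto simp: ennreal_le_iff2 not_le)
    ultimately obtain v where v: "0 \<le> v" "v \<le> t" "integral {0..v} h = N"
      using IVT'[of "\<lambda>u. integral {0..u} h" 0 N t] t N by auto
    then show ?thesis
      using key[of v] g_eq[of v] by (auto intro: min.coboundedI1)
  qed
qed

text \<open>Removes a localization: where \<open>g\<close> is finite the truncating indicator is
  eventually 1, so Fatou carries a bound uniform in \<open>N\<close> to the whole space.\<close>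

lemma (in prob_space) nn_integral_le_truncated:
  fixes g :: "'a \<Rightarrow> ennreal"
  assumes [measurable]: "f \<in> borel_measurable M" "g \<in> borel_measurable M"
    and fin: "AE \<omega> in M. g \<omega> < top"
    and bound: "\<And>N. 0 < N \<Longrightarrow> (\<integral>\<^sup>+\<omega>. f \<omega> * indicator {\<omega>. g \<omega> \<le> ennreal N} \<omega> \<partial>M) \<le> C"
  shows "(\<integral>\<^sup>+\<omega>. f \<omega> \<partial>M) \<le> C"
proof -
  \<comment> \<open>\<open>Suc n\<close> keeps the level positive, as \<open>bound\<close>
    demands.\<close>
  let ?f = "\<lambda>n \<omega>. f \<omega> * indicator {\<omega>. g \<omega> \<le> ennreal (real (Suc n))} \<omega>"
  have "AE \<omega> in M. f \<omega> \<le> liminf (\<lambda>n. ?f n \<omega>)"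
    using fin
  proof eventually_elim
    case (elim \<omega>)
    then obtain y where y: "g \<omega> = ennreal y" "0 \<le> y" by (cases "g \<omega>") auto
    obtain n0 where "y \<le> real n0" using real_arch_simple by blast
    then have "eventually (\<lambda>n. f \<omega> \<le> ?f n \<omega>) sequentially"
      using y by (intro eventually_sequentiallyI[of n0]) (auto simp: indicator_def simp del: of_nat_Suc intro!: ennreal_leI)
    then show ?case by (intro Liminf_bounded) auto
  qed
  then have "(\<integral>\<^sup>+\<omega>. f \<omega> \<partial>M) \<le> (\<integral>\<^sup>+\<omega>. liminf (\<lambda>n. ?f n \<omega>) \<partial>M)"
    by (rule nn_integral_mono_AE)
  also have "\<dots> \<le> liminf (\<lambda>n. \<integral>\<^sup>+\<omega>. ?f n \<omega> \<partial>M)"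
    by (rule nn_integral_liminf) measurable
  also have "\<dots> \<le> limsup (\<lambda>n. \<integral>\<^sup>+\<omega>. ?f n \<omega> \<partial>M)"
    by (rule Liminf_le_Limsup) simp
  also have "\<dots> \<le> C"
    by (intro Limsup_bounded always_eventually allI bound) auto
  finally show ?thesis .
qed

text \<open>For a non-integrable function the Bochner integral is 0 by convention, so the inequality
  covers that case too.\<close>

lemma ennreal_integral_le_nn_integral:
  fixes f :: "'a \<Rightarrow> real"
  assumes "\<And>x. 0 \<le> f x"
  shows "ennreal (integral\<^sup>L M f) \<le> (\<integral>\<^sup>+x. ennreal (f x) \<partial>M)"
proof (cases "integrable M f")
  case True
  then show ?thesis using assms by (subst nn_integral_eq_integral) auto
qed (simp add: not_integrable_integral_eq)

lemma nn_integral_interval_square_le: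
  assumes [measurable]: "f \<in> borel_measurable borel" and "0 \<le> t"
  shows "(\<integral>\<^sup>+u\<in>{0..t}. f u \<partial>lborel)\<^sup>2 \<le> ennreal t * (\<integral>\<^sup>+u\<in>{0..t}. (f u)\<^sup>2 \<partial>lborel)"
proof -
  have "(\<integral>\<^sup>+u\<in>{0..t}. f u \<partial>lborel)\<^sup>2 =
      (\<integral>\<^sup>+u. (f u * indicator {0..t} u) * indicator {0..t} u \<partial>lborel)\<^sup>2"
    by (intro arg_cong[where f="\<lambda>x. x\<^sup>2"] nn_integral_cong) (auto simp: indicator_def)
  also have "\<dots> \<le> (\<integral>\<^sup>+u. (f u * indicator {0..t} u)\<^sup>2 \<partial>lborel) * (\<integral>\<^sup>+u. (indicator {0..t} u)\<^sup>2 \<partial>lborel)"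
    by (rule Cauchy_Schwarz_nn_integral) measurable
  also have "(\<integral>\<^sup>+u. (f u * indicator {0..t} u)\<^sup>2 \<partial>lborel) = (\<integral>\<^sup>+u\<in>{0..t}. (f u)\<^sup>2 \<partial>lborel)"
    by (intro nn_integral_cong) (auto simp: indicator_def)
  also have "(\<integral>\<^sup>+u. (indicator {0..t} u)\<^sup>2 \<partial>lborel) = (\<integral>\<^sup>+u. indicator {0..t} u \<partial>lborel)"
    by (intro nn_integral_cong) (auto simp: indicator_def)
  finally show ?thesis using assms(2) by (simp add: mult.commute)
qed

text \<open>After scaling by \<open>x\<close> the claim is that \<open>y powr \<beta>\<close> lies
  between 1 and \<open>y\<close>. It gives a Lipschitz bound about the fixed point \<open>x\<close>
  for all \<open>s \<ge> 0\<close>, although for \<open>0 < \<beta> < 1\<close> the power has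
  infinite slope at 0.\<close>

lemma powr_diff_le:
  fixes x s :: real
  assumes "0 < x" "0 \<le> s" "0 \<le> \<beta>" "\<beta> \<le> 1"
  shows "\<bar>s powr \<beta> - x powr \<beta>\<bar> \<le> x powr (\<beta> - 1) * \<bar>s - x\<bar>"
proof (cases "s = 0")
  case True
  with assms show ?thesis by (simp add: powr_diff powr_mult_base)
next
  case False
  define y where "y = s / x"
  have y: "0 < y" "s = y * x" using False assms by (auto simp: y_def)
  have "\<bar>y powr \<beta> - 1\<bar> \<le> \<bar>y - 1\<bar>"
  proof (cases "1 \<le> y")
    case True
    then have "1 \<le> y powr \<beta>" "y powr \<beta> \<le> y powr 1"
      using assms ge_one_powr_ge_zero[of y \<beta>] powr_mono[of \<beta> 1 y] by auto
    with True y show ?thesis by simp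
  next
    case False
    then have "y powr \<beta> \<le> 1" "y powr 1 \<le> y powr \<beta>"
      using assms y powr_le1[of \<beta> y] powr_mono'[of \<beta> 1 y] by auto
    with False y show ?thesis by simp
  qed
  then have "x powr \<beta> * \<bar>y powr \<beta> - 1\<bar> \<le> x powr \<beta> * \<bar>y - 1\<bar>"
    by (rule mult_left_mono) simp
  moreover have "s powr \<beta> - x powr \<beta> = x powr \<beta> * (y powr \<beta> - 1)"
    using y assms by (simp add: powr_mult algebra_simps)
  moreover have "x powr (\<beta> - 1) * \<bar>s - x\<bar> = x powr \<beta> * \<bar>y - 1\<bar>"
  proof -
    have "\<bar>s - x\<bar> = x * \<bar>y - 1\<bar>"
      using assms(1) abs_mult[of x "y - 1"] by (simp add: y(2) algebra_simps)
    then show ?thesis using assms(1) by (simp add: powr_diff)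
  qed
  ultimately show ?thesis by (simp add: abs_mult)
qed

section \<open>The price process, a jointly measurable version, and its localized martingale
  part\<close>

locale cev_setting = brownian_setting M F W
  for M :: "'a measure" and F :: "real \<Rightarrow> 'a measure" and W :: "real \<Rightarrow> 'a \<Rightarrow> real" +
  fixes S :: "real \<Rightarrow> 'a \<Rightarrow> real" and r q \<sigma> \<beta> S0 :: real
  assumes \<sigma>: "0 < \<sigma>" and \<beta>: "1 / 2 \<le> \<beta>" "\<beta> < 1" and S0: "0 < S0"
    and cev: "cev_model M F W r q \<sigma> \<beta> S0 S"
begin

sublocale pair_sigma_finite lborel M ..

text \<open>
  \<open>P\<close> is a version of the price on \<open>[0, 1]\<close>, recovered from the diffusion coefficient because only
  the latter is given as jointly measurable. Up to null sets, \<open>J t\<close> is the Ito integral of the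
  diffusion coefficient and \<open>D a t\<close> is the quadratic variation of \<open>J - a W\<close>.
\<close>

definition P :: "real \<Rightarrow> 'a \<Rightarrow> real" where
  "P u \<omega> = (indicator {0..1} u * (\<sigma> * S u \<omega> powr \<beta>) / \<sigma>) powr (1 / \<beta>)"

definition J :: "real \<Rightarrow> 'a \<Rightarrow> real" where
  "J t \<omega> = P t \<omega> - S0 - (r - q) * (LINT u:{0..t}|lborel. P u \<omega>)"

definition D :: "real \<Rightarrow> real \<Rightarrow> 'a \<Rightarrow> ennreal" where
  "D a t \<omega> = (\<integral>\<^sup>+u\<in>{0..t}. ennreal ((\<sigma> * P u \<omega> powr \<beta> - a)\<^sup>2) \<partial>lborel)"

lemma P_nonneg[simp]: "0 \<le> P u \<omega>"
  by (simp add: P_def)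

lemma S_adapted: "adapted F S"
  and S_continuous: "\<omega> \<in> space M \<Longrightarrow> continuous_on {0..} (\<lambda>t. S t \<omega>)"
  and S_nonneg: "AE \<omega> in M. \<forall>t\<ge>0. 0 \<le> S t \<omega>"
  using cev by (auto simp: cev_model_def sde_solution_def)

lemma S_measurable: "0 \<le> t \<Longrightarrow> S t \<in> borel_measurable M"
  using S_adapted borel_measurable_F by (auto simp: adapted_def)

lemma S_ito:
  "\<exists>I. (\<forall>t\<ge>0. has_ito_integral M F W (\<lambda>u \<omega>. \<sigma> * S u \<omega> powr \<beta>) t (I t)) \<and>
    (AE \<omega> in M. \<forall>t\<ge>0. S t \<omega> = S0 + (LINT u:{0..t}|lborel. (r - q) * S u \<omega>) + I t \<omega>)"
  using cev by (simp add: cev_model_def sde_solution_def)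

lemma P_measurable[measurable]: "(\<lambda>(u, \<omega>). P u \<omega>) \<in> borel_measurable (borel \<Otimes>\<^sub>M M)"
proof -
  have "progressive F (\<lambda>u \<omega>. \<sigma> * S u \<omega> powr \<beta>)"
    using S_ito by (auto simp: has_ito_integral_def)
  from progressive_measurable[OF this, of 1]
  have "(\<lambda>p. indicator {0..1} (fst p) * (\<sigma> * S (fst p) (snd p) powr \<beta>)) \<in> borel_measurable (borel \<Otimes>\<^sub>M M)"
    by (simp add: case_prod_beta')
  then show ?thesis
    unfolding P_def case_prod_beta' by measurable
qed

lemma P_measurable1[measurable]: "P u \<in> borel_measurable M"
  using measurable_compose[OF measurable_Pair1'[of u borel] P_measurable] by simp

lemma P_measurable2: "\<omega> \<in> space M \<Longrightarrow> (\<lambda>u. P u \<omega>) \<in> borel_measurable borel"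
  using measurable_compose[OF measurable_Pair2'[of \<omega> M] P_measurable] by simp

text \<open>Division by \<open>\<sigma>\<close> and the power \<open>1 / \<beta>\<close> undo the
  diffusion coefficient on nonnegative numbers. The price is nonnegative only almost surely, but
  then at all times at once.\<close>

lemma P_eq_S: "AE \<omega> in M. \<forall>u\<in>{0..1}. P u \<omega> = S u \<omega>"
  using S_nonneg
proof eventually_elim
  case (elim \<omega>)
  then show ?case using \<sigma> \<beta> by (auto simp: P_def powr_powr)
qed

lemma P_continuous: "AE \<omega> in M. continuous_on {0..1} (\<lambda>u. P u \<omega>)"
  using P_eq_S AE_space
proof eventually_elim
  case (elim \<omega>)
  have "continuous_on {0..1} (\<lambda>u. S u \<omega>)"
    using S_continuous[OF elim(2)] by (rule continuous_on_subset) auto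
  then show ?case
    by (rule back_subst[of "\<lambda>x. x"], intro continuous_on_cong) (use elim in auto)
qed

lemma D_measurable[measurable]: "(\<lambda>(t, \<omega>). D a t \<omega>) \<in> borel_measurable (borel \<Otimes>\<^sub>M M)"
proof -
  \<comment> \<open>With a conditional in place of the indicator of a varying interval, the
    integrand is measurable in \<open>u\<close>, \<open>t\<close> and \<open>\<omega>\<close>
    jointly.\<close>
  have "(\<lambda>(t, \<omega>). D a t \<omega>) = (\<lambda>p. \<integral>\<^sup>+u. (if 0 \<le> u \<and> u \<le> fst p
      then ennreal ((\<sigma> * P u (snd p) powr \<beta> - a)\<^sup>2) else 0) \<partial>lborel)"
    unfolding D_def by (auto simp: fun_eq_iff indicator_def intro!: nn_integral_cong)
  then show ?thesis by simp
qed

lemma D_measurable1[measurable]: "D a t \<in> borel_measurable M"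
  using measurable_compose[OF measurable_Pair1'[of t borel] D_measurable] by simp

lemma diffusion_continuous:
  assumes "continuous_on {0..1} (\<lambda>u. P u \<omega>)"
  shows "continuous_on {0..1} (\<lambda>u. (\<sigma> * P u \<omega> powr \<beta> - a)\<^sup>2)"
  using assms \<beta> by (intro continuous_intros continuous_on_powr') auto

lemma D_finite: 
  assumes "0 \<le> t" "t \<le> 1"
  shows "AE \<omega> in M. D a t \<omega> < top"
  using P_continuous
proof eventually_elim
  case (elim \<omega>)
  have "D a t \<omega> = ennreal (integral {0..t} (\<lambda>u. (\<sigma> * P u \<omega> powr \<beta> - a)\<^sup>2))"
    unfolding D_def using assms
    by (intro nn_integral_set_continuous continuous_on_subset[OF diffusion_continuous[OF elim]]) auto
  then show ?case by simp
qed

text \<open>This is the equation for \<open>S\<close> solved for its stochastic integral.\<close>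

lemma J_ito:
  assumes t: "0 \<le> t" "t \<le> 1"
  obtains X where "has_ito_integral M F W (\<lambda>u \<omega>. \<sigma> * S u \<omega> powr \<beta>) t X" "AE \<omega> in M. J t \<omega> = X \<omega>"
proof -
  obtain I where I: "\<forall>t\<ge>0. has_ito_integral M F W (\<lambda>u \<omega>. \<sigma> * S u \<omega> powr \<beta>) t (I t)"
    "AE \<omega> in M. \<forall>t\<ge>0. S t \<omega> = S0 + (LINT u:{0..t}|lborel. (r - q) * S u \<omega>) + I t \<omega>"
    using S_ito by (elim exE conjE)
  show thesis
  proof (rule that)
    show "has_ito_integral M F W (\<lambda>u \<omega>. \<sigma> * S u \<omega> powr \<beta>) t (I t)"
      using I(1) t by simp
  next
    show "AE \<omega> in M. J t \<omega> = I t \<omega>"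
      using I(2) P_eq_S
    proof eventually_elim
      case (elim \<omega>)
      have "(LINT u:{0..t}|lborel. P u \<omega>) = (LINT u:{0..t}|lborel. S u \<omega>)"
        using elim(2) t by (intro set_lebesgue_integral_cong) auto
      then show ?case using elim t by (simp add: J_def)
    qed
  qed
qed

lemma J_measurable[measurable]: "J t \<in> borel_measurable M"
proof -
  have "J t = (\<lambda>\<omega>. P t \<omega> - S0 - (r - q) * (LINT u|lborel. indicator {0..t} u * P u \<omega>))"
    by (simp add: J_def[abs_def] set_lebesgue_integral_def)
  then show ?thesis by simp
qed

lemma J_minus_const_bound:
  assumes t: "0 < t" "t \<le> 1" and N: "0 < N"
  shows "(\<integral>\<^sup>+\<omega>. ennreal ((J t \<omega> - a * W t \<omega>)\<^sup>2) * indicator {\<omega>. D a t \<omega> \<le> ennreal N} \<omega> \<partial>M)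
    \<le> (\<integral>\<^sup>+\<omega>. min (ennreal N) (D a t \<omega>) \<partial>M)"
proof -
  obtain X where X: "has_ito_integral M F W (\<lambda>u \<omega>. \<sigma> * S u \<omega> powr \<beta>) t X" "AE \<omega> in M. J t \<omega> = X \<omega>"
    using J_ito[of t] t by auto
  let ?G = "\<lambda>\<omega>. \<integral>\<^sup>+u\<in>{0..t}. ennreal ((\<sigma> * S u \<omega> powr \<beta> - a)\<^sup>2) \<partial>lborel"
  have eq: "AE \<omega> in M. D a t \<omega> = ?G \<omega>"
    using P_eq_S
  proof eventually_elim
    case (elim \<omega>)
    then show ?case unfolding D_def using t
      by (intro nn_integral_cong) (auto simp: indicator_def)
  qed
  have "(\<integral>\<^sup>+\<omega>. ennreal ((J t \<omega> - a * W t \<omega>)\<^sup>2) * indicator {\<omega>. D a t \<omega> \<le> ennreal N} \<omega> \<partial>M) =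
    (\<integral>\<^sup>+\<omega>. ennreal ((X \<omega> - a * W t \<omega>)\<^sup>2) * indicator {\<omega>. ?G \<omega> \<le> ennreal N} \<omega> \<partial>M)"
    by (rule nn_integral_cong_AE) (use X(2) eq in \<open>eventually_elim, auto simp: indicator_def\<close>)
  also have "\<dots> \<le> (\<integral>\<^sup>+\<omega>. min (ennreal N) (?G \<omega>) \<partial>M)"
    by (rule ito_integral_minus_const_bound[OF X(1) t(1) N])
  also have "\<dots> = (\<integral>\<^sup>+\<omega>. min (ennreal N) (D a t \<omega>) \<partial>M)"
    by (rule nn_integral_cong_AE) (use eq in \<open>eventually_elim, auto\<close>)
  finally show ?thesis .
qed

text \<open>The clock is almost surely finite, so the level \<open>N\<close> can be sent to
  infinity. The right side may still be infinite; second moments of the price make it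
  useful.\<close>

lemma J_minus_const_square_le:
  assumes t: "0 < t" "t \<le> 1"
  shows "(\<integral>\<^sup>+\<omega>. ennreal ((J t \<omega> - a * W t \<omega>)\<^sup>2) \<partial>M) \<le> (\<integral>\<^sup>+\<omega>. D a t \<omega> \<partial>M)"
proof (rule nn_integral_le_truncated[where g="D a t"])
  show "(\<lambda>\<omega>. ennreal ((J t \<omega> - a * W t \<omega>)\<^sup>2)) \<in> borel_measurable M"
    using W_measurable[of t] t by simp
  show "AE \<omega> in M. D a t \<omega> < top"
    using D_finite t by auto
  fix N :: real assume "0 < N"
  from J_minus_const_bound[OF t this, of a]
  show "(\<integral>\<^sup>+\<omega>. ennreal ((J t \<omega> - a * W t \<omega>)\<^sup>2) * indicator {\<omega>. D a t \<omega> \<le> ennreal N} \<omega> \<partial>M)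
    \<le> (\<integral>\<^sup>+\<omega>. D a t \<omega> \<partial>M)"
    by (rule order_trans) (auto intro: nn_integral_mono)
qed measurable

end

text \<open>For \<open>p > 1\<close> this is \<open>p \<le> p powr (2 * \<beta>)\<close>. Through it
  the clock, an integral of the squared diffusion coefficient, controls the integral of the
  price.\<close>

lemma le_one_plus_powr_square:
  fixes p :: real
  assumes "0 \<le> p" "1 / 2 \<le> \<beta>"
  shows "p \<le> 1 + (p powr \<beta>)\<^sup>2"
proof (cases "p \<le> 1")
  case False
  then have "p powr 1 \<le> p powr (2 * \<beta>)" using assms by (intro powr_mono) auto
  also have "\<dots> = (p powr \<beta>)\<^sup>2" by (simp add: power2_eq_square powr_add[symmetric])
  finally show ?thesis using False by simp
qed (use assms in \<open>auto intro: add_increasing2\<close>)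

text \<open>Linear growth of the diffusion coefficient: \<open>p powr \<beta>\<close> is at most the
  larger of 1 and \<open>p\<close>.\<close>

lemma powr_square_le_one_plus:
  fixes p :: real
  assumes "0 \<le> p" "0 \<le> \<beta>" "\<beta> \<le> 1"
  shows "(p powr \<beta>)\<^sup>2 \<le> 1 + p\<^sup>2"
proof (cases "p \<le> 1")
  case True
  then have "p powr \<beta> \<le> 1" using assms by (intro powr_le1) auto
  then have "(p powr \<beta>)\<^sup>2 \<le> 1" by (simp add: power_le_one)
  then show ?thesis by (rule order_trans) simp
next
  case False
  then have "p powr \<beta> \<le> p powr 1" using assms by (intro powr_mono) auto
  then have "(p powr \<beta>)\<^sup>2 \<le> p\<^sup>2" using False by (intro power_mono) auto
  then show ?thesis by simp
qed

lemma square_add3_le: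
  fixes x y z :: real
  shows "(x + y + z)\<^sup>2 \<le> 3 * x\<^sup>2 + 3 * y\<^sup>2 + 3 * z\<^sup>2"
proof -
  have "0 \<le> (x - y)\<^sup>2 + (y - z)\<^sup>2 + (x - z)\<^sup>2" by simp
  then show ?thesis by (simp add: power2_eq_square algebra_simps)
qed

section \<open>Bounded second moments near time zero by a Gronwall type argument\<close>

context cev_setting
begin

text \<open>Tonelli. The single time 0 is a null set, so the bound is asked for positive times only,
  where the Ito estimates are available.\<close>

lemma nn_integral_time_le:
  assumes f: "(\<lambda>(u, \<omega>). f u \<omega>) \<in> borel_measurable (borel \<Otimes>\<^sub>M M)" and t: "0 \<le> t" and k: "0 \<le> k"
    and bound: "\<And>u. 0 < u \<Longrightarrow> u \<le> t \<Longrightarrow> (\<integral>\<^sup>+\<omega>. f u \<omega> \<partial>M) \<le> ennreal k"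
  shows "(\<integral>\<^sup>+\<omega>. (\<integral>\<^sup>+u\<in>{0..t}. f u \<omega> \<partial>lborel) \<partial>M) \<le> ennreal (k * t)"
proof -
  have "(\<lambda>(u, \<omega>). f u \<omega> * indicator {0..t} u) \<in> borel_measurable (borel \<Otimes>\<^sub>M M)"
    using f by measurable
  also have "borel_measurable (borel \<Otimes>\<^sub>M M) = borel_measurable (lborel \<Otimes>\<^sub>M M)"
    by (intro measurable_cong_sets sets_pair_measure_cong) auto
  finally have "(\<integral>\<^sup>+\<omega>. (\<integral>\<^sup>+u\<in>{0..t}. f u \<omega> \<partial>lborel) \<partial>M) =
      (\<integral>\<^sup>+u. (\<integral>\<^sup>+\<omega>. f u \<omega> * indicator {0..t} u \<partial>M) \<partial>lborel)"
    using Fubini[of "\<lambda>(u, \<omega>). f u \<omega> * indicator {0..t} u"] by simp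
  also have "\<dots> \<le> (\<integral>\<^sup>+u. ennreal k * indicator {0..t} u \<partial>lborel)"
  proof (rule nn_integral_mono_AE)
    show "AE u in lborel. (\<integral>\<^sup>+\<omega>. f u \<omega> * indicator {0..t} u \<partial>M) \<le> ennreal k * indicator {0..t} u"
      using AE_lborel_singleton[of 0]
      by eventually_elim (use bound in \<open>auto simp: indicator_def\<close>)
  qed
  also have "\<dots> = ennreal (k * t)"
    using t k by (simp add: nn_integral_cmult ennreal_mult)
  finally show ?thesis .
qed

lemma abs_integral_P_le:
  "ennreal \<bar>LINT u:{0..t}|lborel. P u \<omega>\<bar> \<le> (\<integral>\<^sup>+u\<in>{0..t}. ennreal (P u \<omega>) \<partial>lborel)"
proof -
  have "0 \<le> (LINT u:{0..t}|lborel. P u \<omega>)"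
    unfolding set_lebesgue_integral_def by (intro integral_nonneg_AE) auto
  then have "ennreal \<bar>LINT u:{0..t}|lborel. P u \<omega>\<bar> \<le> (\<integral>\<^sup>+u. ennreal (indicator {0..t} u * P u \<omega>) \<partial>lborel)"
    unfolding set_lebesgue_integral_def real_scaleR_def
    by (simp add: ennreal_integral_le_nn_integral)
  also have "\<dots> = (\<integral>\<^sup>+u\<in>{0..t}. ennreal (P u \<omega>) \<partial>lborel)"
    by (intro nn_integral_cong) (auto simp: indicator_def)
  finally show ?thesis .
qed

lemma square_integral_P_le:
  "ennreal ((LINT u:{0..t}|lborel. P u \<omega>)\<^sup>2) \<le> (\<integral>\<^sup>+u\<in>{0..t}. ennreal (P u \<omega>) \<partial>lborel)\<^sup>2"
proof -
  have "ennreal ((LINT u:{0..t}|lborel. P u \<omega>)\<^sup>2) = (ennreal \<bar>LINT u:{0..t}|lborel. P u \<omega>\<bar>)\<^sup>2"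
    by (simp add: ennreal_power)
  also have "\<dots> \<le> (\<integral>\<^sup>+u\<in>{0..t}. ennreal (P u \<omega>) \<partial>lborel)\<^sup>2"
    by (intro power_mono abs_integral_P_le) auto
  finally show ?thesis .
qed

lemma diffusion_square_le:
  "ennreal ((\<sigma> * P u \<omega> powr \<beta>)\<^sup>2) \<le> ennreal (\<sigma>\<^sup>2) * (1 + ennreal ((P u \<omega>)\<^sup>2))"
proof -
  have "(\<sigma> * P u \<omega> powr \<beta>)\<^sup>2 \<le> \<sigma>\<^sup>2 * (1 + (P u \<omega>)\<^sup>2)"
    using mult_left_mono[OF powr_square_le_one_plus[of "P u \<omega>" \<beta>], of "\<sigma>\<^sup>2"] \<beta>
    by (simp add: power_mult_distrib)
  then show ?thesis
    by (simp add: ennreal_mult'[symmetric] ennreal_1[symmetric] ennreal_plus[symmetric] ennreal_leI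
        del: ennreal_plus ennreal_1)
qed

text \<open>\<open>P t\<close> splits into \<open>S0\<close>, drift and \<open>J t\<close>. The
  bound \<open>X\<close> on the squared drift integral is left open: a constant serves for mere
  finiteness, a Cauchy-Schwarz bound for the Gronwall step.\<close>

lemma P_square_le:
  assumes "(\<integral>\<^sup>+u\<in>{0..t}. ennreal (P u \<omega>) \<partial>lborel)\<^sup>2 \<le> X"
  shows "ennreal ((P t \<omega>)\<^sup>2) \<le> ennreal (3 * S0\<^sup>2) +
      ennreal (3 * (r - q)\<^sup>2) * X + ennreal 3 * ennreal ((J t \<omega>)\<^sup>2)"
proof -
  define L where "L = (LINT u:{0..t}|lborel. P u \<omega>)"
  have "(P t \<omega>)\<^sup>2 \<le> 3 * S0\<^sup>2 + 3 * (r - q)\<^sup>2 * L\<^sup>2 + 3 * (J t \<omega>)\<^sup>2"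
    using square_add3_le[of S0 "(r - q) * L" "J t \<omega>"] by (simp add: J_def L_def power_mult_distrib)
  then have "ennreal ((P t \<omega>)\<^sup>2) \<le> ennreal (3 * S0\<^sup>2 + 3 * (r - q)\<^sup>2 * L\<^sup>2 + 3 * (J t \<omega>)\<^sup>2)"
    by (rule ennreal_leI)
  also have "\<dots> = ennreal (3 * S0\<^sup>2) + ennreal (3 * (r - q)\<^sup>2) * ennreal (L\<^sup>2) + ennreal 3 * ennreal ((J t \<omega>)\<^sup>2)"
    by (simp add: ennreal_mult)
  also have "\<dots> \<le> ennreal (3 * S0\<^sup>2) + ennreal (3 * (r - q)\<^sup>2) * X + ennreal 3 * ennreal ((J t \<omega>)\<^sup>2)"
    unfolding L_def using order_trans[OF square_integral_P_le[of t \<omega>] assms] by (intro add_mono mult_left_mono order_refl) auto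
  finally show ?thesis .
qed

text \<open>
  Truncating on the size of the clock \<open>D 0 t\<close> makes the second moment finite without stopping
  times; it does so because \<open>2 * \<beta> \<ge> 1\<close>.
\<close>

definition truncated_moment :: "real \<Rightarrow> real \<Rightarrow> ennreal" where
  "truncated_moment N t =
    (\<integral>\<^sup>+\<omega>. ennreal ((P t \<omega>)\<^sup>2) * indicator {\<omega>. D 0 t \<omega> \<le> ennreal N} \<omega> \<partial>M)"

lemma J_truncated_moment_le:
  assumes t: "0 < t" "t \<le> 1" and N: "0 < N"
  shows "(\<integral>\<^sup>+\<omega>. ennreal ((J t \<omega>)\<^sup>2) * indicator {\<omega>. D 0 t \<omega> \<le> ennreal N} \<omega> \<partial>M)
    \<le> (\<integral>\<^sup>+\<omega>. min (ennreal N) (D 0 t \<omega>) \<partial>M)"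
  using J_minus_const_bound[OF assms, of 0] by simp

text \<open>A priori finiteness, with a bound that may grow with \<open>N\<close>. On the truncation
  event the clock bounds the drift integral, and the truncated second moment of \<open>J t\<close>
  is at most \<open>N\<close>.\<close>

lemma truncated_moment_finite:
  assumes N: "0 < N"
  shows "\<exists>K. \<forall>t\<in>{0<..1}. truncated_moment N t \<le> ennreal K"
proof (intro exI ballI)
  fix t :: real assume "t \<in> {0<..1}"
  then have t: "0 < t" "t \<le> 1" by auto
  \<comment> \<open>Integrating \<open>p \<le> 1 + (p powr \<beta>)\<^sup>2\<close> over
    \<open>[0, t]\<close> bounds the integral of \<open>P\<close> by
    \<open>t + D 0 t / \<sigma>\<^sup>2\<close>, hence by \<open>B\<close>.\<close>
  define B where "B = 1 + N / \<sigma>\<^sup>2"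
  have B: "0 \<le> B" using N by (simp add: B_def)
  have pt: "ennreal ((P t \<omega>)\<^sup>2) * indicator {\<omega>. D 0 t \<omega> \<le> ennreal N} \<omega> \<le>
      ennreal (3 * S0\<^sup>2 + 3 * (r - q)\<^sup>2 * B\<^sup>2) +
      ennreal 3 * (ennreal ((J t \<omega>)\<^sup>2) * indicator {\<omega>. D 0 t \<omega> \<le> ennreal N} \<omega>)"
    if \<omega>: "\<omega> \<in> space M" for \<omega>
  proof (cases "D 0 t \<omega> \<le> ennreal N")
    case True
    note [measurable] = P_measurable2[OF \<omega>]
    have "(\<integral>\<^sup>+u\<in>{0..t}. ennreal (P u \<omega>) \<partial>lborel) \<le>
        (\<integral>\<^sup>+u. indicator {0..t} u + ennreal (1 / \<sigma>\<^sup>2) * (ennreal ((\<sigma> * P u \<omega> powr \<beta> - 0)\<^sup>2) * indicator {0..t} u) \<partial>lborel)"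
    proof (rule nn_integral_mono)
      fix u :: real
      have "P u \<omega> \<le> 1 + 1 / \<sigma>\<^sup>2 * (\<sigma> * P u \<omega> powr \<beta>)\<^sup>2"
        using le_one_plus_powr_square[of "P u \<omega>" \<beta>] \<beta> \<sigma> by (simp add: power_mult_distrib)
      then have "ennreal (P u \<omega>) \<le> 1 + ennreal (1 / \<sigma>\<^sup>2) * ennreal ((\<sigma> * P u \<omega> powr \<beta>)\<^sup>2)"
        by (simp add: ennreal_mult'[symmetric] ennreal_1[symmetric] ennreal_plus[symmetric] ennreal_leI
            del: ennreal_plus ennreal_1)
      then show "ennreal (P u \<omega>) * indicator {0..t} u \<le>
          indicator {0..t} u + ennreal (1 / \<sigma>\<^sup>2) * (ennreal ((\<sigma> * P u \<omega> powr \<beta> - 0)\<^sup>2) * indicator {0..t} u)"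
        by (auto simp: indicator_def)
    qed
    also have "\<dots> = ennreal t + ennreal (1 / \<sigma>\<^sup>2) * D 0 t \<omega>"
      unfolding D_def using t by (simp add: nn_integral_add nn_integral_cmult)
    also have "\<dots> \<le> ennreal 1 + ennreal (1 / \<sigma>\<^sup>2) * ennreal N"
      using True t by (intro add_mono mult_left_mono ennreal_leI) auto
    also have "\<dots> = ennreal B"
      using N by (simp add: B_def ennreal_mult'[symmetric] ennreal_plus[symmetric] ennreal_1[symmetric]
            del: ennreal_plus ennreal_1)
    finally have "(\<integral>\<^sup>+u\<in>{0..t}. ennreal (P u \<omega>) \<partial>lborel)\<^sup>2 \<le> ennreal (B\<^sup>2)"
      using B by (simp add: ennreal_power[symmetric] power_mono)
    then have "ennreal ((P t \<omega>)\<^sup>2) \<le> ennreal (3 * S0\<^sup>2) + ennreal (3 * (r - q)\<^sup>2) * ennreal (B\<^sup>2) + ennreal 3 * ennreal ((J t \<omega>)\<^sup>2)"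
      by (rule P_square_le)
    then show ?thesis
      using True by (simp add: ennreal_mult'[symmetric] ennreal_plus[symmetric] del: ennreal_plus)
  qed simp
  have "truncated_moment N t \<le> (\<integral>\<^sup>+\<omega>. ennreal (3 * S0\<^sup>2 + 3 * (r - q)\<^sup>2 * B\<^sup>2) +
      ennreal 3 * (ennreal ((J t \<omega>)\<^sup>2) * indicator {\<omega>. D 0 t \<omega> \<le> ennreal N} \<omega>) \<partial>M)"
    unfolding truncated_moment_def by (intro nn_integral_mono pt)
  also have "\<dots> = ennreal (3 * S0\<^sup>2 + 3 * (r - q)\<^sup>2 * B\<^sup>2) +
      ennreal 3 * (\<integral>\<^sup>+\<omega>. ennreal ((J t \<omega>)\<^sup>2) * indicator {\<omega>. D 0 t \<omega> \<le> ennreal N} \<omega> \<partial>M)"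
    by (subst nn_integral_add, measurable, subst nn_integral_cmult, measurable) (simp add: emeasure_space_1)
  also have "\<dots> \<le> ennreal (3 * S0\<^sup>2 + 3 * (r - q)\<^sup>2 * B\<^sup>2) + ennreal 3 * ennreal N"
  proof (intro add_mono mult_left_mono order_refl)
    have "(\<integral>\<^sup>+\<omega>. min (ennreal N) (D 0 t \<omega>) \<partial>M) \<le> (\<integral>\<^sup>+\<omega>. ennreal N \<partial>M)"
      by (intro nn_integral_mono) auto
    with J_truncated_moment_le[OF t N]
    show "(\<integral>\<^sup>+\<omega>. ennreal ((J t \<omega>)\<^sup>2) * indicator {\<omega>. D 0 t \<omega> \<le> ennreal N} \<omega> \<partial>M) \<le> ennreal N"
      by (simp add: emeasure_space_1)
  qed auto
  finally show "truncated_moment N t \<le> ennreal (3 * S0\<^sup>2 + 3 * (r - q)\<^sup>2 * B\<^sup>2 + 3 * N)"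
    using N by (simp add: ennreal_mult)
qed

lemma min_D_le: 
  assumes t: "0 < t" "t \<le> 1" and N: "0 < N"
  shows "AE \<omega> in M. min (ennreal N) (D 0 t \<omega>) \<le>
    (\<integral>\<^sup>+u\<in>{0..t}. ennreal ((\<sigma> * P u \<omega> powr \<beta>)\<^sup>2) * indicator {u. D 0 u \<omega> \<le> ennreal N} u \<partial>lborel)"
  using P_continuous
proof eventually_elim
  case (elim \<omega>)
  have "continuous_on {0..t} (\<lambda>u. (\<sigma> * P u \<omega> powr \<beta>)\<^sup>2)"
    using continuous_on_subset[OF diffusion_continuous[OF elim, of 0], of "{0..t}"] t by simp
  from min_clock_le[OF this] show ?case
    using t N by (simp add: D_def)
qed

text \<open>Drift and martingale part are both bounded by time integrals in which the price at time
  \<open>u\<close> carries its own truncation \<open>D 0 u \<le> N\<close>. Hence the bound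
  \<open>k\<close> for earlier truncated moments feeds back with a factor proportional to
  \<open>t\<close>.\<close>

lemma truncated_moment_step:
  assumes t: "0 < t" "t \<le> 1" and N: "0 < N" and k: "0 \<le> k"
    and bound: "\<And>u. 0 < u \<Longrightarrow> u \<le> t \<Longrightarrow> truncated_moment N u \<le> ennreal k"
  shows "truncated_moment N t \<le> ennreal (3 * S0\<^sup>2 + 3 * \<sigma>\<^sup>2 + (3 * (r - q)\<^sup>2 + 3 * \<sigma>\<^sup>2) * t * k)"
proof -
  let ?I = "\<lambda>u \<omega>. indicator {\<omega>. D 0 u \<omega> \<le> ennreal N} \<omega> :: ennreal"
  let ?A = "\<lambda>\<omega>. \<integral>\<^sup>+u\<in>{0..t}. ennreal ((P u \<omega>)\<^sup>2) * ?I u \<omega> \<partial>lborel"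
  have I_eq: "?I u \<omega> = (if D 0 u \<omega> \<le> ennreal N then 1 else 0)" for u \<omega> by simp
  have meas2: "(\<lambda>(u, \<omega>). ennreal ((P u \<omega>)\<^sup>2) * ?I u \<omega>) \<in> borel_measurable (borel \<Otimes>\<^sub>M M)"
    unfolding I_eq by measurable
  have meas2': "(\<lambda>(u, \<omega>). ennreal ((\<sigma> * P u \<omega> powr \<beta>)\<^sup>2) * ?I u \<omega>) \<in> borel_measurable (borel \<Otimes>\<^sub>M M)"
    unfolding I_eq by measurable
  have [measurable]: "?A \<in> borel_measurable M"
    using meas2 by measurable
  have pt: "ennreal ((P t \<omega>)\<^sup>2) * ?I t \<omega> \<le> ennreal (3 * S0\<^sup>2) + ennreal (3 * (r - q)\<^sup>2 * t) * ?A \<omega> +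
      ennreal 3 * (ennreal ((J t \<omega>)\<^sup>2) * ?I t \<omega>)" if \<omega>: "\<omega> \<in> space M" for \<omega>
  proof (cases "D 0 t \<omega> \<le> ennreal N")
    case True
    note [measurable] = P_measurable2[OF \<omega>]
    \<comment> \<open>The clock increases, so the truncation at time \<open>t\<close> implies the
      one at each earlier time and may be written inside the time integral.\<close>
    have D_le: "D 0 u \<omega> \<le> ennreal N" if "u \<le> t" for u
    proof -
      have "D 0 u \<omega> \<le> D 0 t \<omega>"
        unfolding D_def using that by (intro nn_integral_mono) (auto simp: indicator_def)
      with True show ?thesis by simp
    qed
    have "(\<integral>\<^sup>+u\<in>{0..t}. ennreal (P u \<omega>) \<partial>lborel)\<^sup>2 \<le> ennreal t * (\<integral>\<^sup>+u\<in>{0..t}. (ennreal (P u \<omega>))\<^sup>2 \<partial>lborel)"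
      using t by (intro nn_integral_interval_square_le) auto
    also have "(\<integral>\<^sup>+u\<in>{0..t}. (ennreal (P u \<omega>))\<^sup>2 \<partial>lborel) = ?A \<omega>"
      using D_le by (intro nn_integral_cong) (auto simp: indicator_def ennreal_power)
    finally have "ennreal ((P t \<omega>)\<^sup>2) \<le> ennreal (3 * S0\<^sup>2) + ennreal (3 * (r - q)\<^sup>2) * (ennreal t * ?A \<omega>) +
        ennreal 3 * ennreal ((J t \<omega>)\<^sup>2)"
      by (rule P_square_le)
    then show ?thesis using True t by (simp add: ennreal_mult mult.assoc)
  qed simp
  have A: "(\<integral>\<^sup>+\<omega>. ?A \<omega> \<partial>M) \<le> ennreal (k * t)"
    using t k bound meas2 by (intro nn_integral_time_le) (auto simp: truncated_moment_def)
  have "(\<integral>\<^sup>+\<omega>. ennreal ((J t \<omega>)\<^sup>2) * ?I t \<omega> \<partial>M) \<le> (\<integral>\<^sup>+\<omega>. min (ennreal N) (D 0 t \<omega>) \<partial>M)"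
    by (rule J_truncated_moment_le[OF t N])
  \<comment> \<open>The capped clock is traded for the squared coefficient at those times at which
    the truncation is still in force.\<close>
  also have "\<dots> \<le> (\<integral>\<^sup>+\<omega>. (\<integral>\<^sup>+u\<in>{0..t}. ennreal ((\<sigma> * P u \<omega> powr \<beta>)\<^sup>2) * ?I u \<omega> \<partial>lborel) \<partial>M)"
    by (rule nn_integral_mono_AE, rule AE_mp[OF min_D_le[OF t N]]) (auto simp: indicator_def)
  also have "\<dots> \<le> ennreal (\<sigma>\<^sup>2 * (1 + k) * t)"
  proof (rule nn_integral_time_le[OF meas2'])
    fix u :: real assume u: "0 < u" "u \<le> t"
    have "(\<integral>\<^sup>+\<omega>. ennreal ((\<sigma> * P u \<omega> powr \<beta>)\<^sup>2) * ?I u \<omega> \<partial>M) \<le>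
        (\<integral>\<^sup>+\<omega>. ennreal (\<sigma>\<^sup>2) * (1 + ennreal ((P u \<omega>)\<^sup>2) * ?I u \<omega>) \<partial>M)"
    proof (rule nn_integral_mono)
      fix \<omega>
      show "ennreal ((\<sigma> * P u \<omega> powr \<beta>)\<^sup>2) * ?I u \<omega> \<le> ennreal (\<sigma>\<^sup>2) * (1 + ennreal ((P u \<omega>)\<^sup>2) * ?I u \<omega>)"
        using diffusion_square_le by (auto simp: indicator_def)
    qed
    also have "\<dots> = ennreal (\<sigma>\<^sup>2) * (1 + truncated_moment N u)"
      unfolding truncated_moment_def
      by (subst nn_integral_cmult, measurable, subst nn_integral_add, measurable) (simp add: emeasure_space_1)
    also have "\<dots> \<le> ennreal (\<sigma>\<^sup>2) * (1 + ennreal k)"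
      by (intro mult_left_mono add_mono bound u) auto
    finally show "(\<integral>\<^sup>+\<omega>. ennreal ((\<sigma> * P u \<omega> powr \<beta>)\<^sup>2) * ?I u \<omega> \<partial>M) \<le> ennreal (\<sigma>\<^sup>2 * (1 + k))"
      using k by (simp add: ennreal_mult)
  qed (use t k in auto)
  finally have J: "(\<integral>\<^sup>+\<omega>. ennreal ((J t \<omega>)\<^sup>2) * ?I t \<omega> \<partial>M) \<le> ennreal (\<sigma>\<^sup>2 * (1 + k) * t)" .
  have "truncated_moment N t \<le> (\<integral>\<^sup>+\<omega>. ennreal (3 * S0\<^sup>2) + ennreal (3 * (r - q)\<^sup>2 * t) * ?A \<omega> +
      ennreal 3 * (ennreal ((J t \<omega>)\<^sup>2) * ?I t \<omega>) \<partial>M)"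
    unfolding truncated_moment_def by (intro nn_integral_mono pt)
  also have "\<dots> = ennreal (3 * S0\<^sup>2) + ennreal (3 * (r - q)\<^sup>2 * t) * (\<integral>\<^sup>+\<omega>. ?A \<omega> \<partial>M) +
      ennreal 3 * (\<integral>\<^sup>+\<omega>. ennreal ((J t \<omega>)\<^sup>2) * ?I t \<omega> \<partial>M)"
    by (subst nn_integral_add, measurable, subst nn_integral_add, measurable,
        subst nn_integral_cmult, measurable, subst nn_integral_cmult, measurable)
      (simp add: emeasure_space_1)
  also have "\<dots> \<le> ennreal (3 * S0\<^sup>2) + ennreal (3 * (r - q)\<^sup>2 * t) * ennreal (k * t) +
      ennreal 3 * ennreal (\<sigma>\<^sup>2 * (1 + k) * t)"
    by (intro add_mono mult_left_mono A J) auto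
  also have "\<dots> = ennreal (3 * S0\<^sup>2 + 3 * (r - q)\<^sup>2 * t * (k * t) + 3 * (\<sigma>\<^sup>2 * (1 + k) * t))"
    using t k by (simp add: ennreal_mult)
  \<comment> \<open>A spare factor \<open>t \<le> 1\<close> is dropped from the drift term and from
    the constant part of the martingale term.\<close>
  also have "\<dots> \<le> ennreal (3 * S0\<^sup>2 + 3 * \<sigma>\<^sup>2 + (3 * (r - q)\<^sup>2 + 3 * \<sigma>\<^sup>2) * t * k)"
  proof (rule ennreal_leI)
    have "3 * (r - q)\<^sup>2 * t * k * t \<le> 3 * (r - q)\<^sup>2 * t * k * 1" "3 * \<sigma>\<^sup>2 * t \<le> 3 * \<sigma>\<^sup>2 * 1"
      using t k by (intro mult_left_mono; simp)+
    then show "3 * S0\<^sup>2 + 3 * (r - q)\<^sup>2 * t * (k * t) + 3 * (\<sigma>\<^sup>2 * (1 + k) * t)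
      \<le> 3 * S0\<^sup>2 + 3 * \<sigma>\<^sup>2 + (3 * (r - q)\<^sup>2 + 3 * \<sigma>\<^sup>2) * t * k"
      by (simp add: algebra_simps)
  qed
  finally show ?thesis .
qed

text \<open>The supremum \<open>K\<close> of the truncated moments over a short interval is finite
  and satisfies \<open>K \<le> A + K / 2\<close>, so \<open>K \<le> 2 * A\<close>. Neither
  \<open>A\<close> nor the interval depends on \<open>N\<close>, and the truncation is then removed
  by Fatou.\<close>

lemma second_moment_bounded:
  obtains C t0 where "0 \<le> C" "0 < t0" "t0 \<le> 1"
    "\<forall>t\<in>{0<..t0}. (\<integral>\<^sup>+\<omega>. ennreal ((P t \<omega>)\<^sup>2) \<partial>M) \<le> ennreal C"
proof -
  define A where "A = 3 * S0\<^sup>2 + 3 * \<sigma>\<^sup>2"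
  define B where "B = 3 * (r - q)\<^sup>2 + 3 * \<sigma>\<^sup>2"
  \<comment> \<open>Makes the feedback factor \<open>B * t0\<close> at most \<open>1 / 2\<close>;
    times stay below 1 because \<open>P\<close> follows the price on \<open>[0, 1]\<close>
    only.\<close>
  define t0 where "t0 = min 1 (1 / (2 * B))"
  have A: "0 \<le> A" and B: "0 < B" using \<sigma> by (auto simp: A_def B_def intro: add_nonneg_pos)
  have t0: "0 < t0" "t0 \<le> 1" "B * t0 \<le> 1 / 2"
    using B by (auto simp: t0_def min_def field_simps)
  have trunc: "truncated_moment N t \<le> ennreal (2 * A)" if N: "0 < N" and t: "0 < t" "t \<le> t0" for N t
  proof -
    define K where "K = (SUP u\<in>{0<..t0}. truncated_moment N u)"
    obtain K0 where "\<And>u. u \<in> {0<..1} \<Longrightarrow> truncated_moment N u \<le> ennreal K0"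
      using truncated_moment_finite[OF N] by blast
    then have "K \<le> ennreal K0" unfolding K_def using t0 by (intro SUP_least) auto
    \<comment> \<open>Finiteness is essential here: it is what later permits subtracting
      \<open>k / 2\<close> on both sides.\<close>
    then obtain k where k: "K = ennreal k" "0 \<le> k" by (cases K) (auto simp: top_unique)
    have le_K: "truncated_moment N u \<le> ennreal k" if "0 < u" "u \<le> t0" for u
      using that unfolding k(1)[symmetric] K_def by (intro SUP_upper) auto
    have "truncated_moment N u \<le> ennreal (A + k / 2)" if u: "0 < u" "u \<le> t0" for u
    proof -
      have "truncated_moment N u \<le> ennreal (A + B * u * k)"
        unfolding A_def B_def
        by (intro truncated_moment_step u N k le_K) (use u t0 in auto)
      also have "\<dots> \<le> ennreal (A + k / 2)"
      proof (intro ennreal_leI add_left_mono)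
        have "B * u \<le> 1 / 2" using mult_left_mono[of u t0 B] u B t0(3) by linarith
        from mult_right_mono[OF this k(2)] show "B * u * k \<le> k / 2" by simp
      qed
      finally show ?thesis .
    qed
    then have "K \<le> ennreal (A + k / 2)" unfolding K_def by (intro SUP_least) auto
    then have "k \<le> 2 * A" using k A by (simp add: ennreal_plus[symmetric] ennreal_le_iff del: ennreal_plus)
    then show ?thesis using le_K[OF t] by (meson ennreal_leI order_trans)
  qed
  show thesis
  proof (rule that[of "2 * A" t0])
    have "(\<integral>\<^sup>+\<omega>. ennreal ((P t \<omega>)\<^sup>2) \<partial>M) \<le> ennreal (2 * A)"
      if t: "0 < t" "t \<le> t0" for t
    proof (rule nn_integral_le_truncated[where g="D 0 t"])
      show "AE \<omega> in M. D 0 t \<omega> < top"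
        using t t0 by (intro D_finite) auto
      show "(\<integral>\<^sup>+\<omega>. ennreal ((P t \<omega>)\<^sup>2) * indicator {\<omega>. D 0 t \<omega> \<le> ennreal N} \<omega> \<partial>M)
        \<le> ennreal (2 * A)" if "0 < N" for N
        using trunc[OF that t] by (simp add: truncated_moment_def)
    qed measurable
    then show "\<forall>t\<in>{0<..t0}. (\<integral>\<^sup>+\<omega>. ennreal ((P t \<omega>)\<^sup>2) \<partial>M) \<le> ennreal (2 * A)"
      by simp
  qed (use A t0 in auto)
qed

end

section \<open>First-order expansion of the price in L1\<close>

lemma nn_integral_lincomb:
  assumes [measurable]: "f \<in> borel_measurable M" "g \<in> borel_measurable M"
  shows "(\<integral>\<^sup>+x. a * f x + b * g x \<partial>M) = a * (\<integral>\<^sup>+x. f x \<partial>M) + b * (\<integral>\<^sup>+x. g x \<partial>M)"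
  by (simp add: nn_integral_add nn_integral_cmult)

lemma (in prob_space) nn_integral_lincomb_const:
  assumes [measurable]: "f \<in> borel_measurable M" "g \<in> borel_measurable M"
  shows "(\<integral>\<^sup>+x. a * f x + (b * g x + k) \<partial>M) = a * (\<integral>\<^sup>+x. f x \<partial>M) + (b * (\<integral>\<^sup>+x. g x \<partial>M) + k)"
  by (simp add: nn_integral_add nn_integral_cmult emeasure_space_1)

lemma ennreal_lincomb_const:
  "\<lbrakk>0 \<le> a; 0 \<le> x; 0 \<le> b; 0 \<le> y; 0 \<le> k\<rbrakk> \<Longrightarrow>
    ennreal (a * x + (b * y + k)) = ennreal a * ennreal x + (ennreal b * ennreal y + ennreal k)"
  by (simp add: ennreal_mult)

context cev_setting
begin

text \<open>Second moments are improved in stages: order \<open>t\<close> for \<open>J t\<close>,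
  then order \<open>t\<close> for \<open>P t - S0\<close>, and, by the Lipschitz bound for the
  coefficient, order \<open>t * t\<close> for \<open>J t - a * W t\<close>. The last remainder is
  thus of order \<open>t\<close> in L1, like the drift.\<close>

lemma first_order_expansion:
  obtains C t0 where "0 \<le> C" "0 < t0" "t0 \<le> 1"
    "\<forall>t\<in>{0<..t0}. (\<integral>\<^sup>+\<omega>. ennreal \<bar>P t \<omega> - S0 - \<sigma> * S0 powr \<beta> * W t \<omega>\<bar> \<partial>M) \<le> ennreal (C * t)"
proof -
  define a where "a = \<sigma> * S0 powr \<beta>"
  define c where "c = r - q"
  obtain C0 t0 where C0: "0 \<le> C0" and t0: "0 < t0" "t0 \<le> 1"
    and bound: "\<forall>t\<in>{0<..t0}. (\<integral>\<^sup>+\<omega>. ennreal ((P t \<omega>)\<^sup>2) \<partial>M) \<le> ennreal C0"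
    by (rule second_moment_bounded)
  have P2: "(\<integral>\<^sup>+\<omega>. ennreal ((P t \<omega>)\<^sup>2) \<partial>M) \<le> ennreal C0" if "0 < t" "t \<le> t0" for t
    using bound that by simp
  \<comment> \<open>\<open>C1 * t\<close> will bound the second moment of \<open>P t - S0\<close>;
    \<open>l\<close> is the squared Lipschitz constant of the diffusion coefficient about
    \<open>S0\<close>; \<open>C\<close> adds the drift contribution and the martingale
    remainder.\<close>
  define C1 where "C1 = 2 * c\<^sup>2 * C0 + 2 * \<sigma>\<^sup>2 * (1 + C0)"
  define l where "l = \<sigma>\<^sup>2 * (S0 powr (\<beta> - 1))\<^sup>2"
  define C where "C = \<bar>c\<bar> * (1 + C0) + (l * C1 + 1) / 2"
  have C1: "0 \<le> C1" and l: "0 \<le> l" using C0 by (auto simp: C1_def l_def)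
  have C: "0 \<le> C" using C0 C1 l by (auto simp: C_def)
  have [measurable]: "W t \<in> borel_measurable M" if "0 < t" for t
    using W_measurable[of t] that by simp
  have J2: "(\<integral>\<^sup>+\<omega>. ennreal ((J t \<omega>)\<^sup>2) \<partial>M) \<le> ennreal (\<sigma>\<^sup>2 * (1 + C0) * t)" if t: "0 < t" "t \<le> t0" for t
  proof -
    have "(\<integral>\<^sup>+\<omega>. ennreal ((J t \<omega>)\<^sup>2) \<partial>M) \<le> (\<integral>\<^sup>+\<omega>. D 0 t \<omega> \<partial>M)"
      using J_minus_const_square_le[of t 0] t t0 by simp
    also have "\<dots> \<le> ennreal (\<sigma>\<^sup>2 * (1 + C0) * t)"
      unfolding D_def
    proof (rule nn_integral_time_le)
      fix u assume u: "0 < u" "u \<le> t"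
      have "(\<integral>\<^sup>+\<omega>. ennreal ((\<sigma> * P u \<omega> powr \<beta> - 0)\<^sup>2) \<partial>M) \<le> (\<integral>\<^sup>+\<omega>. ennreal (\<sigma>\<^sup>2) * (1 + ennreal ((P u \<omega>)\<^sup>2)) \<partial>M)"
        using diffusion_square_le by (intro nn_integral_mono) simp
      also have "\<dots> = ennreal (\<sigma>\<^sup>2) * (1 + (\<integral>\<^sup>+\<omega>. ennreal ((P u \<omega>)\<^sup>2) \<partial>M))"
        by (subst nn_integral_cmult, measurable, subst nn_integral_add, measurable) (simp add: emeasure_space_1)
      also have "\<dots> \<le> ennreal (\<sigma>\<^sup>2) * (1 + ennreal C0)"
        using P2[of u] u t by (intro mult_left_mono add_mono) auto
      finally show "(\<integral>\<^sup>+\<omega>. ennreal ((\<sigma> * P u \<omega> powr \<beta> - 0)\<^sup>2) \<partial>M) \<le> ennreal (\<sigma>\<^sup>2 * (1 + C0))"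
        using C0 by (simp add: ennreal_mult)
    qed (use t C0 in auto)
    finally show ?thesis .
  qed
  have dist2: "(\<integral>\<^sup>+\<omega>. ennreal ((P t \<omega> - S0)\<^sup>2) \<partial>M) \<le> ennreal (C1 * t)" if t: "0 < t" "t \<le> t0" for t
  proof -
    let ?A = "\<lambda>\<omega>. \<integral>\<^sup>+u\<in>{0..t}. ennreal ((P u \<omega>)\<^sup>2) \<partial>lborel"
    have [measurable]: "?A \<in> borel_measurable M" by measurable
    have "(\<integral>\<^sup>+\<omega>. ennreal ((P t \<omega> - S0)\<^sup>2) \<partial>M) \<le>
        (\<integral>\<^sup>+\<omega>. ennreal (2 * c\<^sup>2 * t) * ?A \<omega> + ennreal 2 * ennreal ((J t \<omega>)\<^sup>2) \<partial>M)"
    proof (rule nn_integral_mono)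
      fix \<omega> assume \<omega>: "\<omega> \<in> space M"
      note [measurable] = P_measurable2[OF \<omega>]
      define L where "L = (LINT u:{0..t}|lborel. P u \<omega>)"
      have "ennreal (L\<^sup>2) \<le> (\<integral>\<^sup>+u\<in>{0..t}. ennreal (P u \<omega>) \<partial>lborel)\<^sup>2"
        unfolding L_def by (rule square_integral_P_le)
      also have "\<dots> \<le> ennreal t * (\<integral>\<^sup>+u\<in>{0..t}. (ennreal (P u \<omega>))\<^sup>2 \<partial>lborel)"
        using t by (intro nn_integral_interval_square_le) auto
      finally have L2: "ennreal (L\<^sup>2) \<le> ennreal t * ?A \<omega>" by (simp add: ennreal_power)
      have "(P t \<omega> - S0)\<^sup>2 \<le> 2 * c\<^sup>2 * L\<^sup>2 + 2 * (J t \<omega>)\<^sup>2"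
        using square_add_le[of 1 "c * L" "J t \<omega>"] by (simp add: J_def L_def c_def power_mult_distrib)
      then have "ennreal ((P t \<omega> - S0)\<^sup>2) \<le> ennreal (2 * c\<^sup>2) * ennreal (L\<^sup>2) + ennreal 2 * ennreal ((J t \<omega>)\<^sup>2)"
        by (metis ennreal_leI ennreal_mult ennreal_plus mult_nonneg_nonneg zero_le_numeral zero_le_power2)
      also have "\<dots> \<le> ennreal (2 * c\<^sup>2) * (ennreal t * ?A \<omega>) + ennreal 2 * ennreal ((J t \<omega>)\<^sup>2)"
        by (intro add_mono mult_left_mono L2 order_refl) auto
      finally show "ennreal ((P t \<omega> - S0)\<^sup>2) \<le> ennreal (2 * c\<^sup>2 * t) * ?A \<omega> + ennreal 2 * ennreal ((J t \<omega>)\<^sup>2)"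
        using t by (simp add: ennreal_mult mult.assoc)
    qed
    also have "\<dots> = ennreal (2 * c\<^sup>2 * t) * (\<integral>\<^sup>+\<omega>. ?A \<omega> \<partial>M) + ennreal 2 * (\<integral>\<^sup>+\<omega>. ennreal ((J t \<omega>)\<^sup>2) \<partial>M)"
      by (rule nn_integral_lincomb) measurable
    also have "\<dots> \<le> ennreal (2 * c\<^sup>2 * t) * ennreal (C0 * t) + ennreal 2 * ennreal (\<sigma>\<^sup>2 * (1 + C0) * t)"
      using t t0 C0 P2 by (intro add_mono mult_left_mono J2 nn_integral_time_le) auto
    also have "\<dots> = ennreal (2 * c\<^sup>2 * t * (C0 * t) + 2 * (\<sigma>\<^sup>2 * (1 + C0) * t))"
      using t C0 by (simp add: ennreal_mult)
    also have "\<dots> \<le> ennreal (C1 * t)"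
    proof (rule ennreal_leI)
      have "2 * c\<^sup>2 * C0 * t * t \<le> 2 * c\<^sup>2 * C0 * t * 1"
        using t t0 C0 by (intro mult_left_mono) auto
      then show "2 * c\<^sup>2 * t * (C0 * t) + 2 * (\<sigma>\<^sup>2 * (1 + C0) * t) \<le> C1 * t"
        by (simp add: C1_def algebra_simps)
    qed
    finally show ?thesis .
  qed
  have Z2: "(\<integral>\<^sup>+\<omega>. ennreal ((J t \<omega> - a * W t \<omega>)\<^sup>2) \<partial>M) \<le> ennreal (l * C1 * t * t)" if t: "0 < t" "t \<le> t0" for t
  proof -
    have "(\<integral>\<^sup>+\<omega>. ennreal ((J t \<omega> - a * W t \<omega>)\<^sup>2) \<partial>M) \<le> (\<integral>\<^sup>+\<omega>. D a t \<omega> \<partial>M)"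
      using J_minus_const_square_le[of t a] t t0 by simp
    also have "\<dots> \<le> ennreal (l * C1 * t * t)"
      unfolding D_def
    proof (rule nn_integral_time_le)
      fix u assume u: "0 < u" "u \<le> t"
      have "(\<integral>\<^sup>+\<omega>. ennreal ((\<sigma> * P u \<omega> powr \<beta> - a)\<^sup>2) \<partial>M) \<le> (\<integral>\<^sup>+\<omega>. ennreal l * ennreal ((P u \<omega> - S0)\<^sup>2) \<partial>M)"
      proof (rule nn_integral_mono)
        fix \<omega>
        have "\<bar>P u \<omega> powr \<beta> - S0 powr \<beta>\<bar> \<le> S0 powr (\<beta> - 1) * \<bar>P u \<omega> - S0\<bar>"
          using S0 \<beta> by (intro powr_diff_le) auto
        from power_mono[OF this, of 2]
        have "(P u \<omega> powr \<beta> - S0 powr \<beta>)\<^sup>2 \<le> (S0 powr (\<beta> - 1))\<^sup>2 * (P u \<omega> - S0)\<^sup>2"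
          by (simp add: power_mult_distrib)
        from mult_left_mono[OF this, of "\<sigma>\<^sup>2"]
        have "(\<sigma> * P u \<omega> powr \<beta> - a)\<^sup>2 \<le> l * (P u \<omega> - S0)\<^sup>2"
          by (simp add: a_def l_def power_mult_distrib[symmetric] right_diff_distrib mult.assoc)
        then show "ennreal ((\<sigma> * P u \<omega> powr \<beta> - a)\<^sup>2) \<le> ennreal l * ennreal ((P u \<omega> - S0)\<^sup>2)"
          using l by (simp add: ennreal_mult[symmetric] ennreal_leI)
      qed
      also have "\<dots> = ennreal l * (\<integral>\<^sup>+\<omega>. ennreal ((P u \<omega> - S0)\<^sup>2) \<partial>M)"
        by (rule nn_integral_cmult) measurable
      also have "\<dots> \<le> ennreal l * ennreal (C1 * t)"
      proof (rule mult_left_mono)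
        have "ennreal (C1 * u) \<le> ennreal (C1 * t)"
          using u C1 by (intro ennreal_leI mult_left_mono) auto
        then show "(\<integral>\<^sup>+\<omega>. ennreal ((P u \<omega> - S0)\<^sup>2) \<partial>M) \<le> ennreal (C1 * t)"
          using dist2[of u] u t by (auto intro: order_trans)
      qed simp
      finally show "(\<integral>\<^sup>+\<omega>. ennreal ((\<sigma> * P u \<omega> powr \<beta> - a)\<^sup>2) \<partial>M) \<le> ennreal (l * C1 * t)"
        using l C1 t by (simp add: ennreal_mult[symmetric] mult.assoc)
    qed (use t C1 l in auto)
    finally show ?thesis .
  qed
  show thesis
  proof (rule that[OF C t0], rule ballI)
    fix t assume "t \<in> {0<..t0}"
    then have t: "0 < t" "t \<le> t0" by auto
    let ?A = "\<lambda>\<omega>. \<integral>\<^sup>+u\<in>{0..t}. ennreal (P u \<omega>) \<partial>lborel"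
    let ?Z = "\<lambda>\<omega>. J t \<omega> - a * W t \<omega>"
    have [measurable]: "?A \<in> borel_measurable M" by measurable
    have [measurable]: "W t \<in> borel_measurable M" using t by simp
    have EP: "(\<integral>\<^sup>+\<omega>. ennreal (P u \<omega>) \<partial>M) \<le> ennreal (1 + C0)" if u: "0 < u" "u \<le> t" for u
    proof -
      have "(\<integral>\<^sup>+\<omega>. ennreal (P u \<omega>) \<partial>M) \<le> (\<integral>\<^sup>+\<omega>. 1 + ennreal ((P u \<omega>)\<^sup>2) \<partial>M)"
      proof (rule nn_integral_mono)
        fix \<omega>
        have "2 * P u \<omega> \<le> 1 + (P u \<omega>)\<^sup>2"
          using zero_le_power2[of "P u \<omega> - 1"] by (simp add: power2_diff)
        with P_nonneg[of u \<omega>] have "P u \<omega> \<le> 1 + (P u \<omega>)\<^sup>2" by linarith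
        then show "ennreal (P u \<omega>) \<le> 1 + ennreal ((P u \<omega>)\<^sup>2)"
          by (simp add: ennreal_1[symmetric] ennreal_plus[symmetric] ennreal_leI del: ennreal_plus ennreal_1)
      qed
      also have "\<dots> = 1 + (\<integral>\<^sup>+\<omega>. ennreal ((P u \<omega>)\<^sup>2) \<partial>M)"
        by (subst nn_integral_add) (auto simp: emeasure_space_1)
      also have "\<dots> \<le> 1 + ennreal C0" using P2[of u] u t by (intro add_mono) auto
      finally show ?thesis using C0 by simp
    qed
    have "(\<integral>\<^sup>+\<omega>. ennreal \<bar>P t \<omega> - S0 - a * W t \<omega>\<bar> \<partial>M) \<le>
        (\<integral>\<^sup>+\<omega>. ennreal \<bar>c\<bar> * ?A \<omega> + (ennreal (1 / (2 * t)) * ennreal ((?Z \<omega>)\<^sup>2) + ennreal (t / 2)) \<partial>M)"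
    proof (rule nn_integral_mono)
      fix \<omega>
      define L where "L = (LINT u:{0..t}|lborel. P u \<omega>)"
      \<comment> \<open>The weight \<open>t\<close> matches the L2 size of \<open>?Z\<close>, so
        both resulting terms have mean of order \<open>t\<close>.\<close>
      have "0 \<le> (\<bar>?Z \<omega>\<bar> - t)\<^sup>2 / (2 * t)" using t by simp
      also have "\<dots> = 1 / (2 * t) * (?Z \<omega>)\<^sup>2 + t / 2 - \<bar>?Z \<omega>\<bar>"
        using t by (simp add: power2_diff field_simps) (simp add: power2_eq_square)
      finally have "\<bar>?Z \<omega>\<bar> \<le> 1 / (2 * t) * (?Z \<omega>)\<^sup>2 + t / 2" by simp
      moreover have "P t \<omega> - S0 - a * W t \<omega> = c * L + ?Z \<omega>"
        by (simp add: J_def L_def c_def)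
      then have "\<bar>P t \<omega> - S0 - a * W t \<omega>\<bar> \<le> \<bar>c\<bar> * \<bar>L\<bar> + \<bar>?Z \<omega>\<bar>"
        by (metis abs_mult abs_triangle_ineq)
      ultimately have "\<bar>P t \<omega> - S0 - a * W t \<omega>\<bar> \<le> \<bar>c\<bar> * \<bar>L\<bar> + (1 / (2 * t) * (?Z \<omega>)\<^sup>2 + t / 2)"
        by linarith
      then have "ennreal \<bar>P t \<omega> - S0 - a * W t \<omega>\<bar> \<le>
          ennreal (\<bar>c\<bar> * \<bar>L\<bar> + (1 / (2 * t) * (?Z \<omega>)\<^sup>2 + t / 2))"
        by (rule ennreal_leI)
      also have "\<dots> = ennreal \<bar>c\<bar> * ennreal \<bar>L\<bar> +
          (ennreal (1 / (2 * t)) * ennreal ((?Z \<omega>)\<^sup>2) + ennreal (t / 2))"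
        using t by (intro ennreal_lincomb_const) auto
      also have "\<dots> \<le> ennreal \<bar>c\<bar> * ?A \<omega> + (ennreal (1 / (2 * t)) * ennreal ((?Z \<omega>)\<^sup>2) + ennreal (t / 2))"
        unfolding L_def by (intro add_mono mult_left_mono abs_integral_P_le order_refl) auto
      finally show "ennreal \<bar>P t \<omega> - S0 - a * W t \<omega>\<bar> \<le>
          ennreal \<bar>c\<bar> * ?A \<omega> + (ennreal (1 / (2 * t)) * ennreal ((?Z \<omega>)\<^sup>2) + ennreal (t / 2))" .
    qed
    also have "\<dots> = ennreal \<bar>c\<bar> * (\<integral>\<^sup>+\<omega>. ?A \<omega> \<partial>M) +
        (ennreal (1 / (2 * t)) * (\<integral>\<^sup>+\<omega>. ennreal ((?Z \<omega>)\<^sup>2) \<partial>M) + ennreal (t / 2))"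
      by (rule nn_integral_lincomb_const) measurable
    also have "\<dots> \<le> ennreal \<bar>c\<bar> * ennreal ((1 + C0) * t) +
        (ennreal (1 / (2 * t)) * ennreal (l * C1 * t * t) + ennreal (t / 2))"
      using t C0 EP by (intro add_mono mult_left_mono Z2 nn_integral_time_le order_refl) auto
    also have "\<dots> = ennreal (\<bar>c\<bar> * ((1 + C0) * t) + (1 / (2 * t) * (l * C1 * t * t) + t / 2))"
      using t C0 C1 l by (intro ennreal_lincomb_const[symmetric]) auto
    also have "\<bar>c\<bar> * ((1 + C0) * t) + (1 / (2 * t) * (l * C1 * t * t) + t / 2) = C * t"
      using t by (simp add: C_def field_simps)
    finally show "(\<integral>\<^sup>+\<omega>. ennreal \<bar>P t \<omega> - S0 - \<sigma> * S0 powr \<beta> * W t \<omega>\<bar> \<partial>M) \<le> ennreal (C * t)"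
      by (simp add: a_def)
  qed
qed

end

subsection \<open>The Gaussian limit\<close>

text \<open>Each of the two parts is half of the absolute value plus or minus the variable; as the
  mean is zero, both have half the absolute moment as expectation.\<close>

lemma (in prob_space)
  assumes Y: "distributed M lborel Y (normal_density 0 s)" and s: "0 < s"
  shows normal_abs_integrable: "integrable M (\<lambda>\<omega>. \<bar>Y \<omega>\<bar>)"
    and normal_abs_expectation: "expectation (\<lambda>\<omega>. \<bar>Y \<omega>\<bar>) = s * sqrt (2 / pi)"
    and normal_positive_part: "expectation (\<lambda>\<omega>. max 0 (Y \<omega>)) = s / sqrt (2 * pi)"
    and normal_negative_part: "expectation (\<lambda>\<omega>. max 0 (- Y \<omega>)) = s / sqrt (2 * pi)"
proof -
  have abs: "has_bochner_integral lborel (\<lambda>x. normal_density 0 s x * \<bar>x\<bar>) (s * sqrt (2 / pi))"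
    using normal_moment_abs_odd[OF s, of 0 0] by simp
  show i: "integrable M (\<lambda>\<omega>. \<bar>Y \<omega>\<bar>)"
    using abs by (subst distributed_integrable[OF Y, symmetric]) (auto simp: has_bochner_integral_iff)
  show e: "expectation (\<lambda>\<omega>. \<bar>Y \<omega>\<bar>) = s * sqrt (2 / pi)"
    using abs by (subst distributed_integral[OF Y, symmetric]) (auto simp: has_bochner_integral_iff)
  have e0: "expectation Y = 0" by (rule normal_distributed_expectation[OF s Y])
  have iY: "integrable M Y"
    using i Y by (subst integrable_abs_iff[symmetric]) (auto simp: distributed_def)
  have half: "sqrt (2 / pi) / 2 = 1 / sqrt (2 * pi)"
    by (simp add: real_sqrt_divide real_sqrt_mult field_simps)
  have max_eq: "max 0 y = (\<bar>y\<bar> + y) / 2" "max 0 (- y) = (\<bar>y\<bar> - y) / 2" for y :: real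
    by (auto simp: max_def)
  have "expectation (\<lambda>\<omega>. max 0 (Y \<omega>)) = (s * sqrt (2 / pi)) / 2"
      "expectation (\<lambda>\<omega>. max 0 (- Y \<omega>)) = (s * sqrt (2 / pi)) / 2"
    unfolding max_eq using i iY e e0 by simp_all
  then show "expectation (\<lambda>\<omega>. max 0 (Y \<omega>)) = s / sqrt (2 * pi)"
      "expectation (\<lambda>\<omega>. max 0 (- Y \<omega>)) = s / sqrt (2 * pi)"
    using half by (metis times_divide_eq_right mult.right_neutral)+
qed

lemma sum_by_parts:
  fixes w :: "nat \<Rightarrow> real"
  shows "(\<Sum>j<m. real j * (w (Suc j) - w j)) = real m * w m - (\<Sum>j<m. w (Suc j))"
  by (induction m) (auto simp: algebra_simps)

lemma sum_squares_lessThan: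
  "(\<Sum>j<n. (real j)\<^sup>2) = real n * (real n - 1) * (2 * real n - 1) / 6"
  by (induction n) (auto simp: field_simps power2_eq_square)

section \<open>Exact Gaussian law of a discretized deviation from the average\<close>

context brownian_setting
begin

lemma increment_abs_expectation_le:
  assumes "0 \<le> s" "s \<le> t"
  shows "(\<integral>\<^sup>+\<omega>. ennreal \<bar>W t \<omega> - W s \<omega>\<bar> \<partial>M) \<le> ennreal (sqrt (t - s))"
proof (cases "s = t")
  case False
  then have st: "s < t" "0 < sqrt (t - s)" using assms by auto
  note d = increment_distributed[OF assms(1) st(1)]
  have "sqrt (2 / pi) \<le> 1" using pi_gt3 by simp
  then have "sqrt (t - s) * sqrt (2 / pi) \<le> sqrt (t - s)"
    using st by (simp add: mult_left_le)
  with normal_abs_integrable[OF d st(2)] normal_abs_expectation[OF d st(2)] show ?thesis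
    by (simp add: nn_integral_eq_integral ennreal_leI)
qed simp

text \<open>A right-endpoint Riemann average of \<open>W\<close>. Its deviation from
  \<open>W T\<close> is a finite combination of independent increments, so the law is explicit for
  each \<open>n\<close> and the law of the time integral of \<open>W\<close> is never
  computed.\<close>

definition grid_average :: "nat \<Rightarrow> real \<Rightarrow> 'a \<Rightarrow> real" where
  "grid_average n T \<omega> = (\<Sum>j<n. W (real (Suc j) * T / real n) \<omega>) / real n"

text \<open>Summation by parts gives the increment over cell \<open>j\<close> the deterministic
  weight \<open>j / n\<close>. Independent centred normals add, and the sum of squares gives the
  variance.\<close>

lemma grid_distributed:
  assumes n: "2 \<le> n" and T: "0 < T"
  shows "distributed M lborel (\<lambda>\<omega>. W T \<omega> - grid_average n T \<omega>)
    (normal_density 0 (sqrt (T * (real n - 1) * (2 * real n - 1) / (6 * (real n)\<^sup>2))))"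
proof -
  define s where "s i = real i * T / real n" for i
  define \<eta> :: "nat \<Rightarrow> 'a \<Rightarrow> real" where "\<eta> i \<omega> = real i / real n" for i \<omega>
  have s0: "0 \<le> s 0" and s_step: "s i \<le> s (Suc i)" and s_diff: "s (Suc i) - s i = T / real n" for i
    using T n by (auto simp: s_def field_simps)
  have \<eta>: "\<eta> i \<in> borel_measurable (F (s i))" and \<eta>_bound: "i < n \<Longrightarrow> \<bar>\<eta> i \<omega>\<bar> \<le> 1" for i \<omega>
    using n by (auto simp: \<eta>_def[abs_def])
  have adapted: "martingale_transform s \<eta> m \<in> borel_measurable (F (s m))" if "m \<le> n" for m
    using martingale_transform_adapted[of s n \<eta> 1 m] s0 s_step \<eta> \<eta>_bound that by auto
  have s_nonneg: "0 \<le> s i" and s_less: "s i < s (Suc i)" for i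
    using T n by (auto simp: s_def divide_strict_right_mono)
  have scaled: "distributed M lborel (\<lambda>\<omega>. \<eta> m \<omega> * (W (s (Suc m)) \<omega> - W (s m) \<omega>))
      (normal_density 0 (sqrt (T / real n * (real m / real n)\<^sup>2)))" if "0 < m" for m
  proof -
    have "sqrt (T / real n * (real m / real n)\<^sup>2) = \<bar>real m / real n\<bar> * sqrt (s (Suc m) - s m)"
      unfolding s_diff by (simp only: real_sqrt_mult real_sqrt_abs mult.commute)
    moreover have "distributed M lborel (\<lambda>\<omega>. 0 + real m / real n * (W (s (Suc m)) \<omega> - W (s m) \<omega>))
        (normal_density (0 + real m / real n * 0) (\<bar>real m / real n\<bar> * sqrt (s (Suc m) - s m)))"
      using s_less[of m] that n by (intro normal_density_affine increment_distributed s_nonneg) auto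
    ultimately show ?thesis by (simp only: \<eta>_def add_0 mult_zero_right)
  qed
  have var: "(\<Sum>j<m. T / real n * (real j / real n)\<^sup>2) > 0" if "2 \<le> m" for m
  proof (rule sum_pos2[of _ 1])
    show "0 < T / real n * (real 1 / real n)\<^sup>2" using n T by simp
  qed (use that T in auto)
  have dist: "distributed M lborel (martingale_transform s \<eta> m) (normal_density 0 (sqrt (\<Sum>j<m. T / real n * (real j / real n)\<^sup>2)))"
    if "2 \<le> m" "m \<le> n" for m
    using that
  proof (induction m rule: nat_induct_at_least)
    \<comment> \<open>The weight of cell 0 is 0, so its term has a degenerate law without density.
      The induction starts with the two-term sum, which is the single increment over cell 1.\<close>
    case base
    have "martingale_transform s \<eta> 2 = (\<lambda>\<omega>. \<eta> 1 \<omega> * (W (s (Suc 1)) \<omega> - W (s 1) \<omega>))"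
      by (auto simp: martingale_transform_def \<eta>_def numeral_2_eq_2)
    with scaled[of 1] show ?case by (simp add: numeral_2_eq_2)
  next
    case (Suc m)
    have ind: "indep_var borel (martingale_transform s \<eta> m) borel (\<lambda>\<omega>. W (s (Suc m)) \<omega> - W (s m) \<omega>)"
      using Suc.prems by (intro increment_indep s_nonneg s_less adapted) auto
    have "indep_var borel (martingale_transform s \<eta> m) borel (\<lambda>\<omega>. \<eta> m \<omega> * (W (s (Suc m)) \<omega> - W (s m) \<omega>))"
      using indep_var_compose[OF ind, of "\<lambda>x. x" borel "\<lambda>x. real m / real n * x" borel]
      by (simp add: comp_def \<eta>_def)
    from add_indep_normal[OF this _ _ Suc.IH scaled] var[of m] Suc n T
    have "distributed M lborel (\<lambda>\<omega>. martingale_transform s \<eta> m \<omega> + \<eta> m \<omega> * (W (s (Suc m)) \<omega> - W (s m) \<omega>))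
        (normal_density 0 (sqrt ((\<Sum>j<m. T / real n * (real j / real n)\<^sup>2) + T / real n * (real m / real n)\<^sup>2)))"
      by simp
    then show ?case by (simp add: martingale_transform_def[abs_def])
  qed
  have "martingale_transform s \<eta> n = (\<lambda>\<omega>. W T \<omega> - grid_average n T \<omega>)"
  proof
    fix \<omega>
    have "martingale_transform s \<eta> n \<omega> = (\<Sum>j<n. real j * (W (s (Suc j)) \<omega> - W (s j) \<omega>)) / real n"
      by (simp add: martingale_transform_def \<eta>_def sum_divide_distrib)
    also have "\<dots> = W (s n) \<omega> - (\<Sum>j<n. W (s (Suc j)) \<omega>) / real n"
      using n by (subst sum_by_parts) (simp add: field_simps)
    finally show "martingale_transform s \<eta> n \<omega> = W T \<omega> - grid_average n T \<omega>"
      using n by (simp add: grid_average_def s_def)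
  qed
  moreover have "(\<Sum>j<n. T / real n * (real j / real n)\<^sup>2) = T * (real n - 1) * (2 * real n - 1) / (6 * (real n)\<^sup>2)"
  proof -
    have "(\<Sum>j<n. T / real n * (real j / real n)\<^sup>2) = T / (real n)^3 * (\<Sum>j<n. (real j)\<^sup>2)"
      by (simp add: sum_distrib_left power_divide power3_eq_cube power2_eq_square mult.assoc)
    also have "\<dots> = T * (real n - 1) * (2 * real n - 1) / (6 * (real n)\<^sup>2)"
      unfolding sum_squares_lessThan using n by (simp add: field_simps power3_eq_cube power2_eq_square)
    finally show ?thesis .
  qed
  ultimately show ?thesis using dist[of n] n by simp
qed

end

text \<open>Serves twice: applied to a path of \<open>W\<close>, its integral is \<open>T\<close>
  times the grid average; applied to paths of \<open>S\<close>, it gives jointly measurable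
  approximations.\<close>

definition right_grid :: "nat \<Rightarrow> real \<Rightarrow> (real \<Rightarrow> real) \<Rightarrow> real \<Rightarrow> real" where
  "right_grid n T w t = (\<Sum>j<n. w (real (Suc j) * T / real n) *
    indicator {real j * T / real n<..real (Suc j) * T / real n} t)"

lemma step_cover:
  fixes s :: "nat \<Rightarrow> real"
  assumes "s 0 < u" "u \<le> s m"
  shows "\<exists>i<m. s i < u \<and> u \<le> s (Suc i)"
  using assms(2)
proof (induction m)
  case (Suc m)
  then show ?case by (cases "u \<le> s m") (auto simp: less_Suc_eq)
qed (use assms(1) in simp)

text \<open>The sampling time \<open>v\<close> is chosen before \<open>w\<close>, so one
  deterministic time serves all paths.\<close>

lemma right_grid_eq:
  assumes "0 < n" "0 < t" "t \<le> T"
  shows "\<exists>v\<ge>t. v \<le> t + T / real n \<and> (\<forall>w. right_grid n T w t = w v)"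
proof -
  let ?s = "\<lambda>j. real j * T / real n"
  have mono: "?s i \<le> ?s (Suc i)" for i
    using assms by (simp add: field_simps)
  obtain j where j: "j < n" "?s j < t" "t \<le> ?s (Suc j)"
    using step_cover[of ?s t n] assms by auto
  have "right_grid n T w t = w (?s (Suc j))" for w
    unfolding right_grid_def
    by (rule step_sum_eq[where s="?s" and c="\<lambda>j. w (?s (Suc j))", OF mono j])
  moreover have "?s (Suc j) \<le> t + T / real n"
    using j(2) assms by (simp add: field_simps)
  ultimately show ?thesis using j(3) by blast
qed

lemma right_grid_outside:
  assumes "0 < n" "0 \<le> T" "t \<le> 0 \<or> T < t"
  shows "right_grid n T w t = 0"
proof -
  have "real i * T / real n \<le> real (Suc i) * T / real n" for i
    using assms by (simp add: field_simps)
  then show ?thesis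
    unfolding right_grid_def
    using assms step_sum_eq_0[where s="\<lambda>j. real j * T / real n" and m=n and u=t
        and c="\<lambda>j. w (real (Suc j) * T / real n)"] by auto
qed

lemma
  assumes "0 < n" "0 \<le> T"
  shows right_grid_integrable: "integrable lborel (right_grid n T w)"
    and right_grid_integral:
      "(LINT t|lborel. right_grid n T w t) = T * ((\<Sum>j<n. w (real (Suc j) * T / real n)) / real n)"
proof -
  have le: "real i * T / real n \<le> real (Suc i) * T / real n" for i
    using assms by (simp add: field_simps)
  have "has_bochner_integral lborel (\<lambda>t. w (real (Suc j) * T / real n) *
      indicator {real j * T / real n<..real (Suc j) * T / real n} t)
      (w (real (Suc j) * T / real n) * (T / real n))" for j
  proof -
    have "measure lborel {real j * T / real n<..real (Suc j) * T / real n} = T / real n"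
      using le[of j] by (simp add: field_simps add_divide_distrib)
    then have "has_bochner_integral lborel
        (indicator {real j * T / real n<..real (Suc j) * T / real n}) (T / real n)"
      using has_bochner_integral_real_indicator[of "{real j * T / real n<..real (Suc j) * T / real n}" lborel] le[of j]
      by simp
    then show ?thesis by (intro has_bochner_integral_mult_right) auto
  qed
  then have "has_bochner_integral lborel (right_grid n T w)
      (\<Sum>j<n. w (real (Suc j) * T / real n) * (T / real n))"
    unfolding right_grid_def by (intro has_bochner_integral_sum)
  then show "integrable lborel (right_grid n T w)"
    "(LINT t|lborel. right_grid n T w t) = T * ((\<Sum>j<n. w (real (Suc j) * T / real n)) / real n)"
    by (auto simp: has_bochner_integral_iff sum_divide_distrib sum_distrib_left mult.commute)
qed

text \<open>The positive part is 1-Lipschitz. Integrability of \<open>X\<close> is inherited from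
  \<open>Y\<close> through their finite L1 distance.\<close>

lemma (in prob_space) expectation_positive_part_diff_le:
  assumes [measurable]: "X \<in> borel_measurable M" and Y: "integrable M Y"
    and d: "(\<integral>\<^sup>+\<omega>. ennreal \<bar>X \<omega> - Y \<omega>\<bar> \<partial>M) \<le> ennreal d" "0 \<le> d"
  shows "\<bar>expectation (\<lambda>\<omega>. max 0 (X \<omega>)) - expectation (\<lambda>\<omega>. max 0 (Y \<omega>))\<bar> \<le> d"
proof -
  have [measurable]: "Y \<in> borel_measurable M" using Y by auto
  have XY: "integrable M (\<lambda>\<omega>. X \<omega> - Y \<omega>)"
    using d by (intro integrableI_bounded) (auto intro: le_less_trans)
  have X: "integrable M X"
    using Bochner_Integration.integrable_add[OF XY Y] by simp
  have "\<bar>expectation (\<lambda>\<omega>. max 0 (X \<omega>)) - expectation (\<lambda>\<omega>. max 0 (Y \<omega>))\<bar> =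
      \<bar>expectation (\<lambda>\<omega>. max 0 (X \<omega>) - max 0 (Y \<omega>))\<bar>"
    using X Y by simp
  also have "\<dots> \<le> expectation (\<lambda>\<omega>. \<bar>max 0 (X \<omega>) - max 0 (Y \<omega>)\<bar>)"
    by (rule integral_abs_bound)
  also have "\<dots> \<le> expectation (\<lambda>\<omega>. \<bar>X \<omega> - Y \<omega>\<bar>)"
    using X Y XY by (intro integral_mono) auto
  also have "\<dots> \<le> d"
    using XY d by (subst (asm) nn_integral_eq_integral) (auto simp: ennreal_le_iff)
  finally show ?thesis .
qed

section \<open>Comparison of the payoff with its Gaussian grid approximation\<close>

context cev_setting
begin

text \<open>\<open>P\<close> agrees with \<open>S\<close> only almost everywhere and
  \<open>M\<close> is not assumed complete, so \<open>S\<close> itself is treated: all its paths are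
  continuous, hence it is a pointwise limit of jointly measurable step functions.\<close>

lemma S_integral_measurable:
  assumes T: "0 < T"
  shows "(\<lambda>\<omega>. LINT t:{0..T}|lborel. S t \<omega>) \<in> borel_measurable M"
proof -
  let ?g = "\<lambda>n (t, \<omega>). right_grid (Suc n) T (\<lambda>u. S u \<omega>) t"
  \<comment> \<open>The interval is open at 0 because the step functions vanish there; this changes
    the integral by a null set only.\<close>
  let ?h = "\<lambda>(t, \<omega>). indicator {0<..T} t * S t \<omega>"
  have meas: "?g n \<in> borel_measurable (borel \<Otimes>\<^sub>M M)" for n
  proof -
    have [measurable]: "S (real (Suc j) * T / real (Suc n)) \<in> borel_measurable M" for j
      using T by (intro S_measurable) simp
    show ?thesis unfolding right_grid_def case_prod_beta' by measurable
  qed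
  have lim: "(\<lambda>n. ?g n p) \<longlonglongrightarrow> ?h p" if "p \<in> space (borel \<Otimes>\<^sub>M M)" for p
  proof -
    obtain t \<omega> where p: "p = (t, \<omega>)" by (cases p)
    with that have \<omega>: "\<omega> \<in> space M" by (simp add: space_pair_measure)
    show ?thesis
    proof (cases "t \<in> {0<..T}")
      case True
      then have t: "0 < t" "t \<le> T" by auto
      have "\<forall>n. \<exists>v. t \<le> v \<and> v \<le> t + T / real (Suc n) \<and> (\<forall>w. right_grid (Suc n) T w t = w v)"
        using right_grid_eq[OF _ t] by blast
      then obtain v where v: "\<And>n. t \<le> v n" "\<And>n. v n \<le> t + T / real (Suc n)"
        "\<And>n w. right_grid (Suc n) T w t = w (v n)"
        by metis
      have "(\<lambda>n. t + T / real (Suc n)) \<longlonglongrightarrow> t + 0"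
        by (intro tendsto_add tendsto_const LIMSEQ_Suc[OF lim_const_over_n])
      then have "v \<longlonglongrightarrow> t"
        using v(1,2) by (intro tendsto_sandwich[of "\<lambda>_. t" v sequentially "\<lambda>n. t + T / real (Suc n)"]) auto
      then have "(\<lambda>n. S (v n) \<omega>) \<longlonglongrightarrow> S t \<omega>"
        using t v(1) by (intro continuous_on_tendsto_compose[OF S_continuous[OF \<omega>]])
          (auto intro!: always_eventually intro: order_trans less_imp_le)
      then show ?thesis using True by (simp add: p v(3))
    next
      case False
      then show ?thesis using T by (auto simp: p right_grid_outside)
    qed
  qed
  have h: "?h \<in> borel_measurable (borel \<Otimes>\<^sub>M M)"
    by (rule borel_measurable_LIMSEQ_real[OF lim meas])
  then have "(\<lambda>\<omega>. LINT t|lborel. ?h (t, \<omega>)) \<in> borel_measurable M"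
    by measurable
  moreover have "(LINT t:{0..T}|lborel. S t \<omega>) = (LINT t|lborel. ?h (t, \<omega>))" if "\<omega> \<in> space M" for \<omega>
  proof -
    have [measurable]: "(\<lambda>t. ?h (t, \<omega>)) \<in> borel_measurable borel"
      using measurable_compose[OF measurable_Pair2'[OF that] h] by simp
    have "set_integrable lborel {0..T} (\<lambda>t. S t \<omega>)"
      using S_continuous[OF that]
      by (intro borel_integrable_atLeastAtMost') (auto elim: continuous_on_subset)
    then have [measurable]: "(\<lambda>t. indicator {0..T} t * S t \<omega>) \<in> borel_measurable borel"
      by (auto simp: set_integrable_def dest: borel_measurable_integrable)
    show ?thesis
      unfolding set_lebesgue_integral_def real_scaleR_def
    proof (rule integral_cong_AE)
      show "AE t in lborel. indicator {0..T} t * S t \<omega> = ?h (t, \<omega>)"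
        using AE_lborel_singleton[of 0] by eventually_elim (auto simp: indicator_def)
    qed measurable
  qed
  ultimately show ?thesis
    by (subst measurable_cong) auto
qed

text \<open>Both averages become time integrals over \<open>[0, T]\<close>. The integrand error at
  time \<open>t\<close> is the expansion error plus a Brownian increment over at most one cell
  length. One \<open>C * T\<close> comes from the terminal value and one from the average.\<close>

lemma discretization_error:
  assumes C: "0 \<le> C" and t0: "t0 \<le> 1"
    and bound: "\<forall>t\<in>{0<..t0}. (\<integral>\<^sup>+\<omega>. ennreal \<bar>P t \<omega> - S0 - a * W t \<omega>\<bar> \<partial>M) \<le> ennreal (C * t)"
    and T: "0 < T" "T \<le> t0" and n: "0 < n" and a: "0 \<le> a"
  shows "(\<integral>\<^sup>+\<omega>. ennreal \<bar>(S T \<omega> - 1 / T * (LINT t:{0..T}|lborel. S t \<omega>))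
      - a * (W T \<omega> - grid_average n T \<omega>)\<bar> \<partial>M) \<le> ennreal (2 * C * T + a * sqrt (T / real n))"
proof -
  let ?V = "\<lambda>t \<omega>. right_grid n T (\<lambda>u. W u \<omega>) t"
  let ?f = "\<lambda>t \<omega>. ennreal \<bar>P t \<omega> - S0 - a * ?V t \<omega>\<bar>"
  have W_meas: "W t \<in> borel_measurable M" if "0 \<le> t" for t by (rule W_measurable[OF that])
  have f_meas: "(\<lambda>(t, \<omega>). ?f t \<omega>) \<in> borel_measurable (borel \<Otimes>\<^sub>M M)"
  proof -
    have [measurable]: "W (real (Suc j) * T / real n) \<in> borel_measurable M" for j
      using T by (intro W_meas) simp
    show ?thesis unfolding right_grid_def by measurable
  qed
  have inner: "(\<integral>\<^sup>+\<omega>. ?f t \<omega> \<partial>M) \<le> ennreal (C * T + a * sqrt (T / real n))" if t: "0 < t" "t \<le> T" for t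
  proof -
    obtain v where v: "t \<le> v" "v \<le> t + T / real n" "\<And>w. right_grid n T w t = w v"
      using right_grid_eq[OF n t] by blast
    have [measurable]: "W v \<in> borel_measurable M" "W t \<in> borel_measurable M"
      using v t by (auto intro!: W_meas)
    \<comment> \<open>The factor 1 puts the sum into the form of
      \<open>nn_integral_lincomb\<close>.\<close>
    have "(\<integral>\<^sup>+\<omega>. ?f t \<omega> \<partial>M) \<le>
        (\<integral>\<^sup>+\<omega>. 1 * ennreal \<bar>P t \<omega> - S0 - a * W t \<omega>\<bar> + ennreal a * ennreal \<bar>W v \<omega> - W t \<omega>\<bar> \<partial>M)"
    proof (rule nn_integral_mono)
      fix \<omega>
      have "P t \<omega> - S0 - a * W v \<omega> = (P t \<omega> - S0 - a * W t \<omega>) - a * (W v \<omega> - W t \<omega>)"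
        by (simp add: algebra_simps)
      then have "\<bar>P t \<omega> - S0 - a * W v \<omega>\<bar> \<le> \<bar>P t \<omega> - S0 - a * W t \<omega>\<bar> + a * \<bar>W v \<omega> - W t \<omega>\<bar>"
        using a by (metis abs_mult abs_of_nonneg abs_triangle_ineq4)
      then show "?f t \<omega> \<le> 1 * ennreal \<bar>P t \<omega> - S0 - a * W t \<omega>\<bar> + ennreal a * ennreal \<bar>W v \<omega> - W t \<omega>\<bar>"
        using a by (simp add: v(3) ennreal_mult[symmetric] ennreal_plus[symmetric] ennreal_leI del: ennreal_plus)
    qed
    also have "\<dots> = 1 * (\<integral>\<^sup>+\<omega>. ennreal \<bar>P t \<omega> - S0 - a * W t \<omega>\<bar> \<partial>M) +
        ennreal a * (\<integral>\<^sup>+\<omega>. ennreal \<bar>W v \<omega> - W t \<omega>\<bar> \<partial>M)"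
      by (rule nn_integral_lincomb) measurable
    also have "\<dots> \<le> 1 * ennreal (C * T) + ennreal a * ennreal (sqrt (T / real n))"
    proof (intro add_mono mult_left_mono)
      have "(\<integral>\<^sup>+\<omega>. ennreal \<bar>P t \<omega> - S0 - a * W t \<omega>\<bar> \<partial>M) \<le> ennreal (C * t)"
        by (rule bound[rule_format]) (use t T in simp)
      also have "\<dots> \<le> ennreal (C * T)"
        using C t by (intro ennreal_leI mult_left_mono)
      finally show "(\<integral>\<^sup>+\<omega>. ennreal \<bar>P t \<omega> - S0 - a * W t \<omega>\<bar> \<partial>M) \<le> ennreal (C * T)" .
      have "(\<integral>\<^sup>+\<omega>. ennreal \<bar>W v \<omega> - W t \<omega>\<bar> \<partial>M) \<le> ennreal (sqrt (v - t))"
        by (rule increment_abs_expectation_le) (use t v in auto)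
      also have "\<dots> \<le> ennreal (sqrt (T / real n))"
        using v(2) by (intro ennreal_leI real_sqrt_le_mono) simp
      finally show "(\<integral>\<^sup>+\<omega>. ennreal \<bar>W v \<omega> - W t \<omega>\<bar> \<partial>M) \<le> ennreal (sqrt (T / real n))" .
    qed auto
    also have "\<dots> = ennreal (C * T + a * sqrt (T / real n))"
      using a C T by (simp add: ennreal_mult[symmetric] ennreal_plus[symmetric] del: ennreal_plus)
    finally show ?thesis .
  qed
  let ?X = "\<lambda>\<omega>. P T \<omega> - S0 - a * W T \<omega>"
  have [measurable]: "W T \<in> borel_measurable M" using T by (intro W_meas) simp
  have pt: "AE \<omega> in M. ennreal \<bar>(S T \<omega> - 1 / T * (LINT t:{0..T}|lborel. S t \<omega>))
      - a * (W T \<omega> - grid_average n T \<omega>)\<bar> \<le>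
      1 * ennreal \<bar>?X \<omega>\<bar> + ennreal (1 / T) * (\<integral>\<^sup>+t\<in>{0..T}. ?f t \<omega> \<partial>lborel)"
    using P_eq_S P_continuous
  proof eventually_elim
    case (elim \<omega>)
    have P_int: "integrable lborel (\<lambda>t. indicator {0..T} t * P t \<omega>)"
      using borel_integrable_atLeastAtMost'[of 0 T "\<lambda>t. P t \<omega>"] continuous_on_subset[OF elim(2), of "{0..T}"] T t0
      by (simp add: set_integrable_def)
    have c_int: "integrable lborel (\<lambda>t. indicator {0..T} t * S0)"
      using T by (intro integrable_mult_left integrable_real_indicator) (simp_all add: less_top[symmetric])
    have V_int: "integrable lborel (\<lambda>t. a * ?V t \<omega>)"
      using right_grid_integrable[OF n, of T] T by simp
    let ?g = "\<lambda>t. indicator {0..T} t * P t \<omega> - indicator {0..T} t * S0 - a * ?V t \<omega>"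
    have g_int: "integrable lborel ?g"
      using P_int c_int V_int by (intro Bochner_Integration.integrable_diff)
    have S_eq: "(LINT t:{0..T}|lborel. S t \<omega>) = (LINT t|lborel. indicator {0..T} t * P t \<omega>)"
      unfolding set_lebesgue_integral_def using elim(1) T t0
      by (intro Bochner_Integration.integral_cong) (auto simp: indicator_def)
    have "(LINT t|lborel. ?g t) = (LINT t:{0..T}|lborel. S t \<omega>) - T * S0 - a * (T * grid_average n T \<omega>)"
      using P_int c_int V_int right_grid_integral[OF n, of T "\<lambda>u. W u \<omega>"] T
      by (simp add: S_eq grid_average_def)
    then have "(S T \<omega> - 1 / T * (LINT t:{0..T}|lborel. S t \<omega>)) - a * (W T \<omega> - grid_average n T \<omega>)
        = ?X \<omega> - 1 / T * (LINT t|lborel. ?g t)"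
      using T t0 elim(1) by (simp add: field_simps)
    then have "\<bar>(S T \<omega> - 1 / T * (LINT t:{0..T}|lborel. S t \<omega>)) - a * (W T \<omega> - grid_average n T \<omega>)\<bar>
        \<le> \<bar>?X \<omega>\<bar> + 1 / T * \<bar>LINT t|lborel. ?g t\<bar>"
      using T abs_triangle_ineq4[of "?X \<omega>" "1 / T * (LINT t|lborel. ?g t)"] by (simp add: abs_mult)
    then have "ennreal \<bar>(S T \<omega> - 1 / T * (LINT t:{0..T}|lborel. S t \<omega>)) - a * (W T \<omega> - grid_average n T \<omega>)\<bar>
        \<le> 1 * ennreal \<bar>?X \<omega>\<bar> + ennreal (1 / T) * ennreal \<bar>LINT t|lborel. ?g t\<bar>"
      using T by (subst mult_1, subst ennreal_mult[symmetric])
        (auto simp: ennreal_plus[symmetric] simp del: ennreal_plus intro!: ennreal_leI)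
    also have "\<dots> \<le> 1 * ennreal \<bar>?X \<omega>\<bar> + ennreal (1 / T) * (\<integral>\<^sup>+t\<in>{0..T}. ?f t \<omega> \<partial>lborel)"
    proof (intro add_mono mult_left_mono order_refl)
      have "ennreal \<bar>LINT t|lborel. ?g t\<bar> \<le> (\<integral>\<^sup>+t. ennreal (norm (?g t)) \<partial>lborel)"
        using integral_norm_bound_ennreal[OF g_int] by simp
      \<comment> \<open>Off the interval all three terms of \<open>?g\<close> vanish, the last one
        by \<open>right_grid_outside\<close>.\<close>
      also have "\<dots> = (\<integral>\<^sup>+t\<in>{0..T}. ?f t \<omega> \<partial>lborel)"
        using T n by (intro nn_integral_cong) (auto simp: indicator_def right_grid_outside not_le)
      finally show "ennreal \<bar>LINT t|lborel. ?g t\<bar> \<le> (\<integral>\<^sup>+t\<in>{0..T}. ?f t \<omega> \<partial>lborel)" .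
    qed auto
    finally show ?case .
  qed
  have f_meas1: "(\<lambda>\<omega>. \<integral>\<^sup>+t\<in>{0..T}. ?f t \<omega> \<partial>lborel) \<in> borel_measurable M"
    using f_meas by measurable
  have "(\<integral>\<^sup>+\<omega>. ennreal \<bar>(S T \<omega> - 1 / T * (LINT t:{0..T}|lborel. S t \<omega>))
      - a * (W T \<omega> - grid_average n T \<omega>)\<bar> \<partial>M) \<le>
      (\<integral>\<^sup>+\<omega>. 1 * ennreal \<bar>?X \<omega>\<bar> + ennreal (1 / T) * (\<integral>\<^sup>+t\<in>{0..T}. ?f t \<omega> \<partial>lborel) \<partial>M)"
    by (rule nn_integral_mono_AE[OF pt])
  also have "\<dots> = 1 * (\<integral>\<^sup>+\<omega>. ennreal \<bar>?X \<omega>\<bar> \<partial>M) +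
      ennreal (1 / T) * (\<integral>\<^sup>+\<omega>. (\<integral>\<^sup>+t\<in>{0..T}. ?f t \<omega> \<partial>lborel) \<partial>M)"
    by (rule nn_integral_lincomb[OF _ f_meas1]) measurable
  also have "\<dots> \<le> 1 * ennreal (C * T) + ennreal (1 / T) * ennreal ((C * T + a * sqrt (T / real n)) * T)"
  proof (intro add_mono mult_left_mono)
    show "(\<integral>\<^sup>+\<omega>. ennreal \<bar>?X \<omega>\<bar> \<partial>M) \<le> ennreal (C * T)"
      by (rule bound[rule_format]) (use T in simp)
    show "(\<integral>\<^sup>+\<omega>. (\<integral>\<^sup>+t\<in>{0..T}. ?f t \<omega> \<partial>lborel) \<partial>M) \<le> ennreal ((C * T + a * sqrt (T / real n)) * T)"
      by (rule nn_integral_time_le[OF f_meas _ _ inner]) (use T C a in auto)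
  qed auto
  also have "\<dots> = ennreal (C * T + 1 / T * ((C * T + a * sqrt (T / real n)) * T))"
  proof -
    have "0 \<le> C * T" "0 \<le> 1 / T" "0 \<le> (C * T + a * sqrt (T / real n)) * T" using C T a by auto
    then show ?thesis by (simp only: mult_1 ennreal_mult[symmetric] ennreal_plus[symmetric] mult_nonneg_nonneg)
  qed
  also have "C * T + 1 / T * ((C * T + a * sqrt (T / real n)) * T) = 2 * C * T + a * sqrt (T / real n)"
    using T by simp
  finally show ?thesis .
qed

end

subsection \<open>Asymptotics of the option prices\<close>

lemma grid_deviation_tendsto:
  "(\<lambda>n. sqrt (T * (real n - 1) * (2 * real n - 1) / (6 * (real n)\<^sup>2))) \<longlonglongrightarrow> sqrt (T / 3)"
proof -
  have "(\<lambda>n. sqrt (T * (1 - 1 / real n) * (2 - 1 / real n) / 6)) \<longlonglongrightarrow> sqrt (T * (1 - 0) * (2 - 0) / 6)"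
    by (intro tendsto_intros lim_const_over_n) auto
  then have "(\<lambda>n. sqrt (T * (1 - 1 / real n) * (2 - 1 / real n) / 6)) \<longlonglongrightarrow> sqrt (T / 3)"
    by simp
  moreover have "eventually (\<lambda>n. sqrt (T * (1 - 1 / real n) * (2 - 1 / real n) / 6) =
      sqrt (T * (real n - 1) * (2 * real n - 1) / (6 * (real n)\<^sup>2))) sequentially"
    using eventually_gt_at_top[of 0]
    by eventually_elim (simp add: field_simps power2_eq_square)
  ultimately show ?thesis
    by (rule Lim_transform_eventually)
qed

context cev_setting
begin

text \<open>For fixed \<open>T\<close> the comparison holds for every \<open>n \<ge> 2\<close>,
  while the expectation of the payoff does not involve \<open>n\<close>. Letting \<open>n\<close>
  grow removes the grid error and turns the standard deviation into
  \<open>a * sqrt (T / 3)\<close>.\<close>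

lemma positive_part_asymptotics:
  obtains C t0 where "0 \<le> C" "0 < t0" "t0 \<le> 1"
    "\<forall>T\<in>{0<..t0}. \<bar>expectation (\<lambda>\<omega>. max 0 (S T \<omega> - 1 / T * (LINT t:{0..T}|lborel. S t \<omega>)))
      - \<sigma> * S0 powr \<beta> * (sqrt T / sqrt (6 * pi))\<bar> \<le> C * T"
    "\<forall>T\<in>{0<..t0}. \<bar>expectation (\<lambda>\<omega>. max 0 (1 / T * (LINT t:{0..T}|lborel. S t \<omega>) - S T \<omega>))
      - \<sigma> * S0 powr \<beta> * (sqrt T / sqrt (6 * pi))\<bar> \<le> C * T"
proof -
  define a where "a = \<sigma> * S0 powr \<beta>"
  have a: "0 < a" using \<sigma> S0 by (simp add: a_def)
  obtain C t0 where C: "0 \<le> C" and t0: "0 < t0" "t0 \<le> 1"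
    and bound: "\<forall>t\<in>{0<..t0}. (\<integral>\<^sup>+\<omega>. ennreal \<bar>P t \<omega> - S0 - \<sigma> * S0 powr \<beta> * W t \<omega>\<bar> \<partial>M) \<le> ennreal (C * t)"
    by (rule first_order_expansion)
  have main: "\<bar>expectation (\<lambda>\<omega>. max 0 (S T \<omega> - 1 / T * (LINT t:{0..T}|lborel. S t \<omega>))) - a * (sqrt T / sqrt (6 * pi))\<bar> \<le> 2 * C * T"
    "\<bar>expectation (\<lambda>\<omega>. max 0 (1 / T * (LINT t:{0..T}|lborel. S t \<omega>) - S T \<omega>)) - a * (sqrt T / sqrt (6 * pi))\<bar> \<le> 2 * C * T"
    if T: "0 < T" "T \<le> t0" for T
  proof -
    define Q where "Q \<omega> = S T \<omega> - 1 / T * (LINT t:{0..T}|lborel. S t \<omega>)" for \<omega>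
    define Y where "Y n \<omega> = a * (W T \<omega> - grid_average n T \<omega>)" for n \<omega>
    define v where "v n = sqrt (T * (real n - 1) * (2 * real n - 1) / (6 * (real n)\<^sup>2))" for n
    have [measurable]: "S T \<in> borel_measurable M" "(\<lambda>\<omega>. LINT t:{0..T}|lborel. S t \<omega>) \<in> borel_measurable M"
      using T by (simp_all add: S_measurable S_integral_measurable)
    have Q_meas[measurable]: "Q \<in> borel_measurable M"
      unfolding Q_def by (intro borel_measurable_diff borel_measurable_times) measurable
    have est: "\<bar>expectation (\<lambda>\<omega>. max 0 (Q \<omega>)) - a * (v n / sqrt (2 * pi))\<bar> \<le> 2 * C * T + a * sqrt (T / real n)"
      "\<bar>expectation (\<lambda>\<omega>. max 0 (- Q \<omega>)) - a * (v n / sqrt (2 * pi))\<bar> \<le> 2 * C * T + a * sqrt (T / real n)"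
      if n: "2 \<le> n" for n
    proof -
      let ?d = "2 * C * T + a * sqrt (T / real n)"
      have v: "0 < v n" using n T by (simp add: v_def)
      have dist: "distributed M lborel (Y n) (normal_density 0 (a * v n))"
        using normal_density_affine[OF grid_distributed[OF n T(1)], of a 0] v a
        by (simp add: Y_def[abs_def] v_def)
      have av: "0 < a * v n" using a v by simp
      have Y_meas[measurable]: "Y n \<in> borel_measurable M"
        using dist by (simp add: distributed_def)
      have Y_int: "integrable M (Y n)"
        using normal_abs_integrable[OF dist av] by (simp add: integrable_abs_iff)
      have d: "0 \<le> ?d" using C T a by simp
      have err: "(\<integral>\<^sup>+\<omega>. ennreal \<bar>Q \<omega> - Y n \<omega>\<bar> \<partial>M) \<le> ennreal ?d"
        unfolding Q_def Y_def using n a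
        by (intro discretization_error[OF C t0(2) bound[folded a_def] T]) auto
      \<comment> \<open>The put payoff is the positive part of \<open>- Q\<close>, so it is compared
        with \<open>- Y n\<close> at the same distance.\<close>
      have err': "(\<integral>\<^sup>+\<omega>. ennreal \<bar>- Q \<omega> - - Y n \<omega>\<bar> \<partial>M) \<le> ennreal ?d"
        using err by (simp add: abs_minus_commute)
      show "\<bar>expectation (\<lambda>\<omega>. max 0 (Q \<omega>)) - a * (v n / sqrt (2 * pi))\<bar> \<le> ?d"
        using expectation_positive_part_diff_le[OF Q_meas Y_int err d] normal_positive_part[OF dist av] by simp
      show "\<bar>expectation (\<lambda>\<omega>. max 0 (- Q \<omega>)) - a * (v n / sqrt (2 * pi))\<bar> \<le> ?d"
        using expectation_positive_part_diff_le[OF _ _ err' d] Y_int normal_negative_part[OF dist av] by simp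
    qed
    have "(\<lambda>n. a * (v n / sqrt (2 * pi))) \<longlonglongrightarrow> a * (sqrt (T / 3) / sqrt (2 * pi))"
      unfolding v_def by (intro tendsto_intros grid_deviation_tendsto) auto
    also have "sqrt (T / 3) / sqrt (2 * pi) = sqrt T / sqrt (6 * pi)"
      by (simp add: real_sqrt_divide[symmetric])
    finally have lim: "(\<lambda>n. a * (v n / sqrt (2 * pi))) \<longlonglongrightarrow> a * (sqrt T / sqrt (6 * pi))" .
    have rhs: "(\<lambda>n. 2 * C * T + a * sqrt (T / real n)) \<longlonglongrightarrow> 2 * C * T"
      using tendsto_add[OF tendsto_const tendsto_mult[OF tendsto_const tendsto_real_sqrt[OF lim_const_over_n[of T]]], of "2 * C * T" a]
      by simp
    \<comment> \<open>Stated for an arbitrary number \<open>e\<close>, so that it serves both the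
      call and the put.\<close>
    have limit: "\<bar>e - a * (sqrt T / sqrt (6 * pi))\<bar> \<le> 2 * C * T"
      if "\<And>n. 2 \<le> n \<Longrightarrow> \<bar>e - a * (v n / sqrt (2 * pi))\<bar> \<le> 2 * C * T + a * sqrt (T / real n)" for e
      by (rule LIMSEQ_le[OF tendsto_rabs[OF tendsto_diff[OF tendsto_const lim]] rhs]) (use that in blast)
    show "\<bar>expectation (\<lambda>\<omega>. max 0 (S T \<omega> - 1 / T * (LINT t:{0..T}|lborel. S t \<omega>))) - a * (sqrt T / sqrt (6 * pi))\<bar> \<le> 2 * C * T"
      using limit[OF est(1)] by (simp add: Q_def)
    show "\<bar>expectation (\<lambda>\<omega>. max 0 (1 / T * (LINT t:{0..T}|lborel. S t \<omega>) - S T \<omega>)) - a * (sqrt T / sqrt (6 * pi))\<bar> \<le> 2 * C * T"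
      using limit[OF est(2)] by (simp add: Q_def)
  qed
  show thesis
    by (rule that[of "2 * C" t0]) (use C t0 main in \<open>auto simp: a_def\<close>)
qed

end

text \<open>The discount factor differs from 1 by at most \<open>r * T\<close>, and the leading term
  is at most \<open>a\<close> for \<open>T \<le> 1\<close>, so discounting costs at most
  \<open>a * r * T\<close>.\<close>

lemma discounted_bigo:
  fixes e :: "real \<Rightarrow> real"
  assumes "0 \<le> r" "0 \<le> C" "0 < t0" "t0 \<le> 1" "0 \<le> a"
    and bound: "\<forall>T\<in>{0<..t0}. \<bar>e T - a * (sqrt T / sqrt (6 * pi))\<bar> \<le> C * T"
  shows "(\<lambda>T. exp (- r * T) * e T - a * (sqrt T / sqrt (6 * pi))) \<in> O[at_right 0](\<lambda>T. T)"
proof (rule bigoI[where c="C + a * r"])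
  have "eventually (\<lambda>T. T \<in> {0<..<t0}) (at_right 0)"
    using assms(3) by (rule eventually_at_right_real)
  then show "eventually (\<lambda>T. norm (exp (- r * T) * e T - a * (sqrt T / sqrt (6 * pi))) \<le> (C + a * r) * norm T) (at_right 0)"
  proof eventually_elim
    case (elim T)
    define m where "m = a * (sqrt T / sqrt (6 * pi))"
    have T: "0 < T" "T \<le> 1" using elim assms by auto
    have "sqrt T \<le> 1" using T by simp
    moreover have "1 \<le> sqrt (6 * pi)" using pi_gt3 by simp
    ultimately have "sqrt T / sqrt (6 * pi) \<le> 1" by (simp add: divide_le_eq)
    then have m: "0 \<le> m" "m \<le> a"
      using mult_left_mono[of "sqrt T / sqrt (6 * pi)" 1 a] assms T by (simp_all add: m_def)
    have ex: "0 < exp (- r * T)" "exp (- r * T) \<le> 1" "1 - exp (- r * T) \<le> r * T"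
      using assms T exp_ge_add_one_self[of "- r * T"] by auto
    have "exp (- r * T) * e T - m = exp (- r * T) * (e T - m) - m * (1 - exp (- r * T))"
      by (simp add: algebra_simps)
    also have "\<bar>\<dots>\<bar> \<le> \<bar>exp (- r * T) * (e T - m)\<bar> + \<bar>m * (1 - exp (- r * T))\<bar>"
      by (rule abs_triangle_ineq4)
    also have "\<dots> \<le> 1 * (C * T) + a * (r * T)"
      using ex m bound elim assms
      by (simp only: abs_mult, intro add_mono mult_mono) (auto simp: m_def)
    finally show ?case using T by (simp add: m_def algebra_simps)
  qed
qed

theorem theorem16:
  fixes M :: "'a measure" and F :: "real \<Rightarrow> 'a measure"
    and W S :: "real \<Rightarrow> 'a \<Rightarrow> real" and r q \<sigma> \<beta> S0 :: real
  assumes "filtered_prob_space M F"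
    and "brownian_motion M F W"
    and "r \<ge> 0" and "q \<ge> 0" and "\<sigma> > 0"
    and "1 / 2 \<le> \<beta>" and "\<beta> < 1"
    and "S0 > 0"
    and "cev_model M F W r q \<sigma> \<beta> S0 S"
  shows "(\<lambda>T. floating_call M r S 1 T - \<sigma> * S0 powr \<beta> * (sqrt T / sqrt (6 * pi))) \<in> O[at_right 0](\<lambda>T. T) \<and>
         (\<lambda>T. floating_put M r S 1 T - \<sigma> * S0 powr \<beta> * (sqrt T / sqrt (6 * pi))) \<in> O[at_right 0](\<lambda>T. T)"
proof -
  interpret cev_setting M F W S r q \<sigma> \<beta> S0
    by unfold_locales fact+
  obtain C t0 where C: "0 \<le> C" "0 < t0" "t0 \<le> 1"
    and call: "\<forall>T\<in>{0<..t0}. \<bar>expectation (\<lambda>\<omega>. max 0 (S T \<omega> - 1 / T * (LINT t:{0..T}|lborel. S t \<omega>)))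
      - \<sigma> * S0 powr \<beta> * (sqrt T / sqrt (6 * pi))\<bar> \<le> C * T"
    and put: "\<forall>T\<in>{0<..t0}. \<bar>expectation (\<lambda>\<omega>. max 0 (1 / T * (LINT t:{0..T}|lborel. S t \<omega>) - S T \<omega>))
      - \<sigma> * S0 powr \<beta> * (sqrt T / sqrt (6 * pi))\<bar> \<le> C * T"
    by (rule positive_part_asymptotics)
  have a: "0 \<le> \<sigma> * S0 powr \<beta>" using assms by simp
  show ?thesis
    using discounted_bigo[OF assms(3) C a call] discounted_bigo[OF assms(3) C a put]
    by (simp add: floating_call_def[abs_def] floating_put_def[abs_def])
qed

end
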